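(* Let $n \geq 1$ and $d \geq 0$ be integers. Let $P(z,\bar z)$ be a (complex-valued) polynomial of bidegree at most $(1,1)$ on $\mathbb{C}^n$ whose zero set $\{z \in \mathbb{C}^n : P(z,\bar z)=0\}$ is nonempty. Let $p$ be a point of the zero set of $P$, and let $Q(z,\bar z) \not\equiv 0$ be a (complex-valued) real-analytic function defined in a connected neighborhood of $p$ in $\mathbb{C}^n$. Then $$\operatorname{rank}(Q P^d) \;\geq\; \operatorname{rank}(P^d) \;=\; \binom{\operatorname{rank} P + d - 1}{d}.$$
   Context: A polynomial $P(z,\bar z)$ in $z=(z_1,\dots,z_n)$ and $\bar z$ with complex coefficients has bidegree $(j,k)$ if its total degree in $z$ is $j$ and its total degree in $\bar z$ is $k$; "bidegree at most $(1,1)$" means degree at most $1$ in $z$ and degree at most $1$ in $\bar z$. Rank (hermitian rank): let $U \subset \mathbb{C}^n$ be a domain (open, connected) and $R\colon U \to \mathbb{C}$ real-analytic. The rank of $R$ at $p\in U$ is the smallest $r \in \{0,1,2,\dots\}\cup\{\infty\}$ such that there exist a neighborhood $W$ of $p$ and holomorphic maps $\phi,\psi\colon W \to \mathbb{C}^r$ with $R(z,\bar z)=\sum_{k=1}^r \phi_k(z)\overline{\psi_k(z)}$ on $W$ (an infinite sum if $r=\infty$). The rank does not depend on the point $p \in U$, and one writes $\operatorname{rank} R$. Conventions: $P^0=1$, and $\binom{m+d-1}{d}$ is the number of monomials of degree $d$ in $m$ variables (so it is $1$ when $d=0$, including $m=0$). *)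

theory Defs
  imports "HOL-Analysis.Analysis" "HOL-Library.Extended_Nat"
begin

text \<open>Functions of \<open>z\<close> and its conjugate on \<open>n\<close>-dimensional complex space are modelled as functions on
  \<^typ>\<open>complex ^ 'n\<close>. Multi-indices are functions \<^typ>\<open>'n \<Rightarrow> nat\<close>.\<close>

text \<open>Holomorphy in several variables, for open \<open>W\<close>: the (real) Frechet derivative exists at each
  point and is complex linear.\<close>

definition holomorphic_several_on :: "(complex ^ 'n \<Rightarrow> complex) \<Rightarrow> (complex ^ 'n) set \<Rightarrow> bool"
  where "holomorphic_several_on f W \<longleftrightarrow>
    (\<forall>z\<in>W. \<exists>f'. (f has_derivative f') (at z) \<and> (\<forall>c v. f' (c *s v) = c * f' v))"

text \<open>Near each point of the open set \<open>U\<close>, the function is the sum of a convergent power series in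
  the \<open>2n\<close> real coordinates (\<open>has_sum\<close> is unconditional, hence absolute, convergence).\<close>

definition real_analytic_on :: "(complex ^ 'n \<Rightarrow> complex) \<Rightarrow> (complex ^ 'n) set \<Rightarrow> bool"
  where "real_analytic_on f U \<longleftrightarrow>
    (\<forall>p\<in>U. \<exists>(c :: ('n \<Rightarrow> nat) \<Rightarrow> ('n \<Rightarrow> nat) \<Rightarrow> complex). \<exists>e>0. \<forall>z\<in>ball p e.
      ((\<lambda>(\<alpha>, \<beta>). c \<alpha> \<beta> * (\<Prod>i\<in>UNIV. complex_of_real (Re (z $ i - p $ i)) ^ \<alpha> i)
                       * (\<Prod>i\<in>UNIV. complex_of_real (Im (z $ i - p $ i)) ^ \<beta> i)) has_sum f z) UNIV)"

definition polynomial_bidegree_le :: "nat \<Rightarrow> nat \<Rightarrow> (complex ^ 'n \<Rightarrow> complex) \<Rightarrow> bool"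
  where "polynomial_bidegree_le j k P \<longleftrightarrow>
    (\<exists>(c :: ('n \<Rightarrow> nat) \<Rightarrow> ('n \<Rightarrow> nat) \<Rightarrow> complex). \<forall>z.
      P z = (\<Sum>\<alpha> | (\<Sum>i\<in>UNIV. \<alpha> i) \<le> j. \<Sum>\<beta> | (\<Sum>i\<in>UNIV. \<beta> i) \<le> k.
               c \<alpha> \<beta> * (\<Prod>i\<in>UNIV. (z $ i) ^ \<alpha> i) * (\<Prod>i\<in>UNIV. cnj (z $ i) ^ \<beta> i)))"

text \<open>The infimum of the empty set in \<^typ>\<open>enat\<close> is \<open>\<infinity>\<close>, so the rank is \<open>\<infinity>\<close> exactly when
  there is no finite decomposition. Only the values of \<open>R\<close> near \<open>p\<close> matter.\<close>

definition hermitian_rank_at :: "complex ^ 'n \<Rightarrow> (complex ^ 'n \<Rightarrow> complex) \<Rightarrow> enat"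
  where "hermitian_rank_at p R = Inf {enat r | r.
    \<exists>W (\<phi> :: nat \<Rightarrow> complex ^ 'n \<Rightarrow> complex) \<psi>. open W \<and> p \<in> W \<and>
      (\<forall>k<r. holomorphic_several_on (\<phi> k) W \<and> holomorphic_several_on (\<psi> k) W) \<and>
      (\<forall>z\<in>W. R z = (\<Sum>k<r. \<phi> k z * cnj (\<psi> k z)))}"

text \<open>The common value of the pointwise ranks, for \<open>R\<close> real-analytic on a nonempty open connected
  set \<open>U\<close>, where the rank is independent of the point.\<close>

definition hermitian_rank :: "(complex ^ 'n) set \<Rightarrow> (complex ^ 'n \<Rightarrow> complex) \<Rightarrow> enat"
  where "hermitian_rank U R = (THE r. \<forall>p\<in>U. hermitian_rank_at p R = r)"

end

theory Submission
  imports Defs "HOL-Complex_Analysis.Complex_Analysis"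
begin

text \<open>Near each point, a real-analytic function \<open>R z\<close> is the diagonal of a function \<open>G z w\<close> holomorphic in
  \<open>z\<close> and antiholomorphic in \<open>w\<close>, and the hermitian rank of \<open>R\<close> is the least number of terms in a
  representation of \<open>G\<close> by products of functions of \<open>z\<close> and of \<open>w\<close>. By the identity theorem it is
  locally constant.

  At the zero \<open>p\<close> of \<open>P\<close>, in suitable linear coordinates \<open>x\<close> for \<open>z\<close> and \<open>y\<close> for the conjugate of \<open>w\<close>,
  the polarized \<open>P\<close> is a sum of \<open>m = rank P\<close> terms \<open>u\<^sub>k\<close>, each equal to \<open>x\<^sub>k y\<^sub>k\<close>, \<open>x\<^sub>k\<close> or \<open>y\<^sub>k\<close>, plus
  terms of higher weight, for every choice of positive weights under which all \<open>u\<^sub>k\<close> have weight 1. For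
  generic weights the part of lowest weight of \<open>Q\<close> is a monomial times a Laurent polynomial \<open>g(u)\<close>,
  homogeneous of degree 0. The coefficient matrix of \<open>Q P\<^sup>d\<close> then contains a triangular matrix whose
  diagonal consists of the nonzero coefficients of \<open>g(u) (u\<^sub>1 + \<dots> + u\<^sub>m)\<^sup>d\<close>, and any such multiple has at
  least as many terms as \<open>(u\<^sub>1 + \<dots> + u\<^sub>m)\<^sup>d\<close>.\<close>

no_notation fps_nth (infixl "$" 75)

section \<open>Separated rank\<close>

text \<open>The zero \<open>p\<close> is indispensable: for \<open>P = 1 + |z|^2\<close> and
  \<open>Q = 1 / P\<close> the product has rank 1, while \<open>P\<close> has rank 2. At a zero the
  polarized \<open>P\<close> has no constant term, so that its lowest weight part shows all
  \<open>m\<close> summands. The obstacle is that \<open>Q\<close> may vanish at \<open>p\<close>,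
  and that its leading part may cancel many terms of the power. Knowing the leading part of the
  product says little about a rank, so the weights are split unevenly between \<open>x_k\<close> and
  \<open>y_k\<close>: all \<open>u_k\<close> keep weight 1, but the weight on the \<open>x\<close>
  side alone separates the monomials in the \<open>u_k\<close> of equal degree. A matrix entry with
  its row taken from one such monomial and its column from another with larger \<open>x\<close>
  weight has total weight below the minimum and vanishes. This is the source of the triangular
  shape, and what remains is a count of nonzero coefficients.

  The separated rank asks for no regularity of the factors, so it applies to functions and to
  coefficient matrices alike. The holomorphic factors in the hermitian rank are recovered from
  sections of the function.\<close>

definition sep_rank_le :: "nat \<Rightarrow> 'a set \<Rightarrow> 'b set \<Rightarrow> ('a \<Rightarrow> 'b \<Rightarrow> complex) \<Rightarrow> bool" where
  "sep_rank_le r X Y F \<longleftrightarrow> (\<exists>f g. \<forall>x\<in>X. \<forall>y\<in>Y. F x y = (\<Sum>k<r. f k x * g k y))"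

text \<open>The Schur complement of the entry \<open>F a b\<close>, that is, one step of Gaussian
  elimination. If the entry is nonzero, the result vanishes for \<open>x = a\<close> and for
  \<open>y = b\<close>.\<close>

definition eliminate :: "'a \<Rightarrow> 'b \<Rightarrow> ('a \<Rightarrow> 'b \<Rightarrow> complex) \<Rightarrow> 'a \<Rightarrow> 'b \<Rightarrow> complex" where
  "eliminate a b F x y = F x y - F x b * (F a y / F a b)"

lemma sep_rank_le_I:
  assumes "finite I" "\<And>x y. x \<in> X \<Longrightarrow> y \<in> Y \<Longrightarrow> F x y = (\<Sum>i\<in>I. f i x * g i y)"
  shows "sep_rank_le (card I) X Y F"
proof -
  obtain h where h: "bij_betw h {..<card I} I"
    using assms(1) bij_betw_from_nat_into_finite by blast
  show ?thesis
    unfolding sep_rank_le_def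
  proof (intro exI ballI)
    fix x y assume "x \<in> X" "y \<in> Y"
    then have "F x y = (\<Sum>i\<in>I. f i x * g i y)" by (rule assms(2))
    also have "\<dots> = (\<Sum>k<card I. f (h k) x * g (h k) y)"
      using sum.reindex_bij_betw[OF h, of "\<lambda>i. f i x * g i y"] by simp
    finally show "F x y = (\<Sum>k<card I. (\<lambda>k. f (h k)) k x * (\<lambda>k. g (h k)) k y)" .
  qed
qed

lemma sep_rank_le_0: "sep_rank_le 0 X Y F \<longleftrightarrow> (\<forall>x\<in>X. \<forall>y\<in>Y. F x y = 0)"
  by (simp add: sep_rank_le_def)

lemma sep_rank_le_mono:
  assumes "sep_rank_le r X Y F" "r \<le> s"
  shows "sep_rank_le s X Y F"
proof -
  obtain f g where fg: "\<And>x y. x \<in> X \<Longrightarrow> y \<in> Y \<Longrightarrow> F x y = (\<Sum>k<r. f k x * g k y)"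
    using assms(1) unfolding sep_rank_le_def by metis
  have "F x y = (\<Sum>k<s. (if k < r then f k x else 0) * g k y)" if "x \<in> X" "y \<in> Y" for x y
    unfolding fg[OF that] using assms(2)
    by (intro sum.mono_neutral_cong_left) auto
  then show ?thesis
    unfolding sep_rank_le_def by (intro exI[of _ "\<lambda>k x. if k < r then f k x else 0"] exI[of _ g]) auto
qed

lemma sep_rank_le_subset:
  assumes "sep_rank_le r X Y F" "X' \<subseteq> X" "Y' \<subseteq> Y"
  shows "sep_rank_le r X' Y' F"
  using assms unfolding sep_rank_le_def by (meson subset_eq)

lemma sep_rank_le_reparam:
  assumes "sep_rank_le r X Y F" "\<And>x. x \<in> X' \<Longrightarrow> a x \<in> X" "\<And>y. y \<in> Y' \<Longrightarrow> b y \<in> Y"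
    and "\<And>x y. x \<in> X' \<Longrightarrow> y \<in> Y' \<Longrightarrow> F' x y = F (a x) (b y)"
  shows "sep_rank_le r X' Y' F'"
proof -
  obtain f g where fg: "\<And>x y. x \<in> X \<Longrightarrow> y \<in> Y \<Longrightarrow> F x y = (\<Sum>k<r. f k x * g k y)"
    using assms(1) unfolding sep_rank_le_def by metis
  show ?thesis
    unfolding sep_rank_le_def
    by (intro exI[of _ "\<lambda>k x. f k (a x)"] exI[of _ "\<lambda>k y. g k (b y)"] ballI)
       (simp add: assms(2-4) fg)
qed

lemma sep_rank_le_add:
  assumes "sep_rank_le r X Y F" "sep_rank_le s X Y G"
  shows "sep_rank_le (r + s) X Y (\<lambda>x y. F x y + G x y)"
proof -
  obtain f g where fg: "\<And>x y. x \<in> X \<Longrightarrow> y \<in> Y \<Longrightarrow> F x y = (\<Sum>k<r. f k x * g k y)"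
    using assms(1) unfolding sep_rank_le_def by metis
  obtain f' g' where fg': "\<And>x y. x \<in> X \<Longrightarrow> y \<in> Y \<Longrightarrow> G x y = (\<Sum>k<s. f' k x * g' k y)"
    using assms(2) unfolding sep_rank_le_def by metis
  have "sep_rank_le (card ({..<r} <+> {..<s})) X Y (\<lambda>x y. F x y + G x y)"
    by (rule sep_rank_le_I[where f = "case_sum f f'" and g = "case_sum g g'"])
       (auto simp: fg fg' sum.Plus)
  then show ?thesis by (simp add: card_Plus)
qed

lemma sep_rank_le_sum:
  assumes "finite I" "\<And>i. i \<in> I \<Longrightarrow> sep_rank_le (r i) X Y (F i)"
  shows "sep_rank_le (\<Sum>i\<in>I. r i) X Y (\<lambda>x y. \<Sum>i\<in>I. F i x y)"
  using assms
proof (induction I rule: finite_induct)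
  case empty
  then show ?case by (simp add: sep_rank_le_0)
next
  case (insert i I)
  then show ?case by (simp add: sep_rank_le_add)
qed

lemma sep_rank_le_mult:
  assumes "sep_rank_le r X Y F"
  shows "sep_rank_le r X Y (\<lambda>x y. u x * v y * F x y)"
proof -
  obtain f g where fg: "\<And>x y. x \<in> X \<Longrightarrow> y \<in> Y \<Longrightarrow> F x y = (\<Sum>k<r. f k x * g k y)"
    using assms(1) unfolding sep_rank_le_def by metis
  show ?thesis
    unfolding sep_rank_le_def
    by (intro exI[of _ "\<lambda>k x. u x * f k x"] exI[of _ "\<lambda>k y. v y * g k y"] ballI)
       (simp add: fg sum_distrib_left mult_ac)
qed

text \<open>Wedderburn's rank reduction: for a vector \<open>\<alpha>\<close> with \<open>\<alpha> j \<noteq> 0\<close>, a vector orthogonal to \<open>\<alpha>\<close> is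
  determined by its coordinates other than \<open>j\<close>.\<close>

lemma sep_rank_le_eliminate:
  assumes "sep_rank_le (Suc r) X Y F" "a \<in> X" "b \<in> Y" "F a b \<noteq> 0"
  shows "sep_rank_le r X Y (eliminate a b F)"
proof -
  obtain f g where fg: "\<And>x y. x \<in> X \<Longrightarrow> y \<in> Y \<Longrightarrow> F x y = (\<Sum>k<Suc r. f k x * g k y)"
    using assms(1) unfolding sep_rank_le_def by metis
  have "\<exists>j<Suc r. f j a \<noteq> 0"
  proof (rule ccontr)
    assume "\<not> ?thesis"
    then have "F a b = 0" using assms(2,3) by (subst fg) (auto intro!: sum.neutral)
    with assms(4) show False by simp
  qed
  then obtain j where j: "j < Suc r" "f j a \<noteq> 0" by blast
  define v where "v k y = g k y - g k b * (F a y / F a b)" for k y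
  have v0: "(\<Sum>k<Suc r. f k a * v k y) = 0" if y: "y \<in> Y" for y
  proof -
    have "(\<Sum>k<Suc r. f k a * v k y)
        = (\<Sum>k<Suc r. f k a * g k y) - (\<Sum>k<Suc r. f k a * g k b) * (F a y / F a b)"
      by (simp only: v_def right_diff_distrib sum_subtractf sum_distrib_right mult.assoc)
    also have "\<dots> = 0" using fg[OF assms(2) y] fg[OF assms(2,3)] assms(4) by simp
    finally show ?thesis .
  qed
  have E: "eliminate a b F x y = (\<Sum>k\<in>{..<Suc r}-{j}. (f k x - f j x * f k a / f j a) * v k y)"
    if x: "x \<in> X" and y: "y \<in> Y" for x y
  proof -
    have "eliminate a b F x y = (\<Sum>k<Suc r. f k x * v k y)"
      unfolding eliminate_def fg[OF x y] fg[OF x assms(3)] v_def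
      by (simp only: right_diff_distrib sum_subtractf sum_distrib_right mult.assoc)
    also have "\<dots> = f j x * v j y + (\<Sum>k\<in>{..<Suc r}-{j}. f k x * v k y)"
      using j by (intro sum.remove) auto
    also have "v j y = - (\<Sum>k\<in>{..<Suc r}-{j}. f k a * v k y) / f j a"
    proof -
      have "f j a * v j y + (\<Sum>k\<in>{..<Suc r}-{j}. f k a * v k y) = 0"
        using v0[OF y] sum.remove[of "{..<Suc r}" j "\<lambda>k. f k a * v k y"] j by simp
      then have "f j a * v j y = - (\<Sum>k\<in>{..<Suc r}-{j}. f k a * v k y)"
        by (simp add: add_eq_0_iff2)
      then show ?thesis using j(2) by (metis nonzero_mult_div_cancel_left)
    qed
    also have "f j x * (- (\<Sum>k\<in>{..<Suc r}-{j}. f k a * v k y) / f j a) +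
        (\<Sum>k\<in>{..<Suc r}-{j}. f k x * v k y)
      = (\<Sum>k\<in>{..<Suc r}-{j}. (f k x - f j x * f k a / f j a) * v k y)"
      unfolding left_diff_distrib sum_subtractf sum_distrib_left sum_divide_distrib
      by (simp add: sum_divide_distrib sum_distrib_left mult_ac)
    finally show ?thesis .
  qed
  have "sep_rank_le (card ({..<Suc r}-{j})) X Y (eliminate a b F)"
    by (rule sep_rank_le_I[OF _ E]) auto
  then show ?thesis using j by simp
qed

lemma sep_rank_le_uneliminate:
  assumes "sep_rank_le r X Y (eliminate a b F)"
  shows "sep_rank_le (Suc r) X Y F"
proof -
  have "sep_rank_le (card {()}) X Y (\<lambda>x y. F x b * (F a y / F a b))"
    by (rule sep_rank_le_I[where f = "\<lambda>_ x. F x b" and g = "\<lambda>_ y. F a y / F a b"]) auto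
  from sep_rank_le_add[OF assms this] show ?thesis
    by (simp add: eliminate_def)
qed

text \<open>A separated decomposition can be rewritten with factors that are linear combinations of
  sections of \<open>F\<close>, so that they inherit the regularity of these sections.\<close>

lemma sep_rank_le_sections:
  assumes "sep_rank_le r X Y F"
    and "\<And>y. y \<in> Y \<Longrightarrow> A (\<lambda>x. F x y)" "\<And>x. x \<in> X \<Longrightarrow> B (F x)"
    and A: "A (\<lambda>x. 0)" "\<And>c f g. A f \<Longrightarrow> A g \<Longrightarrow> A (\<lambda>x. f x + c * g x)"
    and B: "B (\<lambda>y. 0)" "\<And>c f g. B f \<Longrightarrow> B g \<Longrightarrow> B (\<lambda>y. f y + c * g y)"
  shows "\<exists>f g. (\<forall>k<r. A (f k) \<and> B (g k)) \<and> (\<forall>x\<in>X. \<forall>y\<in>Y. F x y = (\<Sum>k<r. f k x * g k y))"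
  using assms(1-3)
proof (induction r arbitrary: F)
  case 0
  then show ?case by (simp add: sep_rank_le_0)
next
  case (Suc r)
  show ?case
  proof (cases "\<exists>a\<in>X. \<exists>b\<in>Y. F a b \<noteq> 0")
    case False
    then show ?thesis
      by (intro exI[of _ "\<lambda>_ _. 0"]) (auto simp: A(1) B(1))
  next
    case True
    then obtain a b where ab: "a \<in> X" "b \<in> Y" "F a b \<noteq> 0" by blast
    have 1: "sep_rank_le r X Y (eliminate a b F)"
      by (rule sep_rank_le_eliminate[OF Suc.prems(1) ab])
    have 2: "A (\<lambda>x. eliminate a b F x y)" if "y \<in> Y" for y
      using A(2)[OF Suc.prems(2)[OF that] Suc.prems(2)[OF ab(2)], of "- (F a y / F a b)"]
      by (simp add: eliminate_def mult.commute)
    have 3: "B (eliminate a b F x)" if "x \<in> X" for x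
      using B(2)[OF Suc.prems(3)[OF that] Suc.prems(3)[OF ab(1)], of "- (F x b / F a b)"]
      by (simp add: eliminate_def[abs_def])
    obtain f g where fg: "\<forall>k<r. A (f k) \<and> B (g k)"
      "\<And>x y. x \<in> X \<Longrightarrow> y \<in> Y \<Longrightarrow> eliminate a b F x y = (\<Sum>k<r. f k x * g k y)"
      using Suc.IH[OF 1 2 3] by blast
    have Bg: "B (\<lambda>y. F a y / F a b)"
      using B(2)[OF B(1) Suc.prems(3)[OF ab(1)], of "1 / F a b"] by simp
    show ?thesis
    proof (intro exI conjI allI impI ballI)
      show "F x y = (\<Sum>k<Suc r. (f(r := \<lambda>x. F x b)) k x * (g(r := \<lambda>y. F a y / F a b)) k y)"
        if "x \<in> X" "y \<in> Y" for x y
        using fg(2)[OF that] by (simp add: eliminate_def diff_eq_eq)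
    qed (use fg(1) Suc.prems(2)[OF ab(2)] Bg in \<open>auto simp: less_Suc_eq\<close>)
  qed
qed

text \<open>Pivot on the least key: its row vanishes off the diagonal, so the elimination leaves the
  other entries unchanged, and the remaining matrix is again triangular with one less available
  rank.\<close>

lemma card_le_sep_rank:
  fixes key :: "'a \<Rightarrow> 'k :: linorder"
  assumes "sep_rank_le r K K F" "finite K" "inj_on key K"
    and "\<And>k. k \<in> K \<Longrightarrow> F k k \<noteq> 0"
    and "\<And>k l. k \<in> K \<Longrightarrow> l \<in> K \<Longrightarrow> key k < key l \<Longrightarrow> F k l = 0"
  shows "card K \<le> r"
  using assms
proof (induction r arbitrary: K F)
  case 0
  then have "K = {}" by (auto simp: sep_rank_le_0)
  then show ?case by simp
next
  case (Suc r)
  show ?case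
  proof (cases "K = {}")
    case False
    then obtain a where a: "a \<in> K" "\<And>k. k \<in> K \<Longrightarrow> key a \<le> key k"
      using Suc.prems(2) by (metis arg_min_if_finite(1) arg_min_least)
    have F0: "F a k = 0" if "k \<in> K - {a}" for k
      using that a Suc.prems(3,5) by (metis Diff_iff inj_onD insertI1 order_le_less)
    have E: "eliminate a a F k l = F k l" if "l \<in> K - {a}" for k l
      using F0[OF that] by (simp add: eliminate_def)
    have "sep_rank_le r (K - {a}) (K - {a}) (eliminate a a F)"
      using sep_rank_le_subset[OF sep_rank_le_eliminate[OF Suc.prems(1) a(1) a(1) Suc.prems(4)[OF a(1)]]]
      by blast
    then have "card (K - {a}) \<le> r"
      by (rule Suc.IH) (use Suc.prems in \<open>auto simp: E inj_on_diff\<close>)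
    then show ?thesis using a Suc.prems(2) by simp
  qed auto
qed

section \<open>Sesqui-holomorphic functions\<close>

lemma norm_cscale: "norm (c *s v) = norm c * norm v" for v :: "complex ^ 'n"
  by (simp add: norm_vec_def norm_mult L2_set_right_distrib)

lemma linear_cscale: "linear (\<lambda>c. c *s v)" for v :: "complex ^ 'n"
  by (rule linearI) (simp_all add: vec_eq_iff algebra_simps)

lemma linear_cscale_cnj: "linear (\<lambda>c. cnj c *s v)" for v :: "complex ^ 'n"
  by (rule linearI) (simp_all add: vec_eq_iff algebra_simps)

lemma norm_cscale_pair: "norm (c *s v, cnj c *s u) = norm c * norm (v, u)"
  for v u :: "complex ^ 'n"
  by (simp add: norm_Pair norm_cscale power_mult_distrib flip: distrib_left)
     (simp add: real_sqrt_mult)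

text \<open>Joint holomorphy in \<open>z\<close> and in the conjugate of \<open>w\<close>, stated
  through a single derivative on pairs that is complex linear for the twisted scalar action. It
  makes the restrictions to the curves \<open>l \<mapsto> (z + l *s v, w + cnj l *s u)\<close>
  holomorphic, and one-variable theorems are applied to these.\<close>

definition sesqui_on ::
    "(complex ^ 'n \<Rightarrow> complex ^ 'n \<Rightarrow> complex) \<Rightarrow> ((complex ^ 'n) \<times> (complex ^ 'n)) set \<Rightarrow> bool" where
  "sesqui_on G W \<longleftrightarrow> (\<forall>X\<in>W. \<exists>D. ((\<lambda>X. G (fst X) (snd X)) has_derivative D) (at X) \<and>
     (\<forall>c v u. D (c *s v, cnj c *s u) = c * D (v, u)))"

lemma sesqui_on_subset: "sesqui_on G W \<Longrightarrow> V \<subseteq> W \<Longrightarrow> sesqui_on G V"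
  unfolding sesqui_on_def by blast

lemma sesqui_on_const: "sesqui_on (\<lambda>z w. c) W"
  unfolding sesqui_on_def by (intro ballI exI[of _ "\<lambda>_. 0"]) auto

lemma sesqui_on_left:
  fixes i :: "'n :: finite"
  shows "sesqui_on (\<lambda>z w. z $ i) W"
  unfolding sesqui_on_def
proof (intro ballI exI conjI allI)
  show "((\<lambda>X. fst X $ i) has_derivative (\<lambda>Y. fst Y $ i)) (at X)" for X :: "(complex ^ 'n) \<times> (complex ^ 'n)"
    by (intro linear_imp_has_derivative linearI) auto
qed auto

lemma sesqui_on_right:
  fixes i :: "'n :: finite"
  shows "sesqui_on (\<lambda>z w. cnj (w $ i)) W"
  unfolding sesqui_on_def
proof (intro ballI exI conjI allI)
  show "((\<lambda>X. cnj (snd X $ i)) has_derivative (\<lambda>Y. cnj (snd Y $ i))) (at X)" for X :: "(complex ^ 'n) \<times> (complex ^ 'n)"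
    by (intro linear_imp_has_derivative linearI) auto
qed auto

lemma sesqui_on_add:
  assumes "sesqui_on F W" "sesqui_on G W"
  shows "sesqui_on (\<lambda>z w. F z w + G z w) W"
  unfolding sesqui_on_def
proof
  fix X assume X: "X \<in> W"
  obtain D where D: "((\<lambda>X. F (fst X) (snd X)) has_derivative D) (at X)"
    "\<And>c v u. D (c *s v, cnj c *s u) = c * D (v, u)"
    using assms(1) X unfolding sesqui_on_def by blast
  obtain E where E: "((\<lambda>X. G (fst X) (snd X)) has_derivative E) (at X)"
    "\<And>c v u. E (c *s v, cnj c *s u) = c * E (v, u)"
    using assms(2) X unfolding sesqui_on_def by blast
  show "\<exists>D. ((\<lambda>X. F (fst X) (snd X) + G (fst X) (snd X)) has_derivative D) (at X) \<and>
     (\<forall>c v u. D (c *s v, cnj c *s u) = c * D (v, u))"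
    by (intro exI conjI, rule has_derivative_add[OF D(1) E(1)]) (simp add: D(2) E(2) algebra_simps)
qed

lemma sesqui_on_mult:
  assumes "sesqui_on F W" "sesqui_on G W"
  shows "sesqui_on (\<lambda>z w. F z w * G z w) W"
  unfolding sesqui_on_def
proof
  fix X assume X: "X \<in> W"
  obtain D where D: "((\<lambda>X. F (fst X) (snd X)) has_derivative D) (at X)"
    "\<And>c v u. D (c *s v, cnj c *s u) = c * D (v, u)"
    using assms(1) X unfolding sesqui_on_def by blast
  obtain E where E: "((\<lambda>X. G (fst X) (snd X)) has_derivative E) (at X)"
    "\<And>c v u. E (c *s v, cnj c *s u) = c * E (v, u)"
    using assms(2) X unfolding sesqui_on_def by blast
  show "\<exists>D. ((\<lambda>X. F (fst X) (snd X) * G (fst X) (snd X)) has_derivative D) (at X) \<and>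
     (\<forall>c v u. D (c *s v, cnj c *s u) = c * D (v, u))"
    by (intro exI conjI, rule has_derivative_mult[OF D(1) E(1)]) (simp add: D(2) E(2) algebra_simps)
qed

lemma sesqui_on_power: "sesqui_on F W \<Longrightarrow> sesqui_on (\<lambda>z w. F z w ^ d) W"
  by (induction d) (auto intro: sesqui_on_const sesqui_on_mult)

lemma sesqui_on_sum: "(\<And>i. i \<in> I \<Longrightarrow> sesqui_on (F i) W) \<Longrightarrow> sesqui_on (\<lambda>z w. \<Sum>i\<in>I. F i z w) W"
  by (induction I rule: infinite_finite_induct) (auto intro: sesqui_on_const sesqui_on_add)

lemma sesqui_on_fix_right:
  assumes "sesqui_on G (A \<times> B)" "b \<in> B"
  shows "sesqui_on (\<lambda>z w. G z b) (A \<times> C)"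
  unfolding sesqui_on_def
proof
  fix X assume X: "X \<in> A \<times> C"
  then have X': "(fst X, b) \<in> A \<times> B" using assms(2) by auto
  obtain D where D: "((\<lambda>X. G (fst X) (snd X)) has_derivative D) (at (fst X, b))"
    "\<And>c v u. D (c *s v, cnj c *s u) = c * D (v, u)"
    using assms(1) X' unfolding sesqui_on_def by blast
  have l: "((\<lambda>X. (fst X, b)) has_derivative (\<lambda>Y. (fst Y, 0))) (at X)"
    by (intro derivative_intros)
  show "\<exists>D. ((\<lambda>X. G (fst X) b) has_derivative D) (at X) \<and>
     (\<forall>c v u. D (c *s v, cnj c *s u) = c * D (v, u))"
    using has_derivative_compose[OF l D(1)] D(2)[where u = 0] by force
qed

lemma sesqui_on_fix_left:
  assumes "sesqui_on G (A \<times> B)" "a \<in> A"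
  shows "sesqui_on (\<lambda>z w. G a w) (C \<times> B)"
  unfolding sesqui_on_def
proof
  fix X assume X: "X \<in> C \<times> B"
  then have X': "(a, snd X) \<in> A \<times> B" using assms(2) by auto
  obtain D where D: "((\<lambda>X. G (fst X) (snd X)) has_derivative D) (at (a, snd X))"
    "\<And>c v u. D (c *s v, cnj c *s u) = c * D (v, u)"
    using assms(1) X' unfolding sesqui_on_def by blast
  have l: "((\<lambda>X. (a, snd X)) has_derivative (\<lambda>Y. (0, snd Y))) (at X)"
    by (intro derivative_intros)
  show "\<exists>D. ((\<lambda>X. G a (snd X)) has_derivative D) (at X) \<and>
     (\<forall>c v u. D (c *s v, cnj c *s u) = c * D (v, u))"
    using has_derivative_compose[OF l D(1)] D(2)[where v = 0] by force
qed

lemma sesqui_on_eliminate: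
  assumes "sesqui_on G (A \<times> B)" "a \<in> A" "b \<in> B"
  shows "sesqui_on (eliminate a b G) (A \<times> B)"
proof -
  have "sesqui_on (\<lambda>z w. G z w + (- 1 / G a b) * (G z b * G a w)) (A \<times> B)"
    by (intro sesqui_on_add sesqui_on_mult sesqui_on_const assms sesqui_on_fix_right[OF assms(1,3)]
      sesqui_on_fix_left[OF assms(1,2)])
  moreover have "(\<lambda>z w. G z w + (- 1 / G a b) * (G z b * G a w)) = eliminate a b G"
    by (simp add: fun_eq_iff eliminate_def)
  ultimately show ?thesis by metis
qed

lemma sesqui_on_imp_holomorphic_left:
  assumes "sesqui_on G (A \<times> B)" "b \<in> B"
  shows "holomorphic_several_on (\<lambda>z. G z b) A"
  unfolding holomorphic_several_on_def
proof
  fix z assume "z \<in> A"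
  then have X': "(z, b) \<in> A \<times> B" using assms(2) by auto
  obtain D where D: "((\<lambda>X. G (fst X) (snd X)) has_derivative D) (at (z, b))"
    "\<And>c v u. D (c *s v, cnj c *s u) = c * D (v, u)"
    using assms(1) X' unfolding sesqui_on_def by blast
  have l: "((\<lambda>z. (z, b)) has_derivative (\<lambda>v. (v, 0))) (at z)"
    by (intro derivative_intros)
  show "\<exists>D. ((\<lambda>z. G z b) has_derivative D) (at z) \<and> (\<forall>c v. D (c *s v) = c * D v)"
    using has_derivative_compose[OF l D(1)] D(2)[where u = 0] by force
qed

lemma sesqui_on_imp_holomorphic_right:
  assumes "sesqui_on G (A \<times> B)" "a \<in> A"
  shows "holomorphic_several_on (\<lambda>w. cnj (G a w)) B"
  unfolding holomorphic_several_on_def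
proof
  fix w assume "w \<in> B"
  then have X': "(a, w) \<in> A \<times> B" using assms(2) by auto
  obtain D where D: "((\<lambda>X. G (fst X) (snd X)) has_derivative D) (at (a, w))"
    "\<And>c v u. D (c *s v, cnj c *s u) = c * D (v, u)"
    using assms(1) X' unfolding sesqui_on_def by blast
  have l: "((\<lambda>w. (a, w)) has_derivative (\<lambda>u. (0, u))) (at w)"
    by (intro derivative_intros)
  have "D (0, c *s u) = cnj c * D (0, u)" for c u
    using D(2)[of "cnj c" 0 u] by simp
  then show "\<exists>D. ((\<lambda>w. cnj (G a w)) has_derivative D) (at w) \<and> (\<forall>c v. D (c *s v) = c * D v)"
    using has_derivative_cnj[OF has_derivative_compose[OF l D(1)]]
    by (intro exI[of _ "\<lambda>u. cnj (D (0, u))"]) simp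
qed

lemma sesqui_on_tensor:
  assumes "holomorphic_several_on f A" "holomorphic_several_on g B"
  shows "sesqui_on (\<lambda>z w. f z * cnj (g w)) (A \<times> B)"
proof (rule sesqui_on_mult)
  show "sesqui_on (\<lambda>z w. f z) (A \<times> B)"
    unfolding sesqui_on_def
  proof
    fix X assume "X \<in> A \<times> B"
    then obtain D where D: "(f has_derivative D) (at (fst X))" "\<And>c v. D (c *s v) = c * D v"
      using assms(1) unfolding holomorphic_several_on_def by (metis mem_Times_iff)
    have l: "(fst has_derivative fst) (at X)" by (intro derivative_intros)
    show "\<exists>D. ((\<lambda>X. f (fst X)) has_derivative D) (at X) \<and>
       (\<forall>c v u. D (c *s v, cnj c *s u) = c * D (v, u))"
      using has_derivative_compose[OF l D(1)] D(2) by force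
  qed
  show "sesqui_on (\<lambda>z w. cnj (g w)) (A \<times> B)"
    unfolding sesqui_on_def
  proof
    fix X assume "X \<in> A \<times> B"
    then obtain D where D: "(g has_derivative D) (at (snd X))" "\<And>c v. D (c *s v) = c * D v"
      using assms(2) unfolding holomorphic_several_on_def by (metis mem_Times_iff)
    have l: "(snd has_derivative snd) (at X)" by (intro derivative_intros)
    show "\<exists>D. ((\<lambda>X. cnj (g (snd X))) has_derivative D) (at X) \<and>
       (\<forall>c v u. D (c *s v, cnj c *s u) = c * D (v, u))"
      using has_derivative_cnj[OF has_derivative_compose[OF l D(1)]] D(2) by force
  qed
qed

lemma has_field_derivative_sesqui_line:
  assumes "((\<lambda>X. G (fst X) (snd X)) has_derivative D) (at (z + l *s v, w + cnj l *s u))"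
    and "\<And>c v u. D (c *s v, cnj c *s u) = c * D (v, u)"
  shows "((\<lambda>l. G (z + l *s v) (w + cnj l *s u)) has_field_derivative D (v, u)) (at l)"
proof -
  have l: "((\<lambda>l. (z + l *s v, w + cnj l *s u)) has_derivative (\<lambda>c. (c *s v, cnj c *s u))) (at l)"
    by (intro has_derivative_Pair)
       (auto intro!: derivative_eq_intros linear_imp_has_derivative[OF linear_cscale]
         linear_imp_has_derivative[OF linear_cscale_cnj])
  have "((\<lambda>l. G (z + l *s v) (w + cnj l *s u)) has_derivative (\<lambda>c. D (c *s v, cnj c *s u))) (at l)"
    using has_derivative_compose[OF l assms(1)] by simp
  then show ?thesis
    by (simp add: has_field_derivative_def assms(2) mult.commute[of _ "D (v, u)"])
qed

lemma sesqui_on_line: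
  assumes "sesqui_on G W" "\<And>l. l \<in> S \<Longrightarrow> (z + l *s v, w + cnj l *s u) \<in> W"
  shows "(\<lambda>l. G (z + l *s v) (w + cnj l *s u)) holomorphic_on S"
  unfolding holomorphic_on_def field_differentiable_def
proof
  fix l assume "l \<in> S"
  then obtain D where "((\<lambda>X. G (fst X) (snd X)) has_derivative D) (at (z + l *s v, w + cnj l *s u))"
    "\<And>c v u. D (c *s v, cnj c *s u) = c * D (v, u)"
    using assms unfolding sesqui_on_def by blast
  from has_field_derivative_at_within[OF has_field_derivative_sesqui_line[OF this]]
  show "\<exists>f'. ((\<lambda>l. G (z + l *s v) (w + cnj l *s u)) has_field_derivative f') (at l within S)"
    by blast
qed

text \<open>Cauchy's inequality for the difference along the complex line through \<open>X\<close>
  in direction \<open>h\<close>. The line stays in the ball for parameters below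
  \<open>r / norm h\<close>; taking the circle of half that radius produces the factor 2.\<close>

lemma sesqui_on_diff_derivative_bound:
  assumes F: "sesqui_on F (ball X r)" and G: "sesqui_on G (ball X r)" and "r > 0"
    and D: "((\<lambda>X. F (fst X) (snd X)) has_derivative D) (at X)"
      "\<And>c v u. D (c *s v, cnj c *s u) = c * D (v, u)"
    and E: "((\<lambda>X. G (fst X) (snd X)) has_derivative E) (at X)"
      "\<And>c v u. E (c *s v, cnj c *s u) = c * E (v, u)"
    and e: "\<And>Y. Y \<in> ball X r \<Longrightarrow> norm (F (fst Y) (snd Y) - G (fst Y) (snd Y)) \<le> e"
  shows "norm (D h - E h) \<le> 2 * e / r * norm h"
proof (cases "h = 0")
  case True
  then show ?thesis
    using D(2)[of 0 0 0] E(2)[of 0 0 0] by (simp add: zero_prod_def)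
next
  case False
  obtain v u where h: "h = (v, u)" by (cases h)
  define \<rho> where "\<rho> = r / norm h"
  have \<rho>: "\<rho> > 0" using False assms(3) by (simp add: \<rho>_def)
  let ?z = "fst X" and ?w = "snd X"
  have W: "(?z + l *s v, ?w + cnj l *s u) \<in> ball X r" if "l \<in> ball 0 \<rho>" for l
  proof -
    have "dist X (?z + l *s v, ?w + cnj l *s u) = norm (l *s v, cnj l *s u)"
      by (cases X) (simp add: dist_Pair_Pair norm_Pair dist_norm)
    also have "\<dots> = norm l * norm h" by (simp only: norm_cscale_pair h)
    also have "\<dots> < r" using that False by (simp add: \<rho>_def pos_less_divide_eq)
    finally show ?thesis by simp
  qed
  define g where "g l = F (?z + l *s v) (?w + cnj l *s u) - G (?z + l *s v) (?w + cnj l *s u)" for l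
  have hol: "g holomorphic_on ball 0 \<rho>"
    unfolding g_def by (intro holomorphic_on_diff sesqui_on_line[OF F] sesqui_on_line[OF G] W)
  have "(g has_field_derivative (D (v, u) - E (v, u))) (at 0)"
    unfolding g_def
    by (intro DERIV_diff has_field_derivative_sesqui_line) (use D E in auto)
  then have d: "deriv g 0 = D h - E h" by (simp add: h DERIV_imp_deriv)
  have sub: "cball 0 (\<rho> / 2) \<subseteq> ball (0 :: complex) \<rho>" using \<rho> by auto
  have "norm ((deriv ^^ 1) g 0) \<le> fact 1 * e / (\<rho> / 2) ^ 1"
  proof (rule Cauchy_inequality)
    show "g holomorphic_on ball 0 (\<rho> / 2)"
      by (rule holomorphic_on_subset[OF hol]) (use \<rho> in auto)
    show "continuous_on (cball 0 (\<rho> / 2)) g"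
      by (rule continuous_on_subset[OF holomorphic_on_imp_continuous_on[OF hol] sub])
    show "norm (g l) \<le> e" if "norm (0 - l) = \<rho> / 2" for l
      unfolding g_def using e[OF W[of l]] that \<rho> by simp
  qed (use \<rho> in auto)
  then show ?thesis
    using False assms(3) by (simp add: d \<rho>_def field_simps)
qed

text \<open>Weierstrass's theorem. The preceding estimate turns uniform convergence into a uniform
  Cauchy condition on the derivatives, so the limit is differentiable, and the twisted linearity
  passes to the limit derivative.\<close>

lemma sesqui_on_uniform_limit:
  fixes G :: "nat \<Rightarrow> complex ^ 'n \<Rightarrow> complex ^ 'n \<Rightarrow> complex"
  assumes "open W" and G: "\<And>n. sesqui_on (G n) W"
    and lim: "\<And>e. e > 0 \<Longrightarrow> \<exists>N. \<forall>n\<ge>N. \<forall>X\<in>W. norm (G n (fst X) (snd X) - H (fst X) (snd X)) \<le> e"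
  shows "sesqui_on H W"
  unfolding sesqui_on_def
proof
  fix X0 assume "X0 \<in> W"
  then obtain r0 where r0: "r0 > 0" "ball X0 r0 \<subseteq> W"
    using \<open>open W\<close> open_contains_ball by blast
  \<comment> \<open>Half the radius, so that a ball of the same radius \<open>r\<close> around every
    point of \<open>ball X0 r\<close> lies in \<open>W\<close> and the derivative bound is uniform
    there.\<close>
  define r where "r = r0 / 2"
  have r: "r > 0" using r0 by (simp add: r_def)
  have sub: "ball X r \<subseteq> W" if "X \<in> ball X0 r" for X
  proof
    fix Y assume "Y \<in> ball X r"
    then have "dist X0 Y < r + r"
      using that dist_triangle[of X0 Y X] by simp
    then show "Y \<in> W" using r0 by (auto simp: r_def)
  qed
  have XW: "X \<in> W" if "X \<in> ball X0 r" for X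
    using sub[OF that] r by (meson centre_in_ball subsetD)
  define D where "D n X = (SOME D. ((\<lambda>X. G n (fst X) (snd X)) has_derivative D) (at X) \<and>
     (\<forall>c v u. D (c *s v, cnj c *s u) = c * D (v, u)))" for n X
  have D': "((\<lambda>X. G n (fst X) (snd X)) has_derivative D n X) (at X) \<and>
     (\<forall>c v u. D n X (c *s v, cnj c *s u) = c * D n X (v, u))" if "X \<in> W" for n X
  proof -
    have "\<exists>D. ((\<lambda>X. G n (fst X) (snd X)) has_derivative D) (at X) \<and>
       (\<forall>c v u. D (c *s v, cnj c *s u) = c * D (v, u))"
      using G[of n] that unfolding sesqui_on_def by blast
    from someI_ex[OF this] show ?thesis unfolding D_def .
  qed
  note D = D'[THEN conjunct1] D'[THEN conjunct2, rule_format]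
  have Cauchy: "\<exists>N. \<forall>n\<ge>N. \<forall>m\<ge>N. \<forall>X\<in>ball X0 r. \<forall>h. norm (D n X h - D m X h) \<le> e * norm h"
    if e: "e > 0" for e
  proof -
    have e4: "e * r / 4 > 0" using e r by simp
    from lim[OF this] obtain N
      where N: "\<And>n X. n \<ge> N \<Longrightarrow> X \<in> W \<Longrightarrow> norm (G n (fst X) (snd X) - H (fst X) (snd X)) \<le> e * r / 4"
      by blast
    have "norm (D n X h - D m X h) \<le> e * norm h"
      if nm: "n \<ge> N" "m \<ge> N" and X: "X \<in> ball X0 r" for n m X h
    proof -
      have "norm (D n X h - D m X h) \<le> 2 * (e * r / 2) / r * norm h"
      proof (rule sesqui_on_diff_derivative_bound[OF _ _ r D(1,2)[OF XW[OF X]] D(1,2)[OF XW[OF X]]])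
        show "norm (G n (fst Y) (snd Y) - G m (fst Y) (snd Y)) \<le> e * r / 2" if "Y \<in> ball X r" for Y
        proof -
          have "Y \<in> W" using that sub[OF X] by blast
          have "norm ((G n (fst Y) (snd Y) - H (fst Y) (snd Y)) - (G m (fst Y) (snd Y) - H (fst Y) (snd Y)))
              \<le> e * r / 4 + e * r / 4"
            by (rule norm_triangle_le_diff, rule add_mono) (use N nm \<open>Y \<in> W\<close> in auto)
          then show ?thesis by simp
        qed
      qed (use G sesqui_on_subset[OF _ sub[OF X]] in auto)
      then show ?thesis using r by simp
    qed
    then show ?thesis by blast
  qed
  have conv: "convergent (\<lambda>n. D n X h)" if X: "X \<in> ball X0 r" for X h
  proof (rule Cauchy_convergent, rule metric_CauchyI)
    fix e :: real assume e: "e > 0"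
    then have "e / (norm h + 1) > 0" by (simp add: add_nonneg_pos)
    from Cauchy[OF this] obtain N
      where N: "\<And>n m. n \<ge> N \<Longrightarrow> m \<ge> N \<Longrightarrow> norm (D n X h - D m X h) \<le> e / (norm h + 1) * norm h"
      using X by blast
    have "e / (norm h + 1) * norm h < e"
      using e norm_ge_zero[of h] by (simp add: pos_divide_less_eq add_nonneg_pos distrib_left)
    then have "dist (D m X h) (D n X h) < e" if "m \<ge> N" "n \<ge> N" for m n
      using N[OF that] unfolding dist_norm by linarith
    then show "\<exists>M. \<forall>m\<ge>M. \<forall>n\<ge>M. dist (D m X h) (D n X h) < e" by blast
  qed
  have pw: "(\<lambda>n. G n (fst X) (snd X)) \<longlonglongrightarrow> H (fst X) (snd X)" if X: "X \<in> W" for X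
  proof (rule LIMSEQ_I)
    fix e :: real assume e: "e > 0"
    then have "e / 2 > 0" by simp
    from lim[OF this] X obtain N
      where N: "\<And>n. n \<ge> N \<Longrightarrow> norm (G n (fst X) (snd X) - H (fst X) (snd X)) \<le> e / 2" by blast
    have "norm (G n (fst X) (snd X) - H (fst X) (snd X)) < e" if "n \<ge> N" for n
      using N[OF that] e by linarith
    then show "\<exists>N. \<forall>n\<ge>N. norm (G n (fst X) (snd X) - H (fst X) (snd X)) < e" by blast
  qed
  define E where "E X h = lim (\<lambda>n. D n X h)" for X h
  have E: "(\<lambda>n. D n X h) \<longlonglongrightarrow> E X h" if "X \<in> ball X0 r" for X h
    using conv[OF that] by (simp add: E_def convergent_LIMSEQ_iff)
  have "\<exists>g. \<forall>X\<in>ball X0 r. (\<lambda>n. G n (fst X) (snd X)) \<longlonglongrightarrow> g X \<and>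
      (g has_derivative E X) (at X within ball X0 r)"
  proof (rule has_derivative_sequence)
    show "((\<lambda>X. G n (fst X) (snd X)) has_derivative D n X) (at X within ball X0 r)"
      if "X \<in> ball X0 r" for n X
      using D(1)[OF XW[OF that]] by (rule has_derivative_at_withinI)
    show "\<forall>\<^sub>F n in sequentially. \<forall>X\<in>ball X0 r. \<forall>h. norm (D n X h - E X h) \<le> e * norm h"
      if e: "e > 0" for e
    proof -
      obtain N where N: "\<And>n m X h. n \<ge> N \<Longrightarrow> m \<ge> N \<Longrightarrow> X \<in> ball X0 r \<Longrightarrow>
          norm (D n X h - D m X h) \<le> e * norm h"
        using Cauchy[OF e] by blast
      have "norm (D n X h - E X h) \<le> e * norm h" if "n \<ge> N" "X \<in> ball X0 r" for n X h
      proof (rule tendsto_upperbound)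
        show "(\<lambda>m. norm (D n X h - D m X h)) \<longlonglongrightarrow> norm (D n X h - E X h)"
          by (intro tendsto_intros E that)
        show "\<forall>\<^sub>F m in sequentially. norm (D n X h - D m X h) \<le> e * norm h"
          using N[OF that(1) _ that(2)] eventually_sequentially by blast
      qed simp
      then show ?thesis unfolding eventually_sequentially by blast
    qed
    show "X0 \<in> ball X0 r" using r by simp
    show "(\<lambda>n. G n (fst X0) (snd X0)) \<longlonglongrightarrow> H (fst X0) (snd X0)"
      by (rule pw[OF \<open>X0 \<in> W\<close>])
  qed (rule convex_ball)
  then obtain g where g: "\<And>X. X \<in> ball X0 r \<Longrightarrow> (\<lambda>n. G n (fst X) (snd X)) \<longlonglongrightarrow> g X"
    "\<And>X. X \<in> ball X0 r \<Longrightarrow> (g has_derivative E X) (at X within ball X0 r)"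
    by blast
  have gH: "g X = H (fst X) (snd X)" if X: "X \<in> ball X0 r" for X
    by (rule LIMSEQ_unique[OF g(1)[OF X] pw[OF XW[OF X]]])
  have X0: "X0 \<in> ball X0 r" using r by simp
  have "(g has_derivative E X0) (at X0)"
    using g(2)[OF X0] at_within_open[OF X0 open_ball] by simp
  then have "((\<lambda>X. H (fst X) (snd X)) has_derivative E X0) (at X0)"
    by (rule has_derivative_transform_within_open[OF _ open_ball X0]) (simp add: gH)
  moreover have "E X0 (c *s v, cnj c *s u) = c * E X0 (v, u)" for c v u
  proof (rule LIMSEQ_unique[OF E[OF X0]])
    show "(\<lambda>n. D n X0 (c *s v, cnj c *s u)) \<longlonglongrightarrow> c * E X0 (v, u)"
      unfolding D(2)[OF \<open>X0 \<in> W\<close>] by (intro tendsto_intros E X0)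
  qed
  ultimately show "\<exists>D. ((\<lambda>X. H (fst X) (snd X)) has_derivative D) (at X0) \<and>
     (\<forall>c v u. D (c *s v, cnj c *s u) = c * D (v, u))" by blast
qed

section \<open>Uniform limits of polynomials\<close>

text \<open>The algebra generated by the functions in \<open>V\<close>. Keeping polynomials as
  functions, without coefficients, makes closure properties such as substitution direct
  inductions.\<close>

inductive_set poly_gen :: "('a \<Rightarrow> complex) set \<Rightarrow> ('a \<Rightarrow> complex) set" for V where
  poly_gen_const: "(\<lambda>x. c) \<in> poly_gen V"
| poly_gen_base: "f \<in> V \<Longrightarrow> f \<in> poly_gen V"
| poly_gen_add: "f \<in> poly_gen V \<Longrightarrow> g \<in> poly_gen V \<Longrightarrow> (\<lambda>x. f x + g x) \<in> poly_gen V"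
| poly_gen_mult: "f \<in> poly_gen V \<Longrightarrow> g \<in> poly_gen V \<Longrightarrow> (\<lambda>x. f x * g x) \<in> poly_gen V"

lemma poly_gen_scale: "f \<in> poly_gen V \<Longrightarrow> (\<lambda>x. c * f x) \<in> poly_gen V"
  by (intro poly_gen_mult poly_gen_const)

lemma poly_gen_diff:
  assumes "f \<in> poly_gen V" "g \<in> poly_gen V"
  shows "(\<lambda>x. f x - g x) \<in> poly_gen V"
proof -
  have "(\<lambda>x. f x + (- 1) * g x) \<in> poly_gen V"
    by (intro poly_gen_add poly_gen_scale assms)
  then show ?thesis by simp
qed

lemma poly_gen_power: "f \<in> poly_gen V \<Longrightarrow> (\<lambda>x. f x ^ k) \<in> poly_gen V"
  by (induction k) (auto intro: poly_gen_const poly_gen_mult)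

lemma poly_gen_sum: "(\<And>i. i \<in> I \<Longrightarrow> f i \<in> poly_gen V) \<Longrightarrow> (\<lambda>x. \<Sum>i\<in>I. f i x) \<in> poly_gen V"
  by (induction I rule: infinite_finite_induct) (auto intro: poly_gen_const poly_gen_add)

lemma poly_gen_prod: "(\<And>i. i \<in> I \<Longrightarrow> f i \<in> poly_gen V) \<Longrightarrow> (\<lambda>x. \<Prod>i\<in>I. f i x) \<in> poly_gen V"
  by (induction I rule: infinite_finite_induct) (auto intro: poly_gen_const poly_gen_mult)

lemma poly_gen_compose:
  assumes "f \<in> poly_gen V" "\<And>v. v \<in> V \<Longrightarrow> (\<lambda>x. v (\<sigma> x)) \<in> poly_gen V'"
  shows "(\<lambda>x. f (\<sigma> x)) \<in> poly_gen V'"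
  using assms(1) by induction (auto intro: poly_gen.intros assms(2))

lemma poly_gen_bounded:
  assumes "f \<in> poly_gen V" "\<And>v. v \<in> V \<Longrightarrow> \<exists>K. \<forall>x\<in>S. norm (v x) \<le> K"
  shows "\<exists>K. \<forall>x\<in>S. norm (f x) \<le> K"
  using assms(1)
proof induction
  case (poly_gen_base f)
  then show ?case by (rule assms(2))
next
  case (poly_gen_add f g)
  then obtain K L where K: "\<And>x. x \<in> S \<Longrightarrow> norm (f x) \<le> K" and L: "\<And>x. x \<in> S \<Longrightarrow> norm (g x) \<le> L" by blast
  have "norm (f x + g x) \<le> K + L" if "x \<in> S" for x
    using norm_triangle_mono[OF K L] that by blast
  then show ?case by blast
next
  case (poly_gen_mult f g)
  then obtain K L where K: "\<And>x. x \<in> S \<Longrightarrow> norm (f x) \<le> K" and L: "\<And>x. x \<in> S \<Longrightarrow> norm (g x) \<le> L" by blast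
  have "norm (f x * g x) \<le> K * L" if "x \<in> S" for x
    unfolding norm_mult by (rule mult_mono[OF K L]) (use that order_trans[OF norm_ge_zero K] in auto)
  then show ?case by blast
qed auto

text \<open>Takes the place of a convergent power series in several variables: it is stable under
  polynomial substitutions and under Taylor coefficients, and it implies holomorphy.\<close>

definition poly_approx :: "('a \<Rightarrow> complex) set \<Rightarrow> 'a set \<Rightarrow> ('a \<Rightarrow> complex) \<Rightarrow> bool" where
  "poly_approx V S f \<longleftrightarrow> (\<forall>e>0. \<exists>g\<in>poly_gen V. \<forall>x\<in>S. norm (f x - g x) \<le> e)"

lemma poly_approx_poly: "f \<in> poly_gen V \<Longrightarrow> poly_approx V S f"
  unfolding poly_approx_def by (intro allI impI bexI[of _ f]) auto

lemma poly_approx_add: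
  assumes "poly_approx V S f" "poly_approx V S g"
  shows "poly_approx V S (\<lambda>x. f x + g x)"
  unfolding poly_approx_def
proof (intro allI impI)
  fix e :: real assume "e > 0"
  then have e: "e / 2 > 0" by simp
  obtain f' where f': "f' \<in> poly_gen V" "\<And>x. x \<in> S \<Longrightarrow> norm (f x - f' x) \<le> e / 2"
    using assms(1) e unfolding poly_approx_def by blast
  obtain g' where g': "g' \<in> poly_gen V" "\<And>x. x \<in> S \<Longrightarrow> norm (g x - g' x) \<le> e / 2"
    using assms(2) e unfolding poly_approx_def by blast
  have "norm (f x + g x - (f' x + g' x)) \<le> e" if "x \<in> S" for x
    using norm_triangle_mono[OF f'(2)[OF that] g'(2)[OF that]] by (simp add: algebra_simps)
  then show "\<exists>h\<in>poly_gen V. \<forall>x\<in>S. norm (f x + g x - h x) \<le> e"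
    by (intro bexI[of _ "\<lambda>x. f' x + g' x"] poly_gen_add f' g') auto
qed

lemma poly_approx_mult_poly:
  assumes "poly_approx V S f" "p \<in> poly_gen V" "\<And>v. v \<in> V \<Longrightarrow> \<exists>K. \<forall>x\<in>S. norm (v x) \<le> K"
  shows "poly_approx V S (\<lambda>x. p x * f x)"
  unfolding poly_approx_def
proof (intro allI impI)
  fix e :: real assume e: "e > 0"
  obtain K where K: "\<And>x. x \<in> S \<Longrightarrow> norm (p x) \<le> K"
    using poly_gen_bounded[OF assms(2,3)] by blast
  have "e / (\<bar>K\<bar> + 1) > 0" using e by (simp add: add_nonneg_pos)
  then obtain g where g: "g \<in> poly_gen V" "\<And>x. x \<in> S \<Longrightarrow> norm (f x - g x) \<le> e / (\<bar>K\<bar> + 1)"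
    using assms(1) unfolding poly_approx_def by blast
  have "norm (p x * f x - p x * g x) \<le> e" if x: "x \<in> S" for x
  proof -
    have "norm (p x * f x - p x * g x) = norm (p x) * norm (f x - g x)"
      by (simp add: norm_mult flip: right_diff_distrib)
    also have "\<dots> \<le> (\<bar>K\<bar> + 1) * (e / (\<bar>K\<bar> + 1))"
      by (intro mult_mono g(2) x) (use K[OF x] in auto)
    also have "\<dots> = e" by (simp add: add_nonneg_pos order_less_imp_not_eq2)
    finally show ?thesis .
  qed
  then show "\<exists>h\<in>poly_gen V. \<forall>x\<in>S. norm (p x * f x - h x) \<le> e"
    by (intro bexI[of _ "\<lambda>x. p x * g x"] poly_gen_mult g assms(2)) auto
qed

lemma poly_approx_scale:
  assumes "poly_approx V S f"
  shows "poly_approx V S (\<lambda>x. c * f x)"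
  unfolding poly_approx_def
proof (intro allI impI)
  fix e :: real assume e: "e > 0"
  then have "e / (norm c + 1) > 0" by (simp add: add_nonneg_pos)
  then obtain g where g: "g \<in> poly_gen V" "\<And>x. x \<in> S \<Longrightarrow> norm (f x - g x) \<le> e / (norm c + 1)"
    using assms(1) unfolding poly_approx_def by blast
  have "norm (c * f x - c * g x) \<le> e" if x: "x \<in> S" for x
  proof -
    have "norm (c * f x - c * g x) = norm c * norm (f x - g x)"
      by (simp add: norm_mult flip: right_diff_distrib)
    also have "\<dots> \<le> (norm c + 1) * (e / (norm c + 1))"
      by (intro mult_mono g(2) x) auto
    also have "\<dots> = e" by (simp add: add_nonneg_pos order_less_imp_not_eq2)
    finally show ?thesis .
  qed
  then show "\<exists>h\<in>poly_gen V. \<forall>x\<in>S. norm (c * f x - h x) \<le> e"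
    by (intro bexI[of _ "\<lambda>x. c * g x"] poly_gen_scale g) auto
qed

lemma poly_approx_compose:
  assumes "poly_approx V S f" "\<And>x. x \<in> S' \<Longrightarrow> \<sigma> x \<in> S"
    and "\<And>v. v \<in> V \<Longrightarrow> (\<lambda>x. v (\<sigma> x)) \<in> poly_gen V'"
  shows "poly_approx V' S' (\<lambda>x. f (\<sigma> x))"
  unfolding poly_approx_def
proof (intro allI impI)
  fix e :: real assume "e > 0"
  then obtain g where g: "g \<in> poly_gen V" "\<And>x. x \<in> S \<Longrightarrow> norm (f x - g x) \<le> e"
    using assms(1) unfolding poly_approx_def by blast
  then show "\<exists>h\<in>poly_gen V'. \<forall>x\<in>S'. norm (f (\<sigma> x) - h x) \<le> e"
    by (intro bexI[of _ "\<lambda>x. g (\<sigma> x)"] poly_gen_compose[OF g(1)] assms(3)) (auto simp: assms(2))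
qed

lemma poly_approx_sequence:
  assumes "poly_approx V S f"
  shows "\<exists>g :: nat \<Rightarrow> 'a \<Rightarrow> complex. (\<forall>n. g n \<in> poly_gen V) \<and>
    (\<forall>e>0. \<exists>N. \<forall>n\<ge>N. \<forall>x\<in>S. norm (g n x - f x) \<le> e)"
proof -
  have "\<exists>g\<in>poly_gen V. \<forall>x\<in>S. norm (f x - g x) \<le> inverse (real (Suc n))" for n
    using assms unfolding poly_approx_def by (simp add: inverse_positive_iff_positive)
  then obtain g where g: "\<And>n. g n \<in> poly_gen V"
    "\<And>n x. x \<in> S \<Longrightarrow> norm (f x - g n x) \<le> inverse (real (Suc n))" by metis
  show ?thesis
  proof (intro exI[of _ g] conjI allI impI)
    show "g n \<in> poly_gen V" for n by (rule g(1))
  next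
    fix e :: real assume "e > 0"
    then obtain N where N: "inverse (real (Suc N)) < e" using reals_Archimedean by blast
    have "norm (g n x - f x) \<le> e" if "n \<ge> N" "x \<in> S" for n x
    proof -
      have "norm (g n x - f x) \<le> inverse (real (Suc n))"
        using g(2)[OF that(2)] by (simp add: norm_minus_commute)
      also have "\<dots> \<le> inverse (real (Suc N))" using that(1) by (intro le_imp_inverse_le) auto
      finally show ?thesis using N by simp
    qed
    then show "\<exists>N. \<forall>n\<ge>N. \<forall>x\<in>S. norm (g n x - f x) \<le> e" by blast
  qed
qed

section \<open>Polarization of real-analytic functions\<close>

definition sesqui_coords :: "((complex ^ 'n) \<times> (complex ^ 'n) \<Rightarrow> complex) set" where
  "sesqui_coords = range (\<lambda>i X. fst X $ i) \<union> range (\<lambda>i X. cnj (snd X $ i))"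

lemma sesqui_on_poly:
  assumes "f \<in> poly_gen sesqui_coords"
  shows "sesqui_on (\<lambda>z w. f (z, w)) W"
  using assms
proof induction
  case (poly_gen_base f)
  then show ?case
    by (auto simp: sesqui_coords_def intro: sesqui_on_left sesqui_on_right)
qed (auto intro: sesqui_on_const sesqui_on_add sesqui_on_mult)

lemma sesqui_on_poly_approx:
  fixes H :: "complex ^ 'n \<Rightarrow> complex ^ 'n \<Rightarrow> complex"
  assumes "open W" "poly_approx sesqui_coords W (\<lambda>X. H (fst X) (snd X))"
  shows "sesqui_on H W"
proof -
  obtain g :: "nat \<Rightarrow> (complex ^ 'n) \<times> (complex ^ 'n) \<Rightarrow> complex" where g': "(\<forall>n. g n \<in> poly_gen sesqui_coords) \<and>
      (\<forall>e>0. \<exists>N. \<forall>n\<ge>N. \<forall>X\<in>W. norm (g n X - H (fst X) (snd X)) \<le> e)"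
    using poly_approx_sequence[OF assms(2)] by blast
  note g = g'[THEN conjunct1, rule_format] g'[THEN conjunct2, rule_format]
  show ?thesis
    by (rule sesqui_on_uniform_limit[where G = "\<lambda>n z w. g n (z, w)", OF assms(1) sesqui_on_poly[OF g(1)]])
       (use g(2) in auto)
qed

text \<open>The real and imaginary parts in the power series are replaced by complex quantities
  depending on both \<open>z\<close> and \<open>w\<close>. Absolute convergence at one point bounds
  all terms of the new series, and the Weierstrass M-test makes its finite partial sums uniform
  approximations.\<close>

lemma real_analytic_on_polarization:
  fixes Q :: "complex ^ 'n \<Rightarrow> complex"
  assumes "real_analytic_on Q U" "q \<in> U"
  obtains r H where "r > 0"
    "poly_approx sesqui_coords (ball q r \<times> ball q r) (\<lambda>X. H (fst X) (snd X))"
    "\<And>z. z \<in> ball q r \<Longrightarrow> H z z = Q z"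
proof -
  obtain c :: "('n \<Rightarrow> nat) \<Rightarrow> ('n \<Rightarrow> nat) \<Rightarrow> complex" and e where e: "e > 0"
    and c: "\<And>z. z \<in> ball q e \<Longrightarrow>
      ((\<lambda>(\<alpha>, \<beta>). c \<alpha> \<beta> * (\<Prod>i\<in>UNIV. complex_of_real (Re (z $ i - q $ i)) ^ \<alpha> i)
                       * (\<Prod>i\<in>UNIV. complex_of_real (Im (z $ i - q $ i)) ^ \<beta> i)) has_sum Q z) UNIV"
    using assms unfolding real_analytic_on_def by blast
  \<comment> \<open>Small enough that shifting all real and imaginary coordinates of
    \<open>q\<close> by \<open>r\<close> stays in \<open>ball q e\<close>: the shift has norm at
    most \<open>2 * r\<close> in each of the \<open>CARD('n)\<close> entries.\<close>
  define r where "r = e / (2 * real CARD('n) + 1)"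
  have r: "r > 0" using e by (simp add: r_def add_nonneg_pos)
  have "2 * real CARD('n) + 1 > 0" by (simp add: add_nonneg_pos)
  then have re: "r * (2 * real CARD('n) + 1) = e" by (simp add: r_def)
  have "r * 1 \<le> r * (2 * real CARD('n) + 1)" using r by (intro mult_left_mono) auto
  then have re': "r \<le> e" using re by simp
  \<comment> \<open>\<open>s\<close> and \<open>t\<close> complexify the real and the imaginary
    part: on the diagonal they reduce to those of \<open>z - q\<close>, and on the product of balls
    they are bounded by \<open>r\<close>.\<close>
  define s where "s X i = ((fst X $ i - q $ i) + cnj (snd X $ i - q $ i)) / 2" for X :: "(complex ^ 'n) \<times> (complex ^ 'n)" and i
  define t where "t X i = ((fst X $ i - q $ i) - cnj (snd X $ i - q $ i)) / (2 * \<i>)" for X :: "(complex ^ 'n) \<times> (complex ^ 'n)" and i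
  define T where "T = (\<lambda>(\<alpha>, \<beta>) X. c \<alpha> \<beta> * (\<Prod>i\<in>UNIV. s X i ^ \<alpha> i) * (\<Prod>i\<in>UNIV. t X i ^ \<beta> i))"
  define M where "M = (\<lambda>(\<alpha>, \<beta>). norm (c \<alpha> \<beta>) * (\<Prod>i\<in>UNIV. r ^ \<alpha> i) * (\<Prod>i\<in>UNIV. r ^ \<beta> i))"
  have sgen: "(\<lambda>X. s X i) \<in> poly_gen sesqui_coords" and tgen: "(\<lambda>X. t X i) \<in> poly_gen sesqui_coords" for i
    unfolding s_def t_def divide_inverse complex_cnj_diff
    by (intro poly_gen_mult poly_gen_add poly_gen_diff poly_gen_const poly_gen_base; simp add: sesqui_coords_def)+
  have st: "norm (s X i) \<le> r" "norm (t X i) \<le> r" if "X \<in> ball q r \<times> ball q r" for X i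
  proof -
    have a: "norm (fst X $ i - q $ i) \<le> r" "norm (cnj (snd X $ i - q $ i)) \<le> r"
      using that Finite_Cartesian_Product.norm_nth_le[of "fst X - q" i] Finite_Cartesian_Product.norm_nth_le[of "snd X - q" i]
      by (auto simp: dist_norm norm_minus_commute simp del: complex_cnj_diff)
    show "norm (s X i) \<le> r"
      using norm_triangle_mono[OF a] by (simp add: s_def norm_divide)
    show "norm (t X i) \<le> r"
      using norm_triangle_le_diff[OF add_mono[OF a]] by (simp add: t_def norm_divide norm_mult)
  qed
  have TM: "norm (T k X) \<le> M k" if "X \<in> ball q r \<times> ball q r" for k X
    unfolding T_def M_def
    by (cases k) (auto simp: norm_mult prod_norm[symmetric] norm_power
      intro!: mult_mono prod_mono power_mono st[OF that] mult_nonneg_nonneg prod_nonneg zero_le_power less_imp_le[OF r])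
  have Msum: "M summable_on UNIV"
  proof -
    \<comment> \<open>At this single point the absolute values of the terms are exactly the
      majorants \<open>M\<close>.\<close>
    define z where "z = (\<chi> i. q $ i + Complex r r)"
    have "norm (z - q) \<le> (\<Sum>i\<in>UNIV. norm ((z - q) $ i))" unfolding norm_vec_def by (rule L2_set_le_sum) simp
    also have "\<dots> \<le> (\<Sum>i\<in>(UNIV :: 'n set). 2 * r)"
      using r cmod_le[of "Complex r r"] by (intro sum_mono) (simp add: z_def)
    also have "\<dots> < e" using re r by (simp add: algebra_simps)
    finally have "z \<in> ball q e" by (simp add: dist_norm norm_minus_commute)
    let ?t = "\<lambda>(\<alpha>, \<beta>). c \<alpha> \<beta> * (\<Prod>i\<in>UNIV. complex_of_real (Re (z $ i - q $ i)) ^ \<alpha> i)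
                       * (\<Prod>i\<in>UNIV. complex_of_real (Im (z $ i - q $ i)) ^ \<beta> i)"
    from has_sum_imp_summable[OF c[OF \<open>z \<in> ball q e\<close>]] have "(\<lambda>x. norm (?t x)) summable_on UNIV"
      by (simp add: summable_on_iff_abs_summable_on_complex)
    moreover have "(\<lambda>x. norm (?t x)) = M"
      using r by (auto simp: fun_eq_iff M_def z_def norm_mult prod_norm[symmetric] norm_power)
    ultimately show ?thesis by simp
  qed
  define H where "H z w = (\<Sum>\<^sub>\<infinity>k. T k (z, w))" for z w
  have lim: "uniform_limit (ball q r \<times> ball q r) (\<lambda>K X. \<Sum>k\<in>K. T k X) (\<lambda>X. \<Sum>\<^sub>\<infinity>k. T k X) (finite_subsets_at_top UNIV)"
    by (rule Weierstrass_m_test_general[OF TM Msum])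
  have "poly_approx sesqui_coords (ball q r \<times> ball q r) (\<lambda>X. H (fst X) (snd X))"
    unfolding poly_approx_def
  proof (intro allI impI)
    fix \<epsilon> :: real assume "\<epsilon> > 0"
    from eventually_happens'[OF finite_subsets_at_top_neq_bot uniform_limitD[OF lim this]]
    obtain K where K: "\<forall>X\<in>ball q r \<times> ball q r. dist (\<Sum>k\<in>K. T k X) (\<Sum>\<^sub>\<infinity>k. T k X) < \<epsilon>"
      by (rule exE)
    have "(\<lambda>X. \<Sum>k\<in>K. T k X) \<in> poly_gen sesqui_coords"
      unfolding T_def case_prod_unfold
      by (intro poly_gen_sum poly_gen_mult poly_gen_prod poly_gen_power sgen tgen poly_gen_const)
    then show "\<exists>g\<in>poly_gen sesqui_coords. \<forall>X\<in>ball q r \<times> ball q r. norm (H (fst X) (snd X) - g X) \<le> \<epsilon>"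
      using K by (intro bexI[of _ "\<lambda>X. \<Sum>k\<in>K. T k X"]) (auto simp: H_def dist_norm norm_minus_commute less_imp_le)
  qed
  moreover have "H z z = Q z" if "z \<in> ball q r" for z
  proof -
    have s: "s (z, z) i = complex_of_real (Re (z $ i - q $ i))" for i
      by (simp add: s_def complex_eq_iff)
    have t: "t (z, z) i = complex_of_real (Im (z $ i - q $ i))" for i
    proof -
      have "(z $ i - q $ i) - cnj (z $ i - q $ i) = 2 * \<i> * complex_of_real (Im (z $ i - q $ i))"
        by (simp add: complex_eq_iff)
      then show ?thesis by (simp add: t_def del: complex_cnj_diff)
    qed
    have "z \<in> ball q e" using that re' by auto
    from c[OF this] have "((\<lambda>k. T k (z, z)) has_sum Q z) UNIV"
      by (simp add: T_def s t case_prod_unfold)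
    then show ?thesis by (simp add: H_def infsumI)
  qed
  ultimately show ?thesis using that r by blast
qed

section \<open>Polarization and the hermitian rank\<close>

text \<open>The parameters \<open>l\<close> for which both points stay in the ball form an open
  convex set containing 0 and 1, so the identity theorem in one variable carries the zeros near
  \<open>l = 0\<close> to \<open>l = 1\<close>.\<close>

lemma sesqui_on_zero_along_line:
  assumes G: "sesqui_on G (ball q r \<times> ball q r)"
    and "a + h \<in> ball q r" "a + k \<in> ball q r" "a \<in> ball q r" "d > 0"
    and zero: "\<And>l. norm l < d \<Longrightarrow> a + l *s h \<in> ball q r \<Longrightarrow> a + cnj l *s k \<in> ball q r \<Longrightarrow>
      G (a + l *s h) (a + cnj l *s k) = 0"
  shows "G (a + h) (a + k) = 0"
proof -
  define S where "S = (\<lambda>l. l *s h) -` ball (q - a) r \<inter> (\<lambda>l. cnj l *s k) -` ball (q - a) r"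
  have S: "l \<in> S \<longleftrightarrow> a + l *s h \<in> ball q r \<and> a + cnj l *s k \<in> ball q r" for l
    by (simp add: S_def dist_norm algebra_simps)
  have op: "open S"
    unfolding S_def
    by (intro open_Int open_vimage open_ball linear_continuous_on linear_linear[THEN iffD2]
      linear_cscale linear_cscale_cnj)
  have "convex S"
    unfolding S_def
    by (intro convex_Int convex_linear_vimage convex_ball linear_cscale linear_cscale_cnj)
  then have conn: "connected S" by (rule convex_connected)
  have 0: "0 \<in> S" and 1: "1 \<in> S" using assms(2-4) by (auto simp: S)
  have "G (a + 1 *s h) (a + cnj 1 *s k) = 0"
  proof (rule analytic_continuation_open[where s = "ball 0 d \<inter> S" and s' = S and g = "\<lambda>_. 0"
        and f = "\<lambda>l. G (a + l *s h) (a + cnj l *s k)"])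
    show "(\<lambda>l. G (a + l *s h) (a + cnj l *s k)) holomorphic_on S"
      by (rule sesqui_on_line[OF G]) (simp add: S)
    show "ball 0 d \<inter> S \<noteq> {}" using 0 \<open>d > 0\<close> by (metis IntI centre_in_ball empty_iff)
  qed (use op conn 1 zero S in auto)
  then show ?thesis by simp
qed

lemma sesqui_on_zero_propagate:
  assumes G: "sesqui_on G (ball q r \<times> ball q r)" and a: "a \<in> ball q r" "d > 0"
    and zero: "\<And>z w. z \<in> ball a d \<Longrightarrow> w \<in> ball a d \<Longrightarrow> G z w = 0"
    and zw: "z \<in> ball q r" "w \<in> ball q r"
  shows "G z w = 0"
proof -
  define K where "K = norm (z - a) + norm (w - a) + 1"
  have K: "K > 0" "norm (z - a) \<le> K" "norm (w - a) \<le> K" by (auto simp: K_def add_nonneg_pos)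
  have "G (a + (z - a)) (a + (w - a)) = 0"
  proof (rule sesqui_on_zero_along_line[OF G])
    show "d / K > 0" using K a by simp
    show "G (a + l *s (z - a)) (a + cnj l *s (w - a)) = 0" if l: "norm l < d / K" for l
    proof (rule zero)
      have mem: "a + v \<in> ball a d \<longleftrightarrow> norm v < d" for v by (simp add: dist_norm)
      have *: "norm l * norm v < d" if v: "norm v \<le> K" for v :: "complex ^ 'a"
      proof -
        have "norm l * norm v \<le> norm l * K" by (intro mult_left_mono v) simp
        also have "\<dots> < d" using l K(1) by (simp add: pos_less_divide_eq)
        finally show ?thesis .
      qed
      show "a + l *s (z - a) \<in> ball a d" "a + cnj l *s (w - a) \<in> ball a d"
        unfolding mem norm_cscale using *[OF K(2)] *[OF K(3)] by simp_all
    qed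
  qed (use a zw in auto)
  then show ?thesis by simp
qed

text \<open>Eliminating at a pivot in the small ball keeps the function sesqui-holomorphic on the
  large one and lowers \<open>n\<close>. The induction ends with the zero function, where the
  identity theorem applies.\<close>

lemma sep_rank_le_propagate:
  assumes "sesqui_on G (ball q r \<times> ball q r)" and a: "a \<in> ball q r" "d > 0" "ball a d \<subseteq> ball q r"
    and "sep_rank_le n (ball a d) (ball a d) G"
  shows "sep_rank_le n (ball q r) (ball q r) G"
  using assms(1,5)
proof (induction n arbitrary: G)
  case 0
  then show ?case
    using sesqui_on_zero_propagate[OF 0(1) a(1,2)] by (auto simp: sep_rank_le_0)
next
  case (Suc n)
  show ?case
  proof (cases "\<forall>z\<in>ball a d. \<forall>w\<in>ball a d. G z w = 0")
    case True
    then have "sep_rank_le 0 (ball q r) (ball q r) G"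
      using sesqui_on_zero_propagate[OF Suc.prems(1) a(1,2)] by (auto simp: sep_rank_le_0)
    then show ?thesis by (rule sep_rank_le_mono) simp
  next
    case False
    then obtain z w where zw: "z \<in> ball a d" "w \<in> ball a d" "G z w \<noteq> 0" by blast
    have "sep_rank_le n (ball q r) (ball q r) (eliminate z w G)"
      by (rule Suc.IH[OF sesqui_on_eliminate[OF Suc.prems(1)] sep_rank_le_eliminate[OF Suc.prems(2) zw]])
         (use zw a in auto)
    then show ?thesis by (rule sep_rank_le_uneliminate)
  qed
qed

text \<open>Polarization: along \<open>\<lambda> \<mapsto> (A + \<lambda>V, A + cnj \<lambda> V)\<close> the function vanishes for real \<open>\<lambda>\<close>,
  and any pair of points close to \<open>q\<close> is reached at \<open>\<lambda> = \<i>\<close>.\<close>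

lemma sesqui_on_zero_diagonal:
  assumes G: "sesqui_on G (ball q r \<times> ball q r)"
    and zero: "\<And>z. z \<in> ball q r \<Longrightarrow> G z z = 0"
    and z: "z \<in> ball q (r / 4)" and w: "w \<in> ball q (r / 4)"
  shows "G z w = 0"
proof -
  define A where "A = (1 / 2) *s (z + w)"
  define V where "V = (1 / (2 * \<i>)) *s (z - w)"
  have n: "norm (z - q) < r / 4" "norm (w - q) < r / 4"
    using z w by (auto simp: dist_norm norm_minus_commute)
  have Aq: "A - q = (1 / 2) *s ((z - q) + (w - q))"
    by (simp add: A_def vec_eq_iff field_simps)
  have "norm (A - q) \<le> (norm (z - q) + norm (w - q)) / 2"
    unfolding Aq norm_cscale using norm_triangle_ineq[of "z - q" "w - q"] by (simp add: norm_divide)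
  then have nA: "norm (A - q) < r / 4" using n by simp
  have Vq: "V = (1 / (2 * \<i>)) *s ((z - q) - (w - q))" by (simp add: V_def)
  have "norm V \<le> (norm (z - q) + norm (w - q)) / 2"
    unfolding Vq norm_cscale using norm_triangle_ineq4[of "z - q" "w - q"] by (simp add: norm_divide norm_mult)
  then have nV: "norm V < r / 4" using n by simp
  have r: "r > 0" using n(1) norm_ge_zero[of "z - q"] by linarith
  \<comment> \<open>The parameter disc has to contain \<open>\<i>\<close>, hence radius 2. It fits
    because \<open>A - q\<close> and \<open>V\<close> both have norm below
    \<open>r / 4\<close>.\<close>
  have inB: "A + l *s V \<in> ball q r" if "norm l < 2" for l
  proof -
    have "norm (A + l *s V - q) \<le> norm (A - q) + norm (l *s V)"
      using norm_triangle_ineq[of "A - q" "l *s V"] by (simp add: algebra_simps)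
    also have "norm (l *s V) \<le> 2 * norm V"
      unfolding norm_cscale using that by (intro mult_right_mono) auto
    finally have "norm (A + l *s V - q) < r" using nA nV r by linarith
    then show ?thesis by (simp add: dist_norm norm_minus_commute)
  qed
  have "G (A + \<i> *s V) (A + cnj \<i> *s V) = 0"
  proof (rule analytic_continuation[where S = "ball 0 2" and U = "complex_of_real ` {0<..<1}" and \<xi> = 0
        and f = "\<lambda>l. G (A + l *s V) (A + cnj l *s V)"])
    show "(\<lambda>l. G (A + l *s V) (A + cnj l *s V)) holomorphic_on ball 0 2"
      by (rule sesqui_on_line[OF G]) (use inB inB[of "cnj _"] in simp)
    show "G (A + l *s V) (A + cnj l *s V) = 0" if l: "l \<in> complex_of_real ` {0<..<1}" for l
    proof -
      obtain t where t: "l = complex_of_real t" "0 < t" "t < 1" using l by auto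
      have "G (A + l *s V) (A + l *s V) = 0" by (rule zero[OF inB]) (use t in simp)
      then show ?thesis by (simp add: t(1))
    qed
    show "(0 :: complex) islimpt complex_of_real ` {0<..<1}"
      unfolding islimpt_approachable
    proof (intro allI impI)
      fix e :: real assume e: "e > 0"
      define t where "t = min e 1 / 2"
      have "t > 0" "t < 1" "t < e" using e by (auto simp: t_def min_def)
      then show "\<exists>x'\<in>complex_of_real ` {0<..<1}. x' \<noteq> 0 \<and> dist x' 0 < e"
        by (intro bexI[of _ "complex_of_real t"] imageI) auto
    qed
  qed auto
  moreover have "A + \<i> *s V = z" "A + cnj \<i> *s V = w"
    by (simp_all add: A_def V_def vec_eq_iff field_simps)
  ultimately show ?thesis by simp
qed

text \<open>From left to right, the difference of \<open>G\<close> and the polarized decomposition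
  vanishes on the diagonal, hence off it near \<open>a\<close>, and the rank bound spreads over the
  ball. From right to left, factors taken from sections of \<open>G\<close> are holomorphic or
  antiholomorphic. The point \<open>a\<close> is absent from the right-hand side, which is why the
  rank is locally constant.\<close>

lemma hermitian_decomposition_iff:
  assumes G: "sesqui_on G (ball q r \<times> ball q r)"
    and R: "\<And>z. z \<in> ball q r \<Longrightarrow> R z = G z z" and a: "a \<in> ball q r"
  shows "(\<exists>W (\<phi> :: nat \<Rightarrow> complex ^ 'n \<Rightarrow> complex) \<psi>. open W \<and> a \<in> W \<and>
      (\<forall>k<n. holomorphic_several_on (\<phi> k) W \<and> holomorphic_several_on (\<psi> k) W) \<and>
      (\<forall>z\<in>W. R z = (\<Sum>k<n. \<phi> k z * cnj (\<psi> k z))))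
    \<longleftrightarrow> sep_rank_le n (ball q r) (ball q r) G" (is "?L \<longleftrightarrow> ?R")
proof
  assume ?L
  then obtain W and \<phi> \<psi> :: "nat \<Rightarrow> complex ^ 'n \<Rightarrow> complex" where W: "open W" "a \<in> W"
    and hol: "\<And>k. k < n \<Longrightarrow> holomorphic_several_on (\<phi> k) W" "\<And>k. k < n \<Longrightarrow> holomorphic_several_on (\<psi> k) W"
    and dec: "\<And>z. z \<in> W \<Longrightarrow> R z = (\<Sum>k<n. \<phi> k z * cnj (\<psi> k z))"
    by blast
  have "open (W \<inter> ball q r)" "a \<in> W \<inter> ball q r" using W a by auto
  then obtain d where d: "d > 0" "ball a d \<subseteq> W \<inter> ball q r" using open_contains_ball by blast
  define F where "F z w = G z w + (\<Sum>k<n. - 1 * (\<phi> k z * cnj (\<psi> k w)))" for z w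
  have "sesqui_on (\<lambda>z w. \<phi> k z * cnj (\<psi> k w)) (ball a d \<times> ball a d)" if "k < n" for k
    by (rule sesqui_on_subset[OF sesqui_on_tensor[OF hol(1,2)[OF that]]]) (use d in auto)
  moreover have "sesqui_on G (ball a d \<times> ball a d)"
    by (rule sesqui_on_subset[OF G]) (use d in auto)
  ultimately have F: "sesqui_on F (ball a d \<times> ball a d)"
    unfolding F_def by (intro sesqui_on_add sesqui_on_sum sesqui_on_mult[OF sesqui_on_const]) auto
  have Fz: "F z z = 0" if "z \<in> ball a d" for z
  proof -
    have "z \<in> W" "z \<in> ball q r" using that d by auto
    then show ?thesis using dec[of z] R[of z] by (simp add: F_def sum_negf)
  qed
  have "G z w = (\<Sum>k<n. \<phi> k z * cnj (\<psi> k w))" if "z \<in> ball a (d / 4)" "w \<in> ball a (d / 4)" for z w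
    using sesqui_on_zero_diagonal[OF F Fz that] by (simp add: F_def sum_negf)
  then have "sep_rank_le n (ball a (d / 4)) (ball a (d / 4)) G"
    unfolding sep_rank_le_def by (intro exI[of _ \<phi>] exI[of _ "\<lambda>k w. cnj (\<psi> k w)"]) auto
  then show ?R
    by (rule sep_rank_le_propagate[OF G a, rotated 2]) (use d subset_ball[of "d / 4" d a] in auto)
next
  assume ?R
  have hs0: "holomorphic_several_on (\<lambda>z. 0) (ball q r)"
    unfolding holomorphic_several_on_def by (intro ballI exI[of _ "\<lambda>_. 0"]) auto
  have hsl: "holomorphic_several_on (\<lambda>z. f z + c * g z) (ball q r)"
    if fg: "holomorphic_several_on f (ball q r)" "holomorphic_several_on g (ball q r)" for f g c
    unfolding holomorphic_several_on_def
  proof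
    fix z assume z: "z \<in> ball q r"
    obtain D where D: "(f has_derivative D) (at z)" "\<And>c v. D (c *s v) = c * D v"
      using fg(1) z unfolding holomorphic_several_on_def by blast
    obtain E where E: "(g has_derivative E) (at z)" "\<And>c v. E (c *s v) = c * E v"
      using fg(2) z unfolding holomorphic_several_on_def by blast
    show "\<exists>f'. ((\<lambda>z. f z + c * g z) has_derivative f') (at z) \<and> (\<forall>c v. f' (c *s v) = c * f' v)"
      by (intro exI[of _ "\<lambda>v. D v + c * E v"] conjI has_derivative_add D(1) has_derivative_mult_right E(1))
         (simp add: D(2) E(2) algebra_simps)
  qed
  have "\<exists>f g. (\<forall>k<n. holomorphic_several_on (f k) (ball q r) \<and> holomorphic_several_on (\<lambda>w. cnj (g k w)) (ball q r)) \<and>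
      (\<forall>z\<in>ball q r. \<forall>w\<in>ball q r. G z w = (\<Sum>k<n. f k z * g k w))"
  proof (rule sep_rank_le_sections[OF \<open>?R\<close>])
    show "holomorphic_several_on (\<lambda>z. G z w) (ball q r)" if "w \<in> ball q r" for w
      by (rule sesqui_on_imp_holomorphic_left[OF G that])
    show "holomorphic_several_on (\<lambda>w. cnj (G z w)) (ball q r)" if "z \<in> ball q r" for z
      by (rule sesqui_on_imp_holomorphic_right[OF G that])
    show "holomorphic_several_on (\<lambda>w. cnj (f w + c * g w)) (ball q r)"
      if "holomorphic_several_on (\<lambda>w. cnj (f w)) (ball q r)" "holomorphic_several_on (\<lambda>w. cnj (g w)) (ball q r)" for f g c
      using hsl[OF that, of "cnj c"] by simp
  qed (use hs0 hsl in auto)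
  then obtain f g where fg: "\<And>k. k < n \<Longrightarrow> holomorphic_several_on (f k) (ball q r)"
    "\<And>k. k < n \<Longrightarrow> holomorphic_several_on (\<lambda>w. cnj (g k w)) (ball q r)"
    "\<And>z w. z \<in> ball q r \<Longrightarrow> w \<in> ball q r \<Longrightarrow> G z w = (\<Sum>k<n. f k z * g k w)" by blast
  show ?L
    by (intro exI[of _ "ball q r"] exI[of _ f] exI[of _ "\<lambda>k w. cnj (g k w)"])
       (use a fg R in auto)
qed

lemma hermitian_rank_at_eq:
  assumes "sesqui_on G (ball q r \<times> ball q r)" "\<And>z. z \<in> ball q r \<Longrightarrow> R z = G z z" "a \<in> ball q r"
  shows "hermitian_rank_at a R = Inf {enat n | n. sep_rank_le n (ball q r) (ball q r) G}"
  unfolding hermitian_rank_at_def using hermitian_decomposition_iff[where R = R, OF assms] by simp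

definition polarizable_on :: "(complex ^ 'n) set \<Rightarrow> (complex ^ 'n \<Rightarrow> complex) \<Rightarrow> bool" where
  "polarizable_on U R \<longleftrightarrow> (\<forall>q\<in>U. \<exists>r G. r > 0 \<and> sesqui_on G (ball q r \<times> ball q r) \<and>
     (\<forall>z\<in>ball q r. R z = G z z))"

lemma hermitian_rank_at_constant:
  assumes "connected U" "polarizable_on U R" "p \<in> U" "q \<in> U"
  shows "hermitian_rank_at p R = hermitian_rank_at q R"
proof (rule connected_local_const[where f = "\<lambda>a. hermitian_rank_at a R", OF assms(1,3,4)], intro ballI)
  fix a assume "a \<in> U"
  then obtain r G where G: "r > 0" "sesqui_on G (ball a r \<times> ball a r)" "\<And>z. z \<in> ball a r \<Longrightarrow> R z = G z z"
    using assms(2) unfolding polarizable_on_def by blast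
  have "hermitian_rank_at a R = hermitian_rank_at b R" if "b \<in> ball a r" for b
  proof -
    have "a \<in> ball a r" using G(1) by simp
    from hermitian_rank_at_eq[OF G(2,3) this] hermitian_rank_at_eq[OF G(2,3) that]
    show ?thesis by simp
  qed
  then show "\<forall>\<^sub>F b in at a within U. hermitian_rank_at a R = hermitian_rank_at b R"
    unfolding eventually_at using G(1) by (intro exI[of _ r]) (auto simp: dist_commute)
qed

lemma hermitian_rank_eq:
  assumes "connected U" "polarizable_on U R" "p \<in> U"
  shows "hermitian_rank U R = hermitian_rank_at p R"
  unfolding hermitian_rank_def
proof (rule the_equality)
  show "\<forall>q\<in>U. hermitian_rank_at q R = hermitian_rank_at p R"
    using hermitian_rank_at_constant[OF assms(1,2) _ assms(3)] by blast
  show "r = hermitian_rank_at p R" if "\<forall>q\<in>U. hermitian_rank_at q R = r" for r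
    using that assms(3) by simp
qed

text \<open>The identity theorem for \<open>R\<close>, obtained from the constancy of the rank: a
  function vanishing near \<open>p\<close> has rank 0 at \<open>p\<close>, hence at every point of
  \<open>U\<close>.\<close>

lemma polarizable_on_nonzero_near:
  assumes "connected U" "polarizable_on U R" "p \<in> U" "\<exists>z\<in>U. R z \<noteq> 0" "d > 0"
  shows "\<exists>z\<in>ball p d. R z \<noteq> 0"
proof (rule ccontr)
  assume "\<not> ?thesis"
  then have "\<forall>z\<in>ball p d. R z = 0" by blast
  then have "hermitian_rank_at p R \<le> enat 0"
    unfolding hermitian_rank_at_def using \<open>d > 0\<close>
    by (intro Inf_lower CollectI exI[of _ "0 :: nat"] conjI refl exI[of _ "ball p d"] exI) auto
  moreover obtain z where z: "z \<in> U" "R z \<noteq> 0" using assms(4) by blast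
  ultimately have "hermitian_rank_at z R = 0"
    using hermitian_rank_at_constant[OF assms(1-3) z(1)] by (simp add: enat_0)
  moreover obtain r G where G: "r > 0" "sesqui_on G (ball z r \<times> ball z r)" "\<And>a. a \<in> ball z r \<Longrightarrow> R a = G a a"
    using assms(2) z(1) unfolding polarizable_on_def by blast
  have zr: "z \<in> ball z r" using G(1) by simp
  ultimately have "Inf {enat n | n. sep_rank_le n (ball z r) (ball z r) G} = 0"
    using hermitian_rank_at_eq[OF G(2,3) zr] by simp
  then have "enat 0 \<in> {enat n | n. sep_rank_le n (ball z r) (ball z r) G}"
    by (metis (no_types, lifting) enat_0 Inf_enat_def LeastI_ex ex_in_conv i0_ne_infinity)
  then have "sep_rank_le 0 (ball z r) (ball z r) G" by simp
  then have "G z z = 0" using zr by (auto simp: sep_rank_le_0)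
  then show False using G(3)[OF zr] z(2) by simp
qed

section \<open>Taylor coefficients in several variables\<close>

definition coords :: "(('v \<Rightarrow> complex) \<Rightarrow> complex) set" where
  "coords = range (\<lambda>v x. x v)"

text \<open>The index type may be infinite. It will be \<open>nat + nat\<close>, so that no type has
  to depend on the number of coordinates; only the finitely many variables in a list are ever
  expanded.\<close>

definition polydisc :: "real \<Rightarrow> ('v \<Rightarrow> complex) set" where
  "polydisc \<rho> = {x. \<forall>v. norm (x v) < \<rho>}"

lemma polydisc_upd: "x \<in> polydisc \<rho> \<Longrightarrow> norm t < \<rho> \<Longrightarrow> x(v := t) \<in> polydisc \<rho>"
  by (simp add: polydisc_def)

lemma zero_in_polydisc: "\<rho> > 0 \<Longrightarrow> (\<lambda>_. 0) \<in> polydisc \<rho>"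
  by (simp add: polydisc_def)

lemma coords_bounded: "v \<in> coords \<Longrightarrow> \<exists>K. \<forall>x\<in>polydisc \<rho>. norm (v x) \<le> K"
  unfolding coords_def polydisc_def by (force intro!: exI[of _ \<rho>] less_imp_le)

text \<open>The value does not depend on \<open>x v\<close>, so the operation can be iterated over
  further variables.\<close>

definition taylor :: "'v \<Rightarrow> nat \<Rightarrow> (('v \<Rightarrow> complex) \<Rightarrow> complex) \<Rightarrow> ('v \<Rightarrow> complex) \<Rightarrow> complex" where
  "taylor v n f x = (deriv ^^ n) (\<lambda>t. f (x(v := t))) 0 / fact n"

lemma poly_gen_holomorphic:
  assumes "f \<in> poly_gen coords"
  shows "(\<lambda>t. f (x(v := t))) holomorphic_on A"
  using assms
proof induction
  case (poly_gen_base f)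
  then obtain u where "f = (\<lambda>x. x u)" by (auto simp: coords_def)
  then show ?case by (cases "u = v") auto
qed (auto intro: holomorphic_intros)

lemma poly_approx_holomorphic:
  assumes f: "poly_approx coords (polydisc \<rho>) f" and x: "x \<in> polydisc \<rho>"
  shows "(\<lambda>t. f (x(v := t))) holomorphic_on ball 0 \<rho>"
proof -
  obtain g :: "nat \<Rightarrow> ('a \<Rightarrow> complex) \<Rightarrow> complex" where g': "(\<forall>n. g n \<in> poly_gen coords) \<and>
      (\<forall>e>0. \<exists>N. \<forall>n\<ge>N. \<forall>x\<in>polydisc \<rho>. norm (g n x - f x) \<le> e)"
    using poly_approx_sequence[OF f] by blast
  note g = g'[THEN conjunct1, rule_format] g'[THEN conjunct2, rule_format]
  have ul: "uniform_limit (ball 0 \<rho>) (\<lambda>n t. g n (x(v := t))) (\<lambda>t. f (x(v := t))) sequentially"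
  proof (rule uniform_limitI)
    fix e :: real assume e: "e > 0"
    then have "e / 2 > 0" by simp
    from g(2)[OF this] obtain N where N: "\<forall>n\<ge>N. \<forall>x\<in>polydisc \<rho>. norm (g n x - f x) \<le> e / 2" by (rule exE)
    have "dist (g n (x(v := t))) (f (x(v := t))) < e" if "n \<ge> N" "t \<in> ball 0 \<rho>" for n t
    proof -
      have "norm (g n (x(v := t)) - f (x(v := t))) \<le> e / 2"
        using N that polydisc_upd[OF x, of t v] by simp
      then show ?thesis using e by (simp add: dist_norm)
    qed
    then show "\<forall>\<^sub>F n in sequentially. \<forall>t\<in>ball 0 \<rho>. dist (g n (x(v := t))) (f (x(v := t))) < e"
      unfolding eventually_sequentially by blast
  qed
  show ?thesis
  proof (rule holomorphic_uniform_sequence[where f = "\<lambda>n t. g n (x(v := t))"])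
    show "\<exists>d>0. cball t d \<subseteq> ball 0 \<rho> \<and>
        uniform_limit (cball t d) (\<lambda>n t. g n (x(v := t))) (\<lambda>t. f (x(v := t))) sequentially"
      if t: "t \<in> ball 0 \<rho>" for t
    proof -
      obtain d where "d > 0" "cball t d \<subseteq> ball 0 \<rho>"
        using bspec[OF open_contains_cball[THEN iffD1, OF open_ball] t] by blast
      then show ?thesis using uniform_limit_on_subset[OF ul] by blast
    qed
  qed (auto intro: poly_gen_holomorphic g)
qed

lemma taylor_const: "taylor v n (\<lambda>x. c) x = (if n = 0 then c else 0)"
  by (simp add: taylor_def)

lemma taylor_same: "taylor v n (\<lambda>x. x v) x = (if n = 1 then 1 else 0)"
  by (simp add: taylor_def)

lemma taylor_other: "u \<noteq> v \<Longrightarrow> taylor v n (\<lambda>x. x u) x = (if n = 0 then x u else 0)"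
  by (simp add: taylor_def)

lemma taylor_add_hol:
  assumes "(\<lambda>t. f (x(v := t))) holomorphic_on ball 0 \<rho>" "(\<lambda>t. g (x(v := t))) holomorphic_on ball 0 \<rho>" "\<rho> > 0"
  shows "taylor v n (\<lambda>x. f x + g x) x = taylor v n f x + taylor v n g x"
  unfolding taylor_def
  by (subst higher_deriv_add[OF assms(1,2) open_ball]) (use assms(3) in \<open>auto simp: add_divide_distrib\<close>)

lemma taylor_mult_hol:
  assumes "(\<lambda>t. f (x(v := t))) holomorphic_on ball 0 \<rho>" "(\<lambda>t. g (x(v := t))) holomorphic_on ball 0 \<rho>" "\<rho> > 0"
  shows "taylor v n (\<lambda>x. f x * g x) x = (\<Sum>i = 0..n. taylor v i f x * taylor v (n - i) g x)"
  unfolding taylor_def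
  by (subst higher_deriv_mult[OF assms(1,2) open_ball])
     (use assms(3) in \<open>auto simp: sum_divide_distrib binomial_fact field_simps intro!: sum.cong\<close>)

lemma taylor_poly_gen:
  assumes "f \<in> poly_gen coords"
  shows "taylor v n f \<in> poly_gen coords"
  using assms
proof (induction arbitrary: n)
  case (poly_gen_const c)
  show ?case by (subst taylor_const[abs_def]) (rule poly_gen.poly_gen_const)
next
  case (poly_gen_base f)
  then obtain u where u: "f = (\<lambda>x. x u)" by (auto simp: coords_def)
  show ?case
  proof (cases "u = v")
    case True
    then show ?thesis unfolding u by (simp add: taylor_same[abs_def] poly_gen.poly_gen_const)
  next
    case False
    then have "taylor v n f = (if n = 0 then (\<lambda>x. x u) else (\<lambda>x. 0))"
      by (auto simp: u taylor_other)
    then show ?thesis using poly_gen_base by (simp add: u poly_gen.intros)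
  qed
next
  case (poly_gen_add f g)
  have "taylor v n (\<lambda>x. f x + g x) = (\<lambda>x. taylor v n f x + taylor v n g x)"
    by (intro ext taylor_add_hol[of _ _ _ 1] poly_gen_holomorphic poly_gen_add.hyps) simp
  then show ?case using poly_gen_add.IH by (simp add: poly_gen.poly_gen_add)
next
  case (poly_gen_mult f g)
  have "taylor v n (\<lambda>x. f x * g x) = (\<lambda>x. \<Sum>i = 0..n. taylor v i f x * taylor v (n - i) g x)"
    by (intro ext taylor_mult_hol[of _ _ _ 1] poly_gen_holomorphic poly_gen_mult.hyps) simp
  then show ?case using poly_gen_mult.IH by (simp add: poly_gen.poly_gen_mult poly_gen_sum)
qed

text \<open>Cauchy's inequality on the circle of radius \<open>\<rho> / 2\<close>, uniform in the
  other variables. It carries uniform approximation by polynomials over to Taylor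
  coefficients.\<close>

lemma taylor_bound:
  assumes f: "poly_approx coords (polydisc \<rho>) f" and g: "poly_approx coords (polydisc \<rho>) g"
    and x: "x \<in> polydisc \<rho>" and e: "\<And>x. x \<in> polydisc \<rho> \<Longrightarrow> norm (f x - g x) \<le> e"
  shows "norm (taylor v n f x - taylor v n g x) \<le> e / (\<rho> / 2) ^ n"
proof -
  note hf = poly_approx_holomorphic[OF f x, of v] and hg = poly_approx_holomorphic[OF g x, of v]
  have "norm (x v) < \<rho>" using x by (simp add: polydisc_def)
  then have \<rho>: "\<rho> > 0" using norm_ge_zero[of "x v"] by linarith
  let ?h = "\<lambda>t. f (x(v := t)) - g (x(v := t))"
  have hh: "?h holomorphic_on ball 0 \<rho>" by (intro holomorphic_on_diff hf hg)
  have sub: "cball (0 :: complex) (\<rho> / 2) \<subseteq> ball 0 \<rho>" using \<rho> by auto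
  have "norm ((deriv ^^ n) ?h 0) \<le> fact n * e / (\<rho> / 2) ^ n"
  proof (rule Cauchy_inequality)
    show "?h holomorphic_on ball 0 (\<rho> / 2)"
      by (rule holomorphic_on_subset[OF hh]) (use \<rho> in auto)
    show "continuous_on (cball 0 (\<rho> / 2)) ?h"
      by (rule continuous_on_subset[OF holomorphic_on_imp_continuous_on[OF hh] sub])
    show "norm (?h t) \<le> e" if "norm (0 - t) = \<rho> / 2" for t
      by (rule e[OF polydisc_upd[OF x]]) (use that \<rho> in simp)
  qed (use \<rho> in simp)
  moreover have "(deriv ^^ n) ?h 0 = fact n * (taylor v n f x - taylor v n g x)"
    unfolding taylor_def
    by (subst higher_deriv_diff[OF hf hg open_ball]) (use \<rho> in \<open>auto simp: field_simps\<close>)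
  ultimately have "fact n * norm (taylor v n f x - taylor v n g x) \<le> fact n * (e / (\<rho> / 2) ^ n)"
    by (simp add: norm_mult)
  then show ?thesis by (subst (asm) mult_le_cancel_left_pos) simp_all
qed

lemma taylor_cong:
  assumes "poly_approx coords (polydisc \<rho>) f" "poly_approx coords (polydisc \<rho>) g"
    and "x \<in> polydisc \<rho>" "\<And>x. x \<in> polydisc \<rho> \<Longrightarrow> f x = g x"
  shows "taylor v n f x = taylor v n g x"
  using taylor_bound[OF assms(1-3), of 0 v n] assms(4) by simp

lemma poly_approx_taylor:
  assumes f: "poly_approx coords (polydisc \<rho>) f" and \<rho>: "\<rho> > 0"
  shows "poly_approx coords (polydisc \<rho>) (taylor v n f)"
  unfolding poly_approx_def
proof (intro allI impI)
  fix e :: real assume "e > 0"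
  then have "e * (\<rho> / 2) ^ n > 0" using \<rho> by simp
  then obtain g where g: "g \<in> poly_gen coords" "\<And>x. x \<in> polydisc \<rho> \<Longrightarrow> norm (f x - g x) \<le> e * (\<rho> / 2) ^ n"
    using f unfolding poly_approx_def by blast
  have "norm (taylor v n f x - taylor v n g x) \<le> e" if "x \<in> polydisc \<rho>" for x
    using taylor_bound[OF f poly_approx_poly[OF g(1)] that g(2), of v n] \<rho> by simp
  then show "\<exists>h\<in>poly_gen coords. \<forall>x\<in>polydisc \<rho>. norm (taylor v n f x - h x) \<le> e"
    using taylor_poly_gen[OF g(1)] by blast
qed

lemma taylor_linear:
  assumes f: "poly_approx coords (polydisc \<rho>) f" and g: "poly_approx coords (polydisc \<rho>) g"
    and x: "x \<in> polydisc \<rho>" and \<rho>: "\<rho> > 0"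
  shows "taylor v n (\<lambda>x. f x + c * g x) x = taylor v n f x + c * taylor v n g x"
proof -
  note hf = poly_approx_holomorphic[OF f x, of v] and hg = poly_approx_holomorphic[OF g x, of v]
  have "taylor v n (\<lambda>x. c * g x) x = (\<Sum>i = 0..n. taylor v i (\<lambda>x. c) x * taylor v (n - i) g x)"
    by (rule taylor_mult_hol[OF _ hg \<rho>]) simp
  also have "\<dots> = c * taylor v n g x"
    by (simp add: taylor_const if_distrib[of "\<lambda>a. a * _"] cong: if_cong)
  finally have c: "taylor v n (\<lambda>x. c * g x) x = c * taylor v n g x" .
  show ?thesis
    by (subst taylor_add_hol[OF hf _ \<rho>]) (auto intro!: holomorphic_intros hg simp: c)
qed

lemma taylor_times_same:
  assumes f: "poly_approx coords (polydisc \<rho>) f" and x: "x \<in> polydisc \<rho>" and \<rho>: "\<rho> > 0"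
  shows "taylor v n (\<lambda>x. x v * f x) x = (if n = 0 then 0 else taylor v (n - 1) f x)"
proof -
  have "taylor v n (\<lambda>x. x v * f x) x = (\<Sum>i = 0..n. taylor v i (\<lambda>x. x v) x * taylor v (n - i) f x)"
    by (rule taylor_mult_hol[OF _ poly_approx_holomorphic[OF f x] \<rho>]) simp
  also have "\<dots> = (if n = 0 then 0 else taylor v (n - 1) f x)"
    by (simp add: taylor_same if_distrib[of "\<lambda>a. a * _"] cong: if_cong)
  finally show ?thesis .
qed

lemma taylor_times_other:
  assumes f: "poly_approx coords (polydisc \<rho>) f" and x: "x \<in> polydisc \<rho>" and \<rho>: "\<rho> > 0" and "u \<noteq> v"
  shows "taylor v n (\<lambda>x. x u * f x) x = x u * taylor v n f x"
proof -
  have "taylor v n (\<lambda>x. x u * f x) x = (\<Sum>i = 0..n. taylor v i (\<lambda>x. x u) x * taylor v (n - i) f x)"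
    by (rule taylor_mult_hol[OF _ poly_approx_holomorphic[OF f x] \<rho>]) (use \<open>u \<noteq> v\<close> in simp)
  also have "\<dots> = x u * taylor v n f x"
    by (simp add: taylor_other[OF \<open>u \<noteq> v\<close>] if_distrib[of "\<lambda>a. a * _"] cong: if_cong)
  finally show ?thesis .
qed

section \<open>Iterated Taylor coefficients\<close>

fun taylor_list :: "'v list \<Rightarrow> ('v \<Rightarrow> nat) \<Rightarrow> (('v \<Rightarrow> complex) \<Rightarrow> complex) \<Rightarrow> ('v \<Rightarrow> complex) \<Rightarrow> complex" where
  "taylor_list [] \<gamma> f = f"
| "taylor_list (v # vs) \<gamma> f = taylor_list vs \<gamma> (taylor v (\<gamma> v) f)"

abbreviation taylor_coeff :: "'v list \<Rightarrow> ('v \<Rightarrow> nat) \<Rightarrow> (('v \<Rightarrow> complex) \<Rightarrow> complex) \<Rightarrow> complex" where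
  "taylor_coeff vs \<gamma> f \<equiv> taylor_list vs \<gamma> f (\<lambda>_. 0)"

lemma taylor_list_append: "taylor_list (vs @ ws) \<gamma> f = taylor_list ws \<gamma> (taylor_list vs \<gamma> f)"
  by (induction vs arbitrary: f) auto

lemma taylor_list_cong_index: "(\<And>v. v \<in> set vs \<Longrightarrow> \<gamma> v = \<delta> v) \<Longrightarrow> taylor_list vs \<gamma> f = taylor_list vs \<delta> f"
  by (induction vs arbitrary: f) auto

lemma poly_approx_taylor_list:
  assumes "\<rho> > 0" "poly_approx coords (polydisc \<rho>) f"
  shows "poly_approx coords (polydisc \<rho>) (taylor_list vs \<gamma> f)"
  using assms(2) by (induction vs arbitrary: f) (auto intro: poly_approx_taylor assms(1))

lemma taylor_list_cong:
  assumes "\<rho> > 0" "poly_approx coords (polydisc \<rho>) f" "poly_approx coords (polydisc \<rho>) g"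
    and "\<And>x. x \<in> polydisc \<rho> \<Longrightarrow> f x = g x" "x \<in> polydisc \<rho>"
  shows "taylor_list vs \<gamma> f x = taylor_list vs \<gamma> g x"
  using assms(2-4)
proof (induction vs arbitrary: f g)
  case Nil
  then show ?case using assms(5) by simp
next
  case (Cons v vs)
  show ?case
    unfolding taylor_list.simps
    by (rule Cons.IH) (use Cons.prems assms(1) in \<open>auto intro: poly_approx_taylor taylor_cong\<close>)
qed

lemma taylor_list_zero: "taylor_list vs \<gamma> (\<lambda>x. 0) = (\<lambda>x. 0)"
  by (induction vs) (auto simp: taylor_const[abs_def])

lemma poly_approx_linear:
  assumes "poly_approx V S f" "poly_approx V S g"
  shows "poly_approx V S (\<lambda>x. f x + c * g x)"
  by (intro poly_approx_add poly_approx_scale assms)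

lemma taylor_list_linear:
  assumes "\<rho> > 0" "poly_approx coords (polydisc \<rho>) f" "poly_approx coords (polydisc \<rho>) g" "x \<in> polydisc \<rho>"
  shows "taylor_list vs \<gamma> (\<lambda>x. f x + c * g x) x = taylor_list vs \<gamma> f x + c * taylor_list vs \<gamma> g x"
  using assms(2,3)
proof (induction vs arbitrary: f g)
  case (Cons v vs)
  note t = poly_approx_taylor[OF Cons.prems(1) assms(1), of v "\<gamma> v"]
    poly_approx_taylor[OF Cons.prems(2) assms(1), of v "\<gamma> v"]
  have "taylor_list vs \<gamma> (taylor v (\<gamma> v) (\<lambda>x. f x + c * g x)) x
      = taylor_list vs \<gamma> (\<lambda>x. taylor v (\<gamma> v) f x + c * taylor v (\<gamma> v) g x) x"
    by (rule taylor_list_cong[OF assms(1) _ _ _ assms(4)])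
       (intro poly_approx_taylor poly_approx_linear t Cons.prems assms(1)
          taylor_linear[OF Cons.prems _ assms(1)]; assumption)+
  then show ?case using Cons.IH[OF t] by simp
qed simp

lemma taylor_list_sum:
  fixes f :: "'i \<Rightarrow> ('v \<Rightarrow> complex) \<Rightarrow> complex"
  assumes "\<rho> > 0" "finite I" "\<And>i. i \<in> I \<Longrightarrow> poly_approx coords (polydisc \<rho>) (f i)" "x \<in> polydisc \<rho>"
  shows "taylor_list vs \<gamma> (\<lambda>x. \<Sum>i\<in>I. c i * f i x) x = (\<Sum>i\<in>I. c i * taylor_list vs \<gamma> (f i) x)"
    and "poly_approx coords (polydisc \<rho>) (\<lambda>x. \<Sum>i\<in>I. c i * f i x)"
proof -
  have 0: "poly_approx coords (polydisc \<rho>) (\<lambda>x :: 'v \<Rightarrow> complex. 0)"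
    by (intro poly_approx_poly poly_gen.poly_gen_const)
  have "taylor_list vs \<gamma> (\<lambda>x. \<Sum>i\<in>I. c i * f i x) x = (\<Sum>i\<in>I. c i * taylor_list vs \<gamma> (f i) x) \<and>
    poly_approx coords (polydisc \<rho>) (\<lambda>x. \<Sum>i\<in>I. c i * f i x)"
    using assms(2,3)
  proof (induction I rule: finite_induct)
    case empty
    then show ?case using 0 by (simp add: taylor_list_zero)
  next
    case (insert i I)
    then have s: "poly_approx coords (polydisc \<rho>) (\<lambda>x. \<Sum>i\<in>I. c i * f i x)"
      "taylor_list vs \<gamma> (\<lambda>x. \<Sum>i\<in>I. c i * f i x) x = (\<Sum>i\<in>I. c i * taylor_list vs \<gamma> (f i) x)" by auto
    have i: "poly_approx coords (polydisc \<rho>) (f i)" using insert by simp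
    show ?case
      using taylor_list_linear[OF assms(1) s(1) i assms(4), of vs \<gamma> "c i"]
        poly_approx_linear[OF s(1) i, of "c i"] insert.hyps
      by (simp add: s(2) add.commute[of "c i * _"])
  qed
  then show "taylor_list vs \<gamma> (\<lambda>x. \<Sum>i\<in>I. c i * f i x) x = (\<Sum>i\<in>I. c i * taylor_list vs \<gamma> (f i) x)"
    and "poly_approx coords (polydisc \<rho>) (\<lambda>x. \<Sum>i\<in>I. c i * f i x)" by auto
qed

lemma poly_approx_times_coord:
  assumes "poly_approx coords (polydisc \<rho>) f"
  shows "poly_approx coords (polydisc \<rho>) (\<lambda>x. x u * f x)"
  by (rule poly_approx_mult_poly[OF assms _ coords_bounded]) (auto intro: poly_gen.poly_gen_base simp: coords_def)

lemma taylor_coeff_shift: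
  assumes \<rho>: "\<rho> > 0" and f: "poly_approx coords (polydisc \<rho>) f" and "distinct vs" "u \<in> set vs"
  shows "taylor_coeff vs \<gamma> (\<lambda>x. x u * f x)
    = (if \<gamma> u = 0 then 0 else taylor_coeff vs (\<gamma>(u := \<gamma> u - 1)) f)"
  using assms(2-4)
proof (induction vs arbitrary: f)
  case (Cons v vs)
  note z = zero_in_polydisc[OF \<rho>]
  note t = poly_approx_taylor[OF Cons.prems(1) \<rho>]
  note uf = poly_approx_times_coord[OF Cons.prems(1)]
  show ?case
  proof (cases "u = v")
    case True
    have v: "v \<notin> set vs" using Cons.prems by simp
    show ?thesis
    proof (cases "\<gamma> v = 0")
      case g: True
      have "taylor_list vs \<gamma> (taylor v 0 (\<lambda>x. x v * f x)) (\<lambda>_. 0) = taylor_list vs \<gamma> (\<lambda>x. 0) (\<lambda>_. 0)"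
        by (rule taylor_list_cong[OF \<rho> poly_approx_taylor[OF uf \<rho>] _ _ z])
           (simp_all add: taylor_times_same[OF Cons.prems(1) _ \<rho>] poly_approx_poly poly_gen.poly_gen_const)
      also have "\<dots> = 0" by (simp add: taylor_list_zero)
      finally show ?thesis using g True by simp
    next
      case g: False
      have "taylor_list vs \<gamma> (taylor v (\<gamma> v) (\<lambda>x. x v * f x)) (\<lambda>_. 0) = taylor_list vs \<gamma> (taylor v (\<gamma> v - 1) f) (\<lambda>_. 0)"
        by (rule taylor_list_cong[OF \<rho> poly_approx_taylor[OF uf \<rho>] t _ z])
           (use g in \<open>auto simp: taylor_times_same[OF Cons.prems(1) _ \<rho>]\<close>)
      also have "\<dots> = taylor_list vs (\<gamma>(v := \<gamma> v - 1)) (taylor v (\<gamma> v - 1) f) (\<lambda>_. 0)"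
        by (subst taylor_list_cong_index[of vs \<gamma> "\<gamma>(v := \<gamma> v - 1)"]) (use v in auto)
      finally show ?thesis using g True by simp
    qed
  next
    case False
    have "taylor_list vs \<gamma> (taylor v (\<gamma> v) (\<lambda>x. x u * f x)) (\<lambda>_. 0)
        = taylor_list vs \<gamma> (\<lambda>x. x u * taylor v (\<gamma> v) f x) (\<lambda>_. 0)"
      by (rule taylor_list_cong[OF \<rho> poly_approx_taylor[OF uf \<rho>] poly_approx_times_coord[OF t] _ z])
         (rule taylor_times_other[OF Cons.prems(1) _ \<rho> False])
    also have "\<dots> = (if \<gamma> u = 0 then 0 else taylor_coeff vs (\<gamma>(u := \<gamma> u - 1)) (taylor v (\<gamma> v) f))"
      by (rule Cons.IH[OF t]) (use Cons.prems False in auto)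
    finally show ?thesis using False by (simp add: fun_upd_def)
  qed
qed simp

text \<open>By induction the Taylor coefficients in the first variable vanish at the given values of
  the other variables, and a holomorphic function of one variable with zero Taylor series at 0 is
  zero on the disc.\<close>

lemma zero_if_taylor_coeff_zero:
  assumes \<rho>: "\<rho> > 0" and f: "poly_approx coords (polydisc \<rho>) f" and "distinct vs"
    and "\<And>\<gamma>. taylor_coeff vs \<gamma> f = 0"
    and x: "x \<in> polydisc \<rho>" "\<And>v. v \<notin> set vs \<Longrightarrow> x v = 0"
  shows "f x = 0"
  using assms(2-6)
proof (induction vs arbitrary: f x)
  case Nil
  then have "x = (\<lambda>_. 0)" by auto
  then show ?case using Nil.prems(3) by simp
next
  case (Cons v vs)
  have v: "v \<notin> set vs" using Cons.prems by simp
  have 0: "x(v := 0) \<in> polydisc \<rho>" by (rule polydisc_upd[OF Cons.prems(4)]) (use \<rho> in simp)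
  have "taylor v n f (x(v := 0)) = 0" for n
  proof (rule Cons.IH[OF poly_approx_taylor[OF Cons.prems(1) \<rho>]])
    show "taylor_coeff vs \<gamma> (taylor v n f) = 0" for \<gamma>
    proof -
      have "taylor_coeff vs \<gamma> (taylor v n f) = taylor_coeff vs (\<gamma>(v := n)) (taylor v n f)"
        by (subst taylor_list_cong_index[of vs \<gamma> "\<gamma>(v := n)"]) (use v in auto)
      then show ?thesis using Cons.prems(3)[of "\<gamma>(v := n)"] by (simp add: fun_upd_def)
    qed
  qed (use Cons.prems 0 in \<open>auto simp: fun_upd_def\<close>)
  then have d: "(deriv ^^ n) (\<lambda>t. f ((x(v := 0))(v := t))) 0 = 0" for n
    by (simp add: taylor_def)
  have "f ((x(v := 0))(v := x v)) = 0"
    by (rule holomorphic_fun_eq_0_on_ball[OF poly_approx_holomorphic[OF Cons.prems(1) 0] _ d])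
       (use Cons.prems(4) in \<open>auto simp: polydisc_def\<close>)
  then show ?case by simp
qed

section \<open>Rank of the matrix of Taylor coefficients\<close>

lemma sep_rank_le_swap: "sep_rank_le r X Y F \<Longrightarrow> sep_rank_le r Y X (\<lambda>y x. F x y)"
  unfolding sep_rank_le_def
  by (elim exE, rule_tac x = g in exI, rule_tac x = f in exI) (simp add: mult.commute)

text \<open>A Taylor coefficient is a linear functional and can be applied factor by factor. This
  requires factors that are limits of polynomials; \<open>sep_rank_le_sections\<close> supplies
  them.\<close>

lemma sep_rank_le_taylor_coeff_left:
  assumes \<rho>: "\<rho> > 0" and F: "sep_rank_le r (polydisc \<rho>) Y F"
    and nice: "\<And>y. y \<in> Y \<Longrightarrow> poly_approx coords (polydisc \<rho>) (\<lambda>x. F x y)"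
  shows "sep_rank_le r UNIV Y (\<lambda>\<alpha> y. taylor_coeff vs \<alpha> (\<lambda>x. F x y))"
proof -
  have "\<exists>f g. (\<forall>k<r. poly_approx coords (polydisc \<rho>) (f k) \<and> True) \<and>
     (\<forall>x\<in>polydisc \<rho>. \<forall>y\<in>Y. F x y = (\<Sum>k<r. f k x * g k y))"
    by (rule sep_rank_le_sections[OF F])
       (auto intro: nice poly_approx_poly poly_gen.poly_gen_const poly_approx_linear)
  then obtain f g where fg': "(\<forall>k<r. poly_approx coords (polydisc \<rho>) (f k) \<and> True) \<and>
     (\<forall>x\<in>polydisc \<rho>. \<forall>y\<in>Y. F x y = (\<Sum>k<r. f k x * g k y))" by (elim exE)
  have f: "poly_approx coords (polydisc \<rho>) (f k)" if "k < r" for k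
    using fg' that by blast
  have fg: "F x y = (\<Sum>k<r. g k y * f k x)" if "x \<in> polydisc \<rho>" "y \<in> Y" for x y
    using fg' that by (simp add: mult.commute)
  note z = zero_in_polydisc[OF \<rho>]
  have "taylor_coeff vs \<alpha> (\<lambda>x. F x y) = (\<Sum>k<r. taylor_coeff vs \<alpha> (f k) * g k y)" if y: "y \<in> Y" for \<alpha> y
  proof -
    have "taylor_coeff vs \<alpha> (\<lambda>x. F x y) = taylor_coeff vs \<alpha> (\<lambda>x. \<Sum>k<r. g k y * f k x)"
      by (rule taylor_list_cong[OF \<rho> nice[OF y] taylor_list_sum(2)[OF \<rho> _ _ z] fg[OF _ y] z]) (auto intro: f)
    also have "\<dots> = (\<Sum>k<r. g k y * taylor_coeff vs \<alpha> (f k))"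
      by (rule taylor_list_sum(1)[OF \<rho> _ _ z]) (auto intro: f)
    finally show ?thesis by (simp add: mult.commute)
  qed
  then show ?thesis
    unfolding sep_rank_le_def
    by (intro exI[of _ "\<lambda>k \<alpha>. taylor_coeff vs \<alpha> (f k)"] exI[of _ g]) auto
qed

lemma case_sum_upd: "(case_sum x y)(Inl v := t) = case_sum (x(v := t)) y"
  "(case_sum x y)(Inr w := t) = case_sum x (y(w := t))"
  by (auto simp: fun_eq_iff split: sum.splits)

lemma taylor_list_Inl:
  "taylor_list (map Inl vs) (case_sum \<alpha> \<beta>) F (case_sum x y) = taylor_list vs \<alpha> (\<lambda>x. F (case_sum x y)) x"
proof (induction vs arbitrary: F)
  case (Cons v vs)
  have "(\<lambda>x. taylor (Inl v) (\<alpha> v) F (case_sum x y)) = taylor v (\<alpha> v) (\<lambda>x. F (case_sum x y))"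
    by (simp add: taylor_def case_sum_upd fun_eq_iff)
  then show ?case by (simp add: Cons.IH)
qed simp

lemma taylor_list_Inr:
  "taylor_list (map Inr ws) (case_sum \<alpha> \<beta>) F (case_sum x y) = taylor_list ws \<beta> (\<lambda>y. F (case_sum x y)) y"
proof (induction ws arbitrary: F)
  case (Cons v vs)
  have "(\<lambda>y. taylor (Inr v) (\<beta> v) F (case_sum x y)) = taylor v (\<beta> v) (\<lambda>y. F (case_sum x y))"
    by (simp add: taylor_def case_sum_upd fun_eq_iff)
  then show ?case by (simp add: Cons.IH)
qed simp

lemma case_sum_in_polydisc: "case_sum x y \<in> polydisc \<rho> \<longleftrightarrow> x \<in> polydisc \<rho> \<and> y \<in> polydisc \<rho>"
  by (auto simp: polydisc_def split: sum.splits)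

lemma poly_approx_case_sum_left:
  assumes "poly_approx coords (polydisc \<rho>) F" "y \<in> polydisc \<rho>"
  shows "poly_approx coords (polydisc \<rho>) (\<lambda>x. F (case_sum x y))"
proof (rule poly_approx_compose[OF assms(1)])
  show "(\<lambda>x. v (case_sum x y)) \<in> poly_gen coords" if v: "v \<in> coords" for v
  proof -
    obtain u where u: "v = (\<lambda>x. x u)" using v by (auto simp: coords_def)
    show ?thesis
      by (cases u) (auto simp: u coords_def intro: poly_gen.poly_gen_const poly_gen.poly_gen_base)
  qed
qed (simp add: case_sum_in_polydisc assms)

lemma poly_approx_case_sum_right:
  assumes "poly_approx coords (polydisc \<rho>) F" "x \<in> polydisc \<rho>"
  shows "poly_approx coords (polydisc \<rho>) (\<lambda>y. F (case_sum x y))"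
proof (rule poly_approx_compose[OF assms(1)])
  show "(\<lambda>y. v (case_sum x y)) \<in> poly_gen coords" if v: "v \<in> coords" for v
  proof -
    obtain u where u: "v = (\<lambda>x. x u)" using v by (auto simp: coords_def)
    show ?thesis
      by (cases u) (auto simp: u coords_def intro: poly_gen.poly_gen_const poly_gen.poly_gen_base)
  qed
qed (simp add: case_sum_in_polydisc assms)

lemma sep_rank_le_taylor_coeff:
  assumes \<rho>: "\<rho> > 0" and F: "poly_approx coords (polydisc \<rho>) F"
    and rank: "sep_rank_le r (polydisc \<rho>) (polydisc \<rho>) (\<lambda>x y. F (case_sum x y))"
  shows "sep_rank_le r UNIV UNIV (\<lambda>\<alpha> \<beta>. taylor_coeff (map Inl vs @ map Inr ws) (case_sum \<alpha> \<beta>) F)"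
proof -
  note z = zero_in_polydisc[OF \<rho>]
  define H where "H \<alpha> y = taylor_coeff vs \<alpha> (\<lambda>x. F (case_sum x y))" for \<alpha> y
  have H: "H \<alpha> y = taylor_list (map Inl vs) (case_sum \<alpha> \<beta>) F (case_sum (\<lambda>_. 0) y)" for \<alpha> \<beta> y
    by (simp add: H_def taylor_list_Inl)
  have 1: "sep_rank_le r UNIV (polydisc \<rho>) H"
    unfolding H_def[abs_def]
    by (rule sep_rank_le_taylor_coeff_left[OF \<rho> rank]) (rule poly_approx_case_sum_left[OF F])
  have 2: "poly_approx coords (polydisc \<rho>) (\<lambda>y. H \<alpha> y)" for \<alpha>
    unfolding H[of _ _ "\<lambda>_. 0"]
    by (rule poly_approx_case_sum_right[OF poly_approx_taylor_list[OF \<rho> F] z])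
  have "sep_rank_le r UNIV UNIV (\<lambda>\<beta> \<alpha>. taylor_coeff ws \<beta> (\<lambda>y. H \<alpha> y))"
    by (rule sep_rank_le_taylor_coeff_left[OF \<rho> sep_rank_le_swap[OF 1]]) (rule 2)
  from sep_rank_le_swap[OF this]
  have "sep_rank_le r UNIV UNIV (\<lambda>\<alpha> \<beta>. taylor_coeff ws \<beta> (H \<alpha>))" by simp
  moreover have "taylor_coeff (map Inl vs @ map Inr ws) (case_sum \<alpha> \<beta>) F = taylor_coeff ws \<beta> (H \<alpha>)" for \<alpha> \<beta>
  proof -
    have c: "(\<lambda>_. 0 :: complex) = case_sum (\<lambda>_. 0) (\<lambda>_. 0)" by (auto simp: fun_eq_iff split: sum.splits)
    show ?thesis
      unfolding taylor_list_append
      by (subst c, subst taylor_list_Inr) (simp add: H[of _ _ \<beta>, abs_def])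
  qed
  ultimately show ?thesis by simp
qed

section \<open>Counting terms of multiples of a power of a linear form\<close>

text \<open>Laurent polynomials appear as coefficient functions on integer exponents: an exponent
  will record the deviation from a base monomial and may be negative.\<close>

definition shift_op :: "nat set \<Rightarrow> ((nat \<Rightarrow> int) \<Rightarrow> complex) \<Rightarrow> (nat \<Rightarrow> int) \<Rightarrow> complex" where
  "shift_op K g \<kappa> = (\<Sum>k\<in>K. g (\<kappa>(k := \<kappa> k - 1)))"

lemma finite_support_shift_op:
  assumes "finite K" "finite {\<kappa>. g \<kappa> \<noteq> 0}"
  shows "finite {\<kappa>. shift_op K g \<kappa> \<noteq> 0}"
proof (rule finite_subset)
  show "{\<kappa>. shift_op K g \<kappa> \<noteq> 0} \<subseteq> (\<Union>k\<in>K. (\<lambda>\<kappa>. \<kappa>(k := \<kappa> k + 1)) ` {\<kappa>. g \<kappa> \<noteq> 0})"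
  proof
    fix \<kappa> assume "\<kappa> \<in> {\<kappa>. shift_op K g \<kappa> \<noteq> 0}"
    then obtain k where "k \<in> K" "g (\<kappa>(k := \<kappa> k - 1)) \<noteq> 0"
      unfolding shift_op_def by (metis (mono_tags, lifting) mem_Collect_eq sum.neutral)
    then show "\<kappa> \<in> (\<Union>k\<in>K. (\<lambda>\<kappa>. \<kappa>(k := \<kappa> k + 1)) ` {\<kappa>. g \<kappa> \<noteq> 0})"
      by (intro UN_I[of k] image_eqI[of _ _ "\<kappa>(k := \<kappa> k - 1)"]) auto
  qed
qed (use assms in auto)

lemma finite_support_shift_op_pow:
  assumes "finite K" "finite {\<kappa>. g \<kappa> \<noteq> 0}"
  shows "finite {\<kappa>. (shift_op K ^^ d) g \<kappa> \<noteq> 0}"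
  by (induction d) (auto intro: finite_support_shift_op assms)

text \<open>In the part of lowest degree \<open>e\<close> in the variable \<open>j\<close>,
  multiplication by that variable contributes nothing, since it would need a term of degree
  \<open>e - 1\<close>. The slice therefore sees only the variables in \<open>K\<close>.\<close>

lemma shift_op_slice:
  assumes "finite K" "j \<notin> K"
    and "\<And>\<kappa>. \<kappa> j < e \<Longrightarrow> h \<kappa> = 0" "\<And>\<kappa>. \<kappa> j = e \<Longrightarrow> h \<kappa> = h0 \<kappa>" "\<And>\<kappa>. \<kappa> j \<noteq> e \<Longrightarrow> h0 \<kappa> = 0"
  shows "\<kappa> j < e \<Longrightarrow> shift_op (insert j K) h \<kappa> = 0"
    and "\<kappa> j = e \<Longrightarrow> shift_op (insert j K) h \<kappa> = shift_op K h0 \<kappa>"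
    and "\<kappa> j \<noteq> e \<Longrightarrow> shift_op K h0 \<kappa> = 0"
proof -
  have j: "k \<noteq> j" if "k \<in> K" for k using assms(2) that by auto
  show "shift_op (insert j K) h \<kappa> = 0" if "\<kappa> j < e"
    unfolding shift_op_def using j that by (intro sum.neutral ballI assms(3)) auto
  show "shift_op (insert j K) h \<kappa> = shift_op K h0 \<kappa>" if "\<kappa> j = e"
    unfolding shift_op_def using assms(1,2) j that
    by (auto simp: assms(3) intro!: sum.cong assms(4))
  show "shift_op K h0 \<kappa> = 0" if "\<kappa> j \<noteq> e"
    unfolding shift_op_def using j that by (intro sum.neutral ballI assms(5)) auto
qed

lemma shift_op_pow_slice:
  assumes "finite K" "j \<notin> K"
    and "\<And>\<kappa>. \<kappa> j < e \<Longrightarrow> g \<kappa> = 0" "\<And>\<kappa>. \<kappa> j = e \<Longrightarrow> g \<kappa> = g0 \<kappa>" "\<And>\<kappa>. \<kappa> j \<noteq> e \<Longrightarrow> g0 \<kappa> = 0"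
  shows "(\<kappa> j < e \<longrightarrow> (shift_op (insert j K) ^^ d) g \<kappa> = 0) \<and>
    (\<kappa> j = e \<longrightarrow> (shift_op (insert j K) ^^ d) g \<kappa> = (shift_op K ^^ d) g0 \<kappa>) \<and>
    (\<kappa> j \<noteq> e \<longrightarrow> (shift_op K ^^ d) g0 \<kappa> = 0)"
proof (induction d arbitrary: \<kappa>)
  case 0
  then show ?case using assms(3-5) by simp
next
  case (Suc d)
  have 1: "(shift_op (insert j K) ^^ d) g \<kappa> = 0" if "\<kappa> j < e" for \<kappa>
    using Suc.IH[of \<kappa>] that by simp
  have 2: "(shift_op (insert j K) ^^ d) g \<kappa> = (shift_op K ^^ d) g0 \<kappa>" if "\<kappa> j = e" for \<kappa>
    using Suc.IH[of \<kappa>] that by simp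
  have 3: "(shift_op K ^^ d) g0 \<kappa> = 0" if "\<kappa> j \<noteq> e" for \<kappa>
    using Suc.IH[of \<kappa>] that by simp
  show ?case
    using shift_op_slice[where \<kappa> = \<kappa> and e = e and j = j, OF assms(1,2) 1 2 3] by simp
qed

text \<open>The degree \<open>e + d\<close> in the variable \<open>j\<close> is reached only by
  choosing that variable from all \<open>d\<close> factors, so nothing can cancel.\<close>

lemma shift_op_pow_top:
  assumes "finite K" "j \<in> K" "\<And>\<kappa>. \<kappa> j > e \<Longrightarrow> g \<kappa> = 0"
  shows "(\<kappa> j > e + int d \<longrightarrow> (shift_op K ^^ d) g \<kappa> = 0) \<and>
    (\<kappa> j = e + int d \<longrightarrow> (shift_op K ^^ d) g \<kappa> = g (\<kappa>(j := e)))"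
proof (induction d arbitrary: \<kappa>)
  case 0
  show ?case using assms(3)[of \<kappa>] fun_upd_idem[of \<kappa> j e] by simp
next
  case (Suc d)
  have "(shift_op K ^^ d) g (\<kappa>(k := \<kappa> k - 1)) = 0" if "\<kappa> j > e + int (Suc d)" for k
    by (rule Suc.IH[THEN conjunct1, rule_format]) (use that in auto)
  then have "(shift_op K ^^ Suc d) g \<kappa> = 0" if "\<kappa> j > e + int (Suc d)"
    using that by (simp add: shift_op_def[of K "(shift_op K ^^ d) g"])
  moreover have "(shift_op K ^^ Suc d) g \<kappa> = g (\<kappa>(j := e))" if k: "\<kappa> j = e + int (Suc d)"
  proof -
    have "(shift_op K ^^ d) g (\<kappa>(k := \<kappa> k - 1)) = 0" if "k \<in> K - {j}" for k
      by (rule Suc.IH[THEN conjunct1, rule_format]) (use k that in auto)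
    then have "(shift_op K ^^ Suc d) g \<kappa> = (shift_op K ^^ d) g (\<kappa>(j := \<kappa> j - 1))"
      using assms(1,2) by (simp add: shift_op_def[of K "(shift_op K ^^ d) g"] sum.remove)
    also have "\<dots> = g ((\<kappa>(j := \<kappa> j - 1))(j := e))"
      by (rule Suc.IH[THEN conjunct2, rule_format]) (use k in simp)
    finally show ?thesis by simp
  qed
  ultimately show ?case by blast
qed

text \<open>The operator \<open>D g \<kappa> = (\<kappa> j - e) * g \<kappa>\<close> is the Euler derivative in the variable \<open>j\<close>, and
  \<open>shift_op K\<close> is multiplication by the sum of the variables, a linear form with nonzero
  \<open>j\<close>-derivative. So a derivative of a \<open>(d + 1)\<close>-st power multiple is a \<open>d\<close>-th power multiple.\<close>

lemma euler_shift_op_pow: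
  assumes "finite K" "j \<in> K" "finite {\<kappa>. g \<kappa> \<noteq> 0}"
  shows "\<exists>g'. finite {\<kappa>. g' \<kappa> \<noteq> 0} \<and>
    (\<lambda>\<kappa>. of_int (\<kappa> j - e) * (shift_op K ^^ Suc d) g \<kappa>) = (shift_op K ^^ d) g'"
proof -
  define T where "T h \<kappa> = h (\<kappa>(j := \<kappa> j - 1))" for h :: "(nat \<Rightarrow> int) \<Rightarrow> complex" and \<kappa>
  have fT: "finite {\<kappa>. T h \<kappa> \<noteq> 0}" if "finite {\<kappa>. h \<kappa> \<noteq> 0}" for h
    using finite_support_shift_op[of "{j}" h] that by (simp add: shift_op_def T_def)
  have lin: "shift_op K (\<lambda>\<kappa>. a \<kappa> + b \<kappa>) = (\<lambda>\<kappa>. shift_op K a \<kappa> + shift_op K b \<kappa>)" for a b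
    by (simp add: shift_op_def sum.distrib fun_eq_iff)
  have linp: "(shift_op K ^^ n) (\<lambda>\<kappa>. a \<kappa> + b \<kappa>) = (\<lambda>\<kappa>. (shift_op K ^^ n) a \<kappa> + (shift_op K ^^ n) b \<kappa>)" for n a b
    by (induction n) (simp_all add: lin)
  have comm: "T (shift_op K h) = shift_op K (T h)" for h
  proof
    fix \<kappa>
    show "T (shift_op K h) \<kappa> = shift_op K (T h) \<kappa>"
      unfolding T_def shift_op_def by (intro sum.cong) (auto simp: fun_upd_twist)
  qed
  have commp: "T ((shift_op K ^^ n) h) = (shift_op K ^^ n) (T h)" for n h
    by (induction n) (simp_all add: comm)
  \<comment> \<open>The product rule: multiplication by the variable \<open>j\<close>, which is
    \<open>T\<close>, is the Euler derivative of the linear form.\<close>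
  have D1: "(\<lambda>\<kappa>. of_int (\<kappa> j - e) * shift_op K h \<kappa>)
      = (\<lambda>\<kappa>. shift_op K (\<lambda>\<kappa>. of_int (\<kappa> j - e) * h \<kappa>) \<kappa> + T h \<kappa>)" for h
  proof
    fix \<kappa>
    show "of_int (\<kappa> j - e) * shift_op K h \<kappa> = shift_op K (\<lambda>\<kappa>. of_int (\<kappa> j - e) * h \<kappa>) \<kappa> + T h \<kappa>"
      using assms(1,2)
      by (simp add: shift_op_def T_def sum_distrib_left sum.remove[of K j] algebra_simps)
  qed
  show ?thesis
  proof (induction d)
    case 0
    have "finite {\<kappa>. of_int (\<kappa> j - e) * g \<kappa> \<noteq> 0}"
      by (rule finite_subset[OF _ assms(3)]) auto
    from finite_support_shift_op[OF assms(1) this] fT[OF assms(3)]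
    have "finite ({\<kappa>. shift_op K (\<lambda>\<kappa>. of_int (\<kappa> j - e) * g \<kappa>) \<kappa> \<noteq> 0} \<union> {\<kappa>. T g \<kappa> \<noteq> 0})" by simp
    then have "finite {\<kappa>. shift_op K (\<lambda>\<kappa>. of_int (\<kappa> j - e) * g \<kappa>) \<kappa> + T g \<kappa> \<noteq> 0}"
      by (rule finite_subset[rotated]) auto
    then show ?case using D1[of g] by (intro exI conjI) simp_all
  next
    case (Suc d)
    then obtain g' where g': "finite {\<kappa>. g' \<kappa> \<noteq> 0}"
      "(\<lambda>\<kappa>. of_int (\<kappa> j - e) * (shift_op K ^^ Suc d) g \<kappa>) = (shift_op K ^^ d) g'" by blast
    define G where "G = (shift_op K ^^ Suc d) g"
    have "(\<lambda>\<kappa>. of_int (\<kappa> j - e) * (shift_op K ^^ Suc (Suc d)) g \<kappa>)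
        = (\<lambda>\<kappa>. of_int (\<kappa> j - e) * shift_op K G \<kappa>)" by (simp add: G_def)
    also have "\<dots> = (\<lambda>\<kappa>. shift_op K ((shift_op K ^^ d) g') \<kappa> + T G \<kappa>)"
      unfolding D1 g'(2)[folded G_def] ..
    also have "\<dots> = (\<lambda>\<kappa>. (shift_op K ^^ Suc d) g' \<kappa> + (shift_op K ^^ Suc d) (T g) \<kappa>)"
      unfolding G_def commp by simp
    also have "\<dots> = (shift_op K ^^ Suc d) (\<lambda>\<kappa>. g' \<kappa> + T g \<kappa>)"
      unfolding linp ..
    finally have "(\<lambda>\<kappa>. of_int (\<kappa> j - e) * (shift_op K ^^ Suc (Suc d)) g \<kappa>)
        = (shift_op K ^^ Suc d) (\<lambda>\<kappa>. g' \<kappa> + T g \<kappa>)" .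
    moreover have "finite {\<kappa>. g' \<kappa> + T g \<kappa> \<noteq> 0}"
      by (rule finite_subset[of _ "{\<kappa>. g' \<kappa> \<noteq> 0} \<union> {\<kappa>. T g \<kappa> \<noteq> 0}"]) (use g'(1) fT[OF assms(3)] in auto)
    ultimately show ?case by (intro exI conjI)
  qed
qed

text \<open>The terms of lowest degree in one variable are counted by induction on \<open>K\<close>, the others by
  induction on \<open>d\<close> after applying an Euler derivative.\<close>

lemma card_support_shift_op_pow:
  assumes "finite K" "finite {\<kappa>. g \<kappa> \<noteq> 0}" "g \<kappa>0 \<noteq> 0"
  shows "(card K + d - 1) choose d \<le> card {\<kappa>. (shift_op K ^^ d) g \<kappa> \<noteq> 0}"
  using assms
proof (induction K arbitrary: d g \<kappa>0 rule: finite_induct)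
  case empty
  \<comment> \<open>For no variables the bound is 1 if \<open>d = 0\<close>, where the truncated
    \<open>0 - 1\<close> is harmless, and 0 otherwise.\<close>
  then show ?case
    by (cases d) (auto simp: Suc_le_eq card_gt_0_iff binomial_eq_0)
next
  case (insert j K)
  note K = insert.hyps
  have fin: "finite (insert j K)" using K by simp
  show ?case
    using insert.prems
  proof (induction d arbitrary: g \<kappa>0)
    case 0
    then show ?case by (auto simp: Suc_le_eq card_gt_0_iff)
  next
    case (Suc d)
    let ?S = "shift_op (insert j K)"
    define E where "E = (\<lambda>\<kappa>. \<kappa> j) ` {\<kappa>. g \<kappa> \<noteq> 0}"
    have E: "finite E" "E \<noteq> {}" using Suc.prems by (auto simp: E_def)
    define e where "e = Min E"
    define t where "t = Max E"
    obtain \<kappa>1 where k1: "g \<kappa>1 \<noteq> 0" "\<kappa>1 j = e"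
      using Min_in[OF E] by (auto simp: E_def e_def)
    obtain \<kappa>2 where k2: "g \<kappa>2 \<noteq> 0" "\<kappa>2 j = t"
      using Max_in[OF E] by (auto simp: E_def t_def)
    have low: "g \<kappa> = 0" if "\<kappa> j < e" for \<kappa>
      using Min_le[OF E(1), of "\<kappa> j"] that by (auto simp: E_def e_def)
    have high: "g \<kappa> = 0" if "\<kappa> j > t" for \<kappa>
      using Max_ge[OF E(1), of "\<kappa> j"] that by (auto simp: E_def t_def)
    have et: "e \<le> t" using low[of \<kappa>2] k2 by force
    define g0 where "g0 \<kappa> = (if \<kappa> j = e then g \<kappa> else 0)" for \<kappa>
    have sl: "(\<kappa> j < e \<longrightarrow> (?S ^^ n) g \<kappa> = 0) \<and> (\<kappa> j = e \<longrightarrow> (?S ^^ n) g \<kappa> = (shift_op K ^^ n) g0 \<kappa>) \<and>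
        (\<kappa> j \<noteq> e \<longrightarrow> (shift_op K ^^ n) g0 \<kappa> = 0)" for \<kappa> n
      by (rule shift_op_pow_slice[OF K]) (auto simp: g0_def low)
    define A where "A = {\<kappa>. (shift_op K ^^ Suc d) g0 \<kappa> \<noteq> 0}"
    have A2: "\<kappa> j = e" if "\<kappa> \<in> A" for \<kappa>
    proof (rule ccontr)
      assume "\<kappa> j \<noteq> e"
      then have "(shift_op K ^^ Suc d) g0 \<kappa> = 0" using sl[of \<kappa> "Suc d"] by blast
      then show False using that by (simp add: A_def)
    qed
    have A1: "A \<subseteq> {\<kappa>. (?S ^^ Suc d) g \<kappa> \<noteq> 0}"
    proof
      fix \<kappa> assume \<kappa>: "\<kappa> \<in> A"
      then have "(?S ^^ Suc d) g \<kappa> = (shift_op K ^^ Suc d) g0 \<kappa>"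
        using sl[of \<kappa> "Suc d"] A2 by blast
      then show "\<kappa> \<in> {\<kappa>. (?S ^^ Suc d) g \<kappa> \<noteq> 0}" using \<kappa> unfolding A_def by simp
    qed
    note A = A1 A2
    have "finite {\<kappa>. g0 \<kappa> \<noteq> 0}"
      by (rule finite_subset[OF _ Suc.prems(1)]) (auto simp: g0_def)
    moreover have "g0 \<kappa>1 \<noteq> 0" using k1 by (simp add: g0_def)
    ultimately have cA: "(card K + Suc d - 1) choose Suc d \<le> card A"
      unfolding A_def by (rule insert.IH)
    obtain g' where g': "finite {\<kappa>. g' \<kappa> \<noteq> 0}"
      "(\<lambda>\<kappa>. of_int (\<kappa> j - e) * (?S ^^ Suc d) g \<kappa>) = (?S ^^ d) g'"
      using euler_shift_op_pow[OF fin insertI1 Suc.prems(1), of e d] by blast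
    \<comment> \<open>The factor \<open>\<kappa> j - e\<close> removes exactly the lowest slice, so
      \<open>B\<close> is the part of the support outside it.\<close>
    define B where "B = {\<kappa>. (?S ^^ d) g' \<kappa> \<noteq> 0}"
    have B: "B = {\<kappa>. \<kappa> j \<noteq> e \<and> (?S ^^ Suc d) g \<kappa> \<noteq> 0}"
      unfolding B_def g'(2)[symmetric] by auto
    \<comment> \<open>A term of top degree in \<open>j\<close>, multiplied by the full power of that
      variable, survives in the product. Its degree exceeds \<open>e\<close>, so \<open>B\<close> is
      nonempty, \<open>g'\<close> is nonzero and the induction on \<open>d\<close> applies to
      it.\<close>
    define \<kappa>3 where "\<kappa>3 = \<kappa>2(j := t + int (Suc d))"
    have k3: "\<kappa>3 j = t + int (Suc d)" "\<kappa>3(j := t) = \<kappa>2" using k2 by (auto simp: \<kappa>3_def)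
    have "(?S ^^ Suc d) g \<kappa>3 = g (\<kappa>3(j := t))"
      by (rule shift_op_pow_top[OF fin insertI1 high, THEN conjunct2, rule_format]) (use k3 in auto)
    also have "\<dots> \<noteq> 0" using k2 k3 by simp
    finally have "\<kappa>3 \<in> B" unfolding B using k3(1) et by simp
    then have "\<exists>\<kappa>. g' \<kappa> \<noteq> 0"
    proof (rule contrapos_pp)
      assume "\<not> (\<exists>\<kappa>. g' \<kappa> \<noteq> 0)"
      then have "g' = (\<lambda>_. 0)" by auto
      moreover have "(?S ^^ n) (\<lambda>_. 0) = (\<lambda>_. 0)" for n
        by (induction n) (auto simp: shift_op_def)
      ultimately show "\<kappa>3 \<notin> B" by (simp add: B_def)
    qed
    then obtain \<kappa>' where "g' \<kappa>' \<noteq> 0" by blast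
    from Suc.IH[OF g'(1) this] have cB: "(card (insert j K) + d - 1) choose d \<le> card B"
      by (simp add: B_def)
    have finS: "finite {\<kappa>. (?S ^^ Suc d) g \<kappa> \<noteq> 0}"
      by (rule finite_support_shift_op_pow[OF fin Suc.prems(1)])
    \<comment> \<open>Pascal's rule combines the two lower bounds.\<close>
    have "card A + card B = card (A \<union> B)"
      using A B finS by (intro card_Un_disjoint[symmetric]) (auto intro: finite_subset)
    also have "\<dots> \<le> card {\<kappa>. (?S ^^ Suc d) g \<kappa> \<noteq> 0}"
      using A B finS by (intro card_mono) auto
    finally show ?case using cA cB K by simp
  qed
qed

section \<open>Generic weights and minimal exponents\<close>

text \<open>Countably many nonzero integer polynomials, each with finitely many roots, cannot
  exhaust an interval.\<close>

lemma ex_transcendental: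
  "\<exists>\<tau>::real. 0 < \<tau> \<and> \<tau> < 1 \<and>
     (\<forall>(c :: nat \<Rightarrow> int) n. (\<Sum>i\<le>n. of_int (c i) * \<tau> ^ i) = 0 \<longrightarrow> (\<forall>i\<le>n. c i = 0))"
proof -
  \<comment> \<open>Polynomials are coded by lists, which are countable. The appended 0 makes the
    index \<open>length xs\<close> legal, so the empty list needs no separate treatment.\<close>
  define Z where "Z xs = {x::real. (\<Sum>i\<le>length xs. of_int ((xs @ [0]) ! i) * x ^ i) = 0}" for xs :: "int list"
  define B where "B = (\<Union>xs\<in>{xs. \<exists>i\<le>length xs. (xs @ [0]) ! i \<noteq> 0}. Z xs)"
  have "countable B"
    unfolding B_def
  proof (rule countable_UN)
    show "countable (Z xs)" if "xs \<in> {xs. \<exists>i\<le>length xs. (xs @ [0]) ! i \<noteq> 0}" for xs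
      unfolding Z_def
      by (rule countable_finite, subst polyfun_finite_roots) (use that in auto)
  qed auto
  then have "uncountable ({0<..<1} - B)"
    by (intro uncountable_minus_countable) (auto simp: uncountable_open_interval)
  then obtain \<tau> where \<tau>: "\<tau> \<in> {0<..<1}" "\<tau> \<notin> B"
    by (metis Diff_iff countable_empty equals0I)
  have "c i = 0" if 0: "(\<Sum>i\<le>n. of_int (c i) * \<tau> ^ i) = 0" and i: "i \<le> n" for c :: "nat \<Rightarrow> int" and n i
  proof (rule ccontr)
    assume ci: "c i \<noteq> 0"
    define xs where "xs = map c [0..<Suc n]"
    have nth: "(xs @ [0]) ! k = (if k \<le> n then c k else 0)" if "k \<le> Suc n" for k
      using that by (auto simp: xs_def nth_append less_Suc_eq_le simp del: upt_Suc)
    have len: "length xs = Suc n" by (simp add: xs_def)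
    have "(\<Sum>k\<le>length xs. of_int ((xs @ [0]) ! k) * \<tau> ^ k) = (\<Sum>k\<le>n. of_int (c k) * \<tau> ^ k)"
      unfolding len by (simp add: nth)
    then have "\<tau> \<in> Z xs" using 0 by (simp add: Z_def)
    moreover have "i \<le> length xs" "(xs @ [0]) ! i \<noteq> 0" using i ci nth[of i] len by auto
    ultimately have "\<tau> \<in> B" unfolding B_def by blast
    with \<tau>(2) show False by simp
  qed
  with \<tau>(1) show ?thesis by auto
qed

text \<open>Real weights need not be well-ordered, but because they are positive only finitely many
  nonnegative exponents on \<open>Z\<close> have weight at most that of
  \<open>\<gamma>1\<close>.\<close>

lemma ex_minimal_weight:
  fixes \<omega> :: "'v \<Rightarrow> real" and \<gamma>1 :: "'v \<Rightarrow> int"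
  assumes "finite Z" "\<And>v. v \<in> Z \<Longrightarrow> \<omega> v > 0" "P \<gamma>1"
    and nonneg: "\<And>\<gamma> v. P \<gamma> \<Longrightarrow> v \<in> Z \<Longrightarrow> \<gamma> v \<ge> 0"
  shows "\<exists>\<gamma>0. P \<gamma>0 \<and> (\<forall>\<gamma>. P \<gamma> \<longrightarrow> (\<Sum>v\<in>Z. \<omega> v * of_int (\<gamma>0 v)) \<le> (\<Sum>v\<in>Z. \<omega> v * of_int (\<gamma> v)))"
proof -
  define w where "w \<gamma> = (\<Sum>v\<in>Z. \<omega> v * of_int (\<gamma> v))" for \<gamma> :: "'v \<Rightarrow> int"
  define M where "M = (\<Sum>v\<in>Z. \<lceil>w \<gamma>1 / \<omega> v\<rceil>)"
  define A where "A = {\<gamma>. P \<gamma> \<and> w \<gamma> \<le> w \<gamma>1}"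
  \<comment> \<open>Values outside \<open>Z\<close> are arbitrary and do not affect the weight;
    setting them to 0 makes the set of candidates finite.\<close>
  define r where "r \<gamma> v = (if v \<in> Z then \<gamma> v else 0)" for \<gamma> :: "'v \<Rightarrow> int" and v
  have wr: "w (r \<gamma>) = w \<gamma>" for \<gamma> by (auto simp: w_def r_def intro: sum.cong)
  have w1: "w \<gamma>1 \<ge> 0"
    unfolding w_def using assms by (intro sum_nonneg mult_nonneg_nonneg) (auto intro: less_imp_le)
  have "r ` A \<subseteq> {f. \<forall>v. (v \<in> Z \<longrightarrow> f v \<in> {0..M}) \<and> (v \<notin> Z \<longrightarrow> f v = 0)}"
  proof
    fix f assume "f \<in> r ` A"
    then obtain \<gamma> where \<gamma>: "f = r \<gamma>" "P \<gamma>" "w \<gamma> \<le> w \<gamma>1" by (auto simp: A_def)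
    have "\<gamma> v \<le> M" if v: "v \<in> Z" for v
    proof -
      have "\<omega> v * of_int (\<gamma> v) \<le> w \<gamma>"
        unfolding w_def using assms(1,2) nonneg[OF \<gamma>(2)] v
        by (intro member_le_sum) (auto intro!: mult_nonneg_nonneg less_imp_le[OF assms(2)])
      then have "of_int (\<gamma> v) \<le> w \<gamma>1 / \<omega> v"
        using \<gamma>(3) assms(2)[OF v] by (simp add: pos_le_divide_eq mult.commute)
      then have "\<gamma> v \<le> \<lceil>w \<gamma>1 / \<omega> v\<rceil>" by linarith
      also have "\<dots> \<le> M"
        unfolding M_def
      proof (rule member_le_sum[OF v _ assms(1)])
        fix u assume "u \<in> Z - {v}"
        then have "w \<gamma>1 / \<omega> u \<ge> 0" using w1 assms(2)[of u] by simp
        then show "0 \<le> \<lceil>w \<gamma>1 / \<omega> u\<rceil>" by linarith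
      qed
      finally show ?thesis .
    qed
    then show "f \<in> {f. \<forall>v. (v \<in> Z \<longrightarrow> f v \<in> {0..M}) \<and> (v \<notin> Z \<longrightarrow> f v = 0)}"
      using nonneg[OF \<gamma>(2)] by (simp add: \<gamma>(1) r_def)
  qed
  then have "finite (r ` A)"
    by (rule finite_subset) (intro finite_set_of_finite_funs assms(1) finite_atLeastAtMost_int)
  then have "finite (w ` A)"
    using finite_imageI[of "r ` A" w] by (simp add: image_image wr)
  moreover have A1: "\<gamma>1 \<in> A" using assms(3) by (simp add: A_def)
  ultimately have "Min (w ` A) \<in> w ` A" by (intro Min_in) auto
  then obtain \<gamma>0 where \<gamma>0: "\<gamma>0 \<in> A" "w \<gamma>0 = Min (w ` A)" by auto
  have "w \<gamma>0 \<le> w \<gamma>" if "P \<gamma>" for \<gamma>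
  proof (cases "\<gamma> \<in> A")
    case True
    then show ?thesis using \<gamma>0(2) \<open>finite (w ` A)\<close> by simp
  next
    case False
    then have "w \<gamma>1 < w \<gamma>" using that by (simp add: A_def)
    moreover have "w \<gamma>0 \<le> w \<gamma>1" using \<gamma>0(1) by (simp add: A_def)
    ultimately show ?thesis by simp
  qed
  with \<gamma>0(1) show ?thesis unfolding w_def A_def by blast
qed

section \<open>Lowest weight parts\<close>

text \<open>In the matrix with rows and columns \<open>\<gamma>0 + \<Sum>k\<in>K. \<kappa> k * \<delta> k\<close>, cut into its \<open>Inl\<close> and \<open>Inr\<close> parts,
  the entries of minimal total weight form a triangular shape whose diagonal is a Laurent
  polynomial multiple of a \<open>d\<close>-th power.\<close>

lemma weighted_rank_bound:
  fixes C :: "nat \<Rightarrow> ('a + 'b \<Rightarrow> int) \<Rightarrow> complex" and \<delta> :: "nat \<Rightarrow> 'a + 'b \<Rightarrow> int"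
    and \<delta>' :: "'l \<Rightarrow> 'a + 'b \<Rightarrow> int" and \<omega> :: "'a + 'b \<Rightarrow> real" and Z :: "('a + 'b) set"
  defines "w \<equiv> \<lambda>\<gamma>. \<Sum>v\<in>Z. \<omega> v * of_int (\<gamma> v)"
    and "s \<equiv> \<lambda>k. \<Sum>v\<in>Z. (if isl v then \<omega> v else 0) * of_int (\<delta> k v)"
  assumes K: "finite K" and L: "finite L" and Z: "finite Z"
    and rec: "\<And>n \<gamma>. C (Suc n) \<gamma> = (\<Sum>k\<in>K. C n (\<lambda>v. \<gamma> v - \<delta> k v)) + (\<Sum>l\<in>L. c l * C n (\<lambda>v. \<gamma> v - \<delta>' l v))"
    and wK: "\<And>k. k \<in> K \<Longrightarrow> w (\<delta> k) = 1" and wL: "\<And>l. l \<in> L \<Longrightarrow> w (\<delta>' l) > 1"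
    and \<gamma>0: "C 0 \<gamma>0 \<noteq> 0" and min: "\<And>\<gamma>. C 0 \<gamma> \<noteq> 0 \<Longrightarrow> w \<gamma>0 \<le> w \<gamma>"
    and nonneg: "\<And>\<gamma> v. C 0 \<gamma> \<noteq> 0 \<Longrightarrow> v \<in> Z \<Longrightarrow> \<gamma> v \<ge> 0"
    and own: "\<And>k. k \<in> K \<Longrightarrow> \<exists>v\<in>Z. \<delta> k v = 1 \<and> (\<forall>k'\<in>K - {k}. \<delta> k' v = 0)"
    and indep: "\<And>n :: nat \<Rightarrow> int. (\<Sum>k\<in>K. of_int (n k) * s k) = 0 \<Longrightarrow> (\<Sum>k\<in>K. n k) = 0 \<Longrightarrow> \<forall>k\<in>K. n k = 0"
    and rank: "sep_rank_le r UNIV UNIV (\<lambda>\<alpha> \<beta>. C d (case_sum \<alpha> \<beta>))"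
  shows "(card K + d - 1) choose d \<le> r"
proof -
  have w_diff: "w (\<lambda>v. \<gamma> v - \<delta> v) = w \<gamma> - w \<delta>" for \<gamma> \<delta>
    by (simp add: w_def right_diff_distrib sum_subtractf)
  \<comment> \<open>Each step of the recursion raises the least weight by at least 1.\<close>
  have low: "w \<gamma> \<ge> w \<gamma>0 + real n" if "C n \<gamma> \<noteq> 0" for n \<gamma>
    using that
  proof (induction n arbitrary: \<gamma>)
    case 0
    then show ?case using min by simp
  next
    case (Suc n)
    have "(\<Sum>k\<in>K. C n (\<lambda>v. \<gamma> v - \<delta> k v)) \<noteq> 0 \<or> (\<Sum>l\<in>L. c l * C n (\<lambda>v. \<gamma> v - \<delta>' l v)) \<noteq> 0"
      using Suc.prems rec[of n \<gamma>] by auto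
    then have "(\<exists>k\<in>K. C n (\<lambda>v. \<gamma> v - \<delta> k v) \<noteq> 0) \<or> (\<exists>l\<in>L. C n (\<lambda>v. \<gamma> v - \<delta>' l v) \<noteq> 0)"
      by (metis (no_types, lifting) mult_zero_right sum.neutral)
    then show ?case
    proof (elim disjE bexE)
      fix k assume k: "k \<in> K" "C n (\<lambda>v. \<gamma> v - \<delta> k v) \<noteq> 0"
      from Suc.IH[OF k(2)] wK[OF k(1)] show ?thesis by (simp add: w_diff)
    next
      fix l assume l: "l \<in> L" "C n (\<lambda>v. \<gamma> v - \<delta>' l v) \<noteq> 0"
      from Suc.IH[OF l(2)] wL[OF l(1)] show ?thesis by (simp add: w_diff)
    qed
  qed
  \<comment> \<open>The exponent of the base monomial times the Laurent monomial in the
    \<open>u\<^sub>k\<close> with exponents \<open>\<kappa>\<close>.\<close>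
  define P where "P \<kappa> v = \<gamma>0 v + (\<Sum>k\<in>K. \<kappa> k * \<delta> k v)" for \<kappa> v
  have wP: "(\<Sum>v\<in>Z. \<mu> v * of_int (P \<kappa> v)) =
      (\<Sum>v\<in>Z. \<mu> v * of_int (\<gamma>0 v)) + (\<Sum>k\<in>K. of_int (\<kappa> k) * (\<Sum>v\<in>Z. \<mu> v * of_int (\<delta> k v)))" for \<mu> :: "'a + 'b \<Rightarrow> real" and \<kappa>
    unfolding P_def sum_distrib_left of_int_add of_int_sum of_int_mult distrib_left sum.distrib
    by (subst sum.swap) (simp add: mult_ac)
  have wP1: "w (P \<kappa>) = w \<gamma>0 + of_int (\<Sum>k\<in>K. \<kappa> k)" for \<kappa>
    unfolding w_def wP using wK by (simp add: w_def)
  \<comment> \<open>The condition on the sum selects minimal weight, and the zeros outside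
    \<open>K\<close> make \<open>\<kappa>\<close> determined by its values on \<open>K\<close>. Thus
    \<open>G n\<close> is the relevant part of the lowest weight coefficients, and it obeys the
    recursion of \<open>shift_op\<close>.\<close>
  define G where "G n \<kappa> = (if (\<Sum>k\<in>K. \<kappa> k) = int n \<and> (\<forall>k. k \<notin> K \<longrightarrow> \<kappa> k = 0) then C n (P \<kappa>) else 0)" for n \<kappa>
  have Pshift: "(\<lambda>v. P \<kappa> v - \<delta> k v) = P (\<kappa>(k := \<kappa> k - 1))" if "k \<in> K" for k \<kappa>
  proof
    fix v
    have "(\<Sum>i\<in>K. (\<kappa>(k := \<kappa> k - 1)) i * \<delta> i v) = (\<Sum>i\<in>K. \<kappa> i * \<delta> i v) - \<delta> k v"
      using K that by (simp add: sum.remove[of K k] algebra_simps)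
    then show "P \<kappa> v - \<delta> k v = P (\<kappa>(k := \<kappa> k - 1)) v" by (simp add: P_def)
  qed
  have GS: "G (Suc n) = shift_op K (G n)" for n
  proof
    fix \<kappa>
    show "G (Suc n) \<kappa> = shift_op K (G n) \<kappa>"
    proof (cases "(\<Sum>k\<in>K. \<kappa> k) = int (Suc n) \<and> (\<forall>k. k \<notin> K \<longrightarrow> \<kappa> k = 0)")
      case True
      \<comment> \<open>Summands of weight above 1 could only come from coefficients below the
        minimal weight.\<close>
      have "C n (\<lambda>v. P \<kappa> v - \<delta>' l v) = 0" if "l \<in> L" for l
        using low[of n "\<lambda>v. P \<kappa> v - \<delta>' l v"] wL[OF that] True by (force simp: w_diff wP1)
      then have "G (Suc n) \<kappa> = (\<Sum>k\<in>K. C n (P (\<kappa>(k := \<kappa> k - 1))))"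
        using True by (simp add: G_def rec Pshift)
      also have "\<dots> = shift_op K (G n) \<kappa>"
        unfolding shift_op_def
      proof (intro sum.cong refl)
        fix k assume k: "k \<in> K"
        have "(\<Sum>i\<in>K. (\<kappa>(k := \<kappa> k - 1)) i) = int n"
          using K k True by (simp add: sum.remove[of K k] algebra_simps)
        then show "C n (P (\<kappa>(k := \<kappa> k - 1))) = G n (\<kappa>(k := \<kappa> k - 1))"
          using True k by (auto simp: G_def)
      qed
      finally show ?thesis .
    next
      case False
      have "G n (\<kappa>(k := \<kappa> k - 1)) = 0" if k: "k \<in> K" for k
      proof -
        have "(\<Sum>i\<in>K. (\<kappa>(k := \<kappa> k - 1)) i) = (\<Sum>i\<in>K. \<kappa> i) - 1"
          using K k by (simp add: sum.remove[of K k] algebra_simps)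
        then show ?thesis using False k by (auto simp: G_def)
      qed
      then have "shift_op K (G n) \<kappa> = 0" by (simp add: shift_op_def)
      moreover have "G (Suc n) \<kappa> = 0" unfolding G_def using False by (rule if_not_P)
      ultimately show ?thesis by simp
    qed
  qed
  have Gpow: "G n = (shift_op K ^^ n) (G 0)" for n
    by (induction n) (simp_all add: GS)
  have "P (\<lambda>_. 0) = \<gamma>0" by (simp add: P_def fun_eq_iff)
  then have G0: "G 0 (\<lambda>_. 0) \<noteq> 0" using \<gamma>0 by (simp add: G_def)
  have finG: "finite {\<kappa>. G 0 \<kappa> \<noteq> 0}"
  proof -
    define M where "M = (\<Sum>v\<in>Z. \<bar>\<gamma>0 v\<bar>)"
    have "{\<kappa>. G 0 \<kappa> \<noteq> 0} \<subseteq> {\<kappa>. \<forall>k. (k \<in> K \<longrightarrow> \<kappa> k \<in> {- M..int (card K) * M}) \<and> (k \<notin> K \<longrightarrow> \<kappa> k = 0)}"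
    proof
      fix \<kappa> assume "\<kappa> \<in> {\<kappa>. G 0 \<kappa> \<noteq> 0}"
      then have \<kappa>: "(\<Sum>k\<in>K. \<kappa> k) = 0" "\<And>k. k \<notin> K \<Longrightarrow> \<kappa> k = 0" "C 0 (P \<kappa>) \<noteq> 0"
        by (auto simp: G_def split: if_splits)
      have lo: "\<kappa> k \<ge> - M" if k: "k \<in> K" for k
      proof -
        \<comment> \<open>A variable occurring in \<open>u\<^sub>k\<close> alone: its exponent is
          nonnegative, which bounds \<open>\<kappa> k\<close> from below. Since the
          \<open>\<kappa> k\<close> add up to 0, they are bounded from above as well.\<close>
        obtain v where v: "v \<in> Z" "\<delta> k v = 1" "\<forall>k'\<in>K - {k}. \<delta> k' v = 0" using own[OF k] by blast
        have "P \<kappa> v = \<gamma>0 v + \<kappa> k"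
          using v K k by (simp add: P_def sum.remove[of K k])
        moreover have "P \<kappa> v \<ge> 0" by (rule nonneg[OF \<kappa>(3) v(1)])
        moreover have "\<bar>\<gamma>0 v\<bar> \<le> M" unfolding M_def using Z v(1) by (intro member_le_sum) auto
        ultimately show ?thesis by linarith
      qed
      have M0: "M \<ge> 0" by (auto simp: M_def intro: sum_nonneg)
      have hi: "\<kappa> k \<le> int (card K) * M" if k: "k \<in> K" for k
      proof -
        have "\<kappa> k = - (\<Sum>i\<in>K - {k}. \<kappa> i)" using \<kappa>(1) K k by (simp add: sum.remove[of K k])
        also have "\<dots> = (\<Sum>i\<in>K - {k}. - \<kappa> i)" by (simp add: sum_negf)
        also have "\<dots> \<le> (\<Sum>i\<in>K - {k}. M)" using lo by (intro sum_mono) force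
        also have "\<dots> = int (card (K - {k})) * M" by simp
        also have "\<dots> \<le> int (card K) * M"
          using K M0 by (intro mult_right_mono) (auto intro: card_mono)
        finally show ?thesis .
      qed
      show "\<kappa> \<in> {\<kappa>. \<forall>k. (k \<in> K \<longrightarrow> \<kappa> k \<in> {- M..int (card K) * M}) \<and> (k \<notin> K \<longrightarrow> \<kappa> k = 0)}"
        using lo hi \<kappa>(2) by auto
    qed
    then show ?thesis
      by (rule finite_subset) (intro finite_set_of_finite_funs K finite_atLeastAtMost_int)
  qed
  define S where "S = {\<kappa>. G d \<kappa> \<noteq> 0}"
  have card: "(card K + d - 1) choose d \<le> card S"
    unfolding S_def Gpow[of d] by (rule card_support_shift_op_pow[OF K finG G0])
  have finS: "finite S"
    unfolding S_def Gpow[of d] by (rule finite_support_shift_op_pow[OF K finG])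
  have S: "(\<Sum>k\<in>K. \<kappa> k) = int d" "\<And>k. k \<notin> K \<Longrightarrow> \<kappa> k = 0" "C d (P \<kappa>) \<noteq> 0" if "\<kappa> \<in> S" for \<kappa>
    using that by (auto simp: S_def G_def split: if_splits)
  \<comment> \<open>The weight on the \<open>Inl\<close> side, up to a constant. By
    \<open>indep\<close> it distinguishes exponents of equal sum.\<close>
  define key where "key \<kappa> = (\<Sum>k\<in>K. of_int (\<kappa> k) * s k)" for \<kappa> :: "nat \<Rightarrow> int"
  define A where "A \<kappa> \<kappa>' = C d (case_sum (\<lambda>a. P \<kappa> (Inl a)) (\<lambda>b. P \<kappa>' (Inr b)))" for \<kappa> \<kappa>'
  have "card S \<le> r"
  proof (rule card_le_sep_rank[where key = key and F = A])
    show "sep_rank_le r S S A"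
      by (rule sep_rank_le_reparam[OF rank]) (auto simp: A_def)
    show "inj_on key S"
    proof (rule inj_onI)
      fix \<kappa> \<kappa>' assume \<kappa>: "\<kappa> \<in> S" "\<kappa>' \<in> S" "key \<kappa> = key \<kappa>'"
      have "\<forall>k\<in>K. \<kappa> k - \<kappa>' k = 0"
        by (rule indep) (use \<kappa> S(1) in \<open>simp_all add: key_def left_diff_distrib sum_subtractf\<close>)
      then show "\<kappa> = \<kappa>'" using S(2)[OF \<kappa>(1)] S(2)[OF \<kappa>(2)] by (metis eq_iff_diff_eq_0 ext)
    qed
    show "A \<kappa> \<kappa> \<noteq> 0" if "\<kappa> \<in> S" for \<kappa>
    proof -
      have "case_sum (\<lambda>a. P \<kappa> (Inl a)) (\<lambda>b. P \<kappa> (Inr b)) = P \<kappa>" by (auto simp: fun_eq_iff split: sum.splits)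
      then show ?thesis using S(3)[OF that] by (simp add: A_def)
    qed
    show "A \<kappa> \<kappa>' = 0" if \<kappa>: "\<kappa> \<in> S" "\<kappa>' \<in> S" and less: "key \<kappa> < key \<kappa>'" for \<kappa> \<kappa>'
    proof (rule ccontr)
      assume "A \<kappa> \<kappa>' \<noteq> 0"
      define \<gamma> where "\<gamma> = case_sum (\<lambda>a. P \<kappa> (Inl a)) (\<lambda>b. P \<kappa>' (Inr b))"
      have l: "w \<gamma> \<ge> w \<gamma>0 + real d" using low[of d \<gamma>] \<open>A \<kappa> \<kappa>' \<noteq> 0\<close> by (simp add: A_def \<gamma>_def)
      define \<mu> where "\<mu> v = (if isl v then \<omega> v else 0)" for v
      have "\<omega> v * of_int (\<gamma> v) = \<omega> v * of_int (P \<kappa>' v) + \<mu> v * of_int (P \<kappa> v) - \<mu> v * of_int (P \<kappa>' v)" for v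
        by (cases v) (auto simp: \<gamma>_def \<mu>_def)
      then have "w \<gamma> = w (P \<kappa>') + (\<Sum>v\<in>Z. \<mu> v * of_int (P \<kappa> v)) - (\<Sum>v\<in>Z. \<mu> v * of_int (P \<kappa>' v))"
        by (simp add: w_def sum.distrib sum_subtractf)
      \<comment> \<open>Exchanging the \<open>Inl\<close> part changes only the \<open>Inl\<close>
        weight, by \<open>key \<kappa> - key \<kappa>'\<close>; if this is negative, the entry lies
        below the minimal weight.\<close>
      also have "\<dots> = w \<gamma>0 + real d + key \<kappa> - key \<kappa>'"
        unfolding wP1 wP key_def s_def \<mu>_def using S(1)[OF \<kappa>(2)] by simp
      finally show False using l less by simp
    qed
  qed (rule finS)
  with card show ?thesis by simp
qed

section \<open>Coefficients at integer exponents\<close>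

definition vars_prod :: "'v list \<Rightarrow> ('v \<Rightarrow> complex) \<Rightarrow> complex" where
  "vars_prod us x = (\<Prod>u\<leftarrow>us. x u)"

text \<open>Extension by 0 to negative exponents turns multiplication by a variable into a pure
  shift, with no exception at exponent 0.\<close>

definition icoeff :: "'v list \<Rightarrow> (('v \<Rightarrow> complex) \<Rightarrow> complex) \<Rightarrow> ('v \<Rightarrow> int) \<Rightarrow> complex" where
  "icoeff vs f \<gamma> = (if \<forall>v\<in>set vs. 0 \<le> \<gamma> v then taylor_coeff vs (\<lambda>v. nat (\<gamma> v)) f else 0)"

lemma icoeff_shift:
  assumes "\<rho> > 0" "poly_approx coords (polydisc \<rho>) f" "distinct vs" "u \<in> set vs"
  shows "icoeff vs (\<lambda>x. x u * f x) \<gamma> = icoeff vs f (\<gamma>(u := \<gamma> u - 1))"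
proof (cases "\<forall>v\<in>set vs. 0 \<le> \<gamma> v")
  case True
  have t: "taylor_coeff vs (\<lambda>v. nat (\<gamma> v)) (\<lambda>x. x u * f x)
    = (if nat (\<gamma> u) = 0 then 0 else taylor_coeff vs ((\<lambda>v. nat (\<gamma> v))(u := nat (\<gamma> u) - 1)) f)"
    by (rule taylor_coeff_shift[OF assms])
  have eq: "(\<lambda>v. nat (\<gamma> v))(u := nat (\<gamma> u) - 1) = (\<lambda>v. nat ((\<gamma>(u := \<gamma> u - 1)) v))"
    by (auto simp: fun_eq_iff nat_diff_distrib')
  have 1: "icoeff vs (\<lambda>x. x u * f x) \<gamma>
    = (if nat (\<gamma> u) = 0 then 0 else taylor_coeff vs (\<lambda>v. nat ((\<gamma>(u := \<gamma> u - 1)) v)) f)"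
    unfolding icoeff_def t eq using True by simp
  show ?thesis
  proof (cases "\<gamma> u = 0")
    case z: True
    then have "\<not> (\<forall>v\<in>set vs. 0 \<le> (\<gamma>(u := \<gamma> u - 1)) v)" using assms(4) by force
    then have "icoeff vs f (\<gamma>(u := \<gamma> u - 1)) = 0" unfolding icoeff_def by (rule if_not_P)
    then show ?thesis unfolding 1 using z by simp
  next
    case False
    then have "\<gamma> u > 0" using True assms(4) by force
    then have "\<forall>v\<in>set vs. 0 \<le> (\<gamma>(u := \<gamma> u - 1)) v" using True by simp
    then have "icoeff vs f (\<gamma>(u := \<gamma> u - 1)) = taylor_coeff vs (\<lambda>v. nat ((\<gamma>(u := \<gamma> u - 1)) v)) f"
      unfolding icoeff_def by (rule if_P)
    then show ?thesis unfolding 1 using \<open>\<gamma> u > 0\<close> by simp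
  qed
next
  case False
  then obtain v where "v \<in> set vs" "\<gamma> v < 0" by force
  then have "v \<in> set vs" "(\<gamma>(u := \<gamma> u - 1)) v < 0" by auto
  then have "\<not> (\<forall>v\<in>set vs. 0 \<le> (\<gamma>(u := \<gamma> u - 1)) v)" by force
  then have "icoeff vs f (\<gamma>(u := \<gamma> u - 1)) = 0" unfolding icoeff_def by (rule if_not_P)
  moreover have "icoeff vs (\<lambda>x. x u * f x) \<gamma> = 0" unfolding icoeff_def using False by (rule if_not_P)
  ultimately show ?thesis by simp
qed

lemma poly_gen_vars_prod: "vars_prod us \<in> poly_gen coords"
  unfolding vars_prod_def[abs_def]
proof (induction us)
  case (Cons u us)
  have "(\<lambda>x. x u) \<in> poly_gen coords" by (rule poly_gen_base) (auto simp: coords_def)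
  from poly_gen_mult[OF this Cons.IH] show ?case by simp
qed (simp add: poly_gen_const)

lemma poly_approx_coords_mult:
  "poly_approx coords (polydisc \<rho>) f \<Longrightarrow> p \<in> poly_gen coords \<Longrightarrow> poly_approx coords (polydisc \<rho>) (\<lambda>x. p x * f x)"
  by (rule poly_approx_mult_poly[OF _ _ coords_bounded])

lemma icoeff_vars_prod:
  assumes "\<rho> > 0" "poly_approx coords (polydisc \<rho>) f" "distinct vs" "set us \<subseteq> set vs"
  shows "icoeff vs (\<lambda>x. vars_prod us x * f x) \<gamma> = icoeff vs f (\<lambda>v. \<gamma> v - int (count_list us v))"
  using assms(4)
proof (induction us arbitrary: \<gamma>)
  case Nil
  then show ?case by (simp add: vars_prod_def)
next
  case (Cons u us)
  have "icoeff vs (\<lambda>x. vars_prod (u # us) x * f x) \<gamma> = icoeff vs (\<lambda>x. x u * (vars_prod us x * f x)) \<gamma>"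
    by (simp add: vars_prod_def mult_ac)
  also have "\<dots> = icoeff vs (\<lambda>x. vars_prod us x * f x) (\<gamma>(u := \<gamma> u - 1))"
    by (rule icoeff_shift[OF assms(1) poly_approx_coords_mult[OF assms(2) poly_gen_vars_prod] assms(3)])
       (use Cons.prems in simp)
  also have "\<dots> = icoeff vs f (\<lambda>v. (\<gamma>(u := \<gamma> u - 1)) v - int (count_list us v))"
    by (rule Cons.IH) (use Cons.prems in simp)
  also have "(\<lambda>v. (\<gamma>(u := \<gamma> u - 1)) v - int (count_list us v)) = (\<lambda>v. \<gamma> v - int (count_list (u # us) v))"
    by auto
  finally show ?case .
qed

lemma icoeff_sum:
  fixes f :: "'i \<Rightarrow> ('v \<Rightarrow> complex) \<Rightarrow> complex"
  assumes "\<rho> > 0" "finite I" "\<And>i. i \<in> I \<Longrightarrow> poly_approx coords (polydisc \<rho>) (f i)"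
  shows "icoeff vs (\<lambda>x. \<Sum>i\<in>I. c i * f i x) \<gamma> = (\<Sum>i\<in>I. c i * icoeff vs (f i) \<gamma>)"
proof (cases "\<forall>v\<in>set vs. 0 \<le> \<gamma> v")
  case True
  show ?thesis
    unfolding icoeff_def if_P[OF True]
    by (rule taylor_list_sum(1)[OF assms(1,2) _ zero_in_polydisc[OF assms(1)]]) (rule assms(3))
next
  case False
  then show ?thesis unfolding icoeff_def if_not_P[OF False] by simp
qed

lemma sum_count_list:
  fixes \<omega> :: "'v \<Rightarrow> real"
  assumes "finite Z" "set us \<subseteq> Z"
  shows "(\<Sum>v\<in>Z. \<omega> v * of_int (int (count_list us v))) = (\<Sum>u\<leftarrow>us. \<omega> u)"
  using assms(2)
proof (induction us)
  case (Cons u us)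
  have "(\<Sum>v\<in>Z. \<omega> v * of_int (int (count_list (u # us) v)))
      = (\<Sum>v\<in>Z. \<omega> v * of_int (int (count_list us v)) + (if u = v then \<omega> v else 0))"
    by (intro sum.cong) (auto simp: algebra_simps)
  also have "\<dots> = (\<Sum>u\<leftarrow>us. \<omega> u) + \<omega> u"
    using Cons assms(1) by (simp add: sum.distrib)
  finally show ?case by simp
qed simp

text \<open>The sign condition is the product of a condition on the row and one on the column, so
  cutting off the negative exponents does not raise the rank.\<close>

lemma sep_rank_le_icoeff:
  assumes "\<rho> > 0" "poly_approx coords (polydisc \<rho>) F"
    and "sep_rank_le r (polydisc \<rho>) (polydisc \<rho>) (\<lambda>x y. F (case_sum x y))"
  shows "sep_rank_le r UNIV UNIV (\<lambda>\<alpha> \<beta>. icoeff (map Inl vs @ map Inr ws) F (case_sum \<alpha> \<beta>))"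
proof -
  let ?vs = "map Inl vs @ map Inr ws"
  have 1: "sep_rank_le r UNIV UNIV (\<lambda>(\<alpha> :: _ \<Rightarrow> int) (\<beta> :: _ \<Rightarrow> int).
      taylor_coeff ?vs (case_sum (\<lambda>v. nat (\<alpha> v)) (\<lambda>v. nat (\<beta> v))) F)"
    by (rule sep_rank_le_reparam[OF sep_rank_le_taylor_coeff[OF assms, of vs ws]]) auto
  have 2: "icoeff ?vs F (case_sum \<alpha> \<beta>) =
      (if \<forall>v\<in>set vs. 0 \<le> \<alpha> v then 1 else 0) * (if \<forall>v\<in>set ws. 0 \<le> \<beta> v then 1 else 0) *
      taylor_coeff ?vs (case_sum (\<lambda>v. nat (\<alpha> v)) (\<lambda>v. nat (\<beta> v))) F" for \<alpha> \<beta>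
  proof -
    have "(\<lambda>v. nat (case_sum \<alpha> \<beta> v)) = case_sum (\<lambda>v. nat (\<alpha> v)) (\<lambda>v. nat (\<beta> v))"
      by (auto simp: fun_eq_iff split: sum.splits)
    moreover have "(\<forall>v\<in>set ?vs. 0 \<le> case_sum \<alpha> \<beta> v) \<longleftrightarrow> (\<forall>v\<in>set vs. 0 \<le> \<alpha> v) \<and> (\<forall>v\<in>set ws. 0 \<le> \<beta> v)"
      by (simp add: ball_Un)
    ultimately show ?thesis unfolding icoeff_def by simp
  qed
  show ?thesis
    unfolding 2 by (rule sep_rank_le_mult[OF 1])
qed

text \<open>The polarized bilinear polynomial in adapted coordinates. For weights with
  \<open>\<omega> (Inl k) + \<omega> (Inr k) = 1\<close> for \<open>k < N\<close> and weight 1 for all other variables, its lowest part consists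
  of the first three summands.\<close>

definition adapted_form ::
    "bool \<Rightarrow> bool \<Rightarrow> nat \<Rightarrow> (nat \<Rightarrow> complex) \<Rightarrow> (nat \<Rightarrow> complex) \<Rightarrow> (nat + nat \<Rightarrow> complex) \<Rightarrow> complex" where
  "adapted_form e e' N l l' x =
     (if e then x (Inl N) else 0) + (if e' then x (Inr N) else 0) + (\<Sum>k<N. x (Inl k) * x (Inr k)) +
     ((\<Sum>j\<le>Suc N. l j * (x (Inl N) * x (Inr j))) + (\<Sum>j\<le>Suc N. l' j * (x (Inr N) * x (Inl j))))"

text \<open>Powers of a transcendental number as the weights \<open>\<omega> (Inl k)\<close> separate the monomials.\<close>

lemma product_rank_bound:
  fixes F0 :: "(nat + nat \<Rightarrow> complex) \<Rightarrow> complex" and l l' :: "nat \<Rightarrow> complex"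
  assumes \<rho>: "\<rho> > 0" and F0: "poly_approx coords (polydisc \<rho>) F0"
    and x0: "x0 \<in> polydisc \<rho>" "F0 x0 \<noteq> 0" "\<And>v. v \<notin> Inl ` {..Suc N} \<union> Inr ` {..Suc N} \<Longrightarrow> x0 v = 0"
    and rank: "sep_rank_le r (polydisc \<rho>) (polydisc \<rho>)
      (\<lambda>x y. F0 (case_sum x y) * adapted_form e e' N l l' (case_sum x y) ^ d)"
  shows "(N + of_bool e + of_bool e' + d - 1) choose d \<le> r"
proof -
  define \<pi> where "\<pi> = adapted_form e e' N l l'"
  define vs :: "(nat + nat) list" where "vs = map Inl [0..<Suc (Suc N)] @ map Inr [0..<Suc (Suc N)]"
  define Z where "Z = set vs"
  have Zeq: "Z = Inl ` {..Suc N} \<union> Inr ` {..Suc N}"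
    by (auto simp: Z_def vs_def less_Suc_eq_le simp del: upt_Suc)
  have dist: "distinct vs" by (auto simp: vs_def distinct_map inj_on_def simp del: upt_Suc)
  \<comment> \<open>The index \<open>N\<close> stands for the linear term \<open>x (Inl N)\<close>
    and the index \<open>Suc N\<close> for \<open>x (Inr N)\<close>, each present only if the form
    contains it. The variables with index \<open>Suc N\<close> occur in no \<open>us k\<close>; they
    are kept because the point \<open>x0\<close> may need them.\<close>
  define K where "K = {..<N} \<union> (if e then {N} else {}) \<union> (if e' then {Suc N} else {})"
  have finK: "finite K" by (simp add: K_def)
  have cardK: "card K = N + of_bool e + of_bool e'" by (simp add: K_def)
  define us :: "nat \<Rightarrow> (nat + nat) list" where
    "us k = (if k < N then [Inl k, Inr k] else if k = N then [Inl N] else [Inr N])" for k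
  define L :: "(nat + nat) set" where "L = {..Suc N} <+> {..Suc N}"
  define us' :: "nat + nat \<Rightarrow> (nat + nat) list" where
    "us' = case_sum (\<lambda>j. [Inl N, Inr j]) (\<lambda>j. [Inr N, Inl j])"
  define c where "c = case_sum l l'"
  have finL: "finite L" by (simp add: L_def)
  have usZ: "set (us k) \<subseteq> Z" if "k \<in> K" for k
    using that by (auto simp: us_def Zeq K_def split: if_splits)
  have us'Z: "set (us' i) \<subseteq> Z" if "i \<in> L" for i
    using that by (auto simp: us'_def Zeq L_def)
  have sumK: "(\<Sum>k\<in>K. g k) = (\<Sum>k<N. g k) + (if e then g N else 0) + (if e' then g (Suc N) else 0)"
    for g :: "nat \<Rightarrow> 'z :: comm_monoid_add"
    unfolding K_def by ((subst sum.union_disjoint; simp)+) (simp add: add.commute)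
  have \<pi>_eq: "\<pi> x = (\<Sum>k\<in>K. 1 * vars_prod (us k) x) + (\<Sum>i\<in>L. c i * vars_prod (us' i) x)" for x
    unfolding sumK L_def by (simp add: \<pi>_def adapted_form_def us_def us'_def c_def vars_prod_def sum.Plus)
  have \<pi>_poly: "\<pi> \<in> poly_gen coords"
    unfolding \<pi>_eq[abs_def] by (intro poly_gen_add poly_gen_sum poly_gen_scale poly_gen_vars_prod)
  define f where "f n x = F0 x * \<pi> x ^ n" for n x
  have f: "poly_approx coords (polydisc \<rho>) (f n)" for n
  proof -
    have "poly_approx coords (polydisc \<rho>) (\<lambda>x. \<pi> x ^ n * F0 x)"
      by (rule poly_approx_coords_mult[OF F0 poly_gen_power[OF \<pi>_poly]])
    then show ?thesis by (simp add: f_def[abs_def] mult.commute)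
  qed
  define C where "C n = icoeff vs (f n)" for n
  have rec: "C (Suc n) \<gamma> = (\<Sum>k\<in>K. C n (\<lambda>v. \<gamma> v - int (count_list (us k) v))) +
      (\<Sum>i\<in>L. c i * C n (\<lambda>v. \<gamma> v - int (count_list (us' i) v)))" for n \<gamma>
  proof -
    have "f (Suc n) = (\<lambda>x. \<Sum>i\<in>K <+> L. case_sum (\<lambda>_. 1) c i * (vars_prod (case_sum us us' i) x * f n x))"
      by (auto simp: fun_eq_iff f_def \<pi>_eq sum.Plus finK finL sum_distrib_left sum_distrib_right algebra_simps)
    then have "C (Suc n) \<gamma> = (\<Sum>i\<in>K <+> L. case_sum (\<lambda>_. 1) c i * icoeff vs (\<lambda>x. vars_prod (case_sum us us' i) x * f n x) \<gamma>)"
      unfolding C_def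
      by (simp only:) (rule icoeff_sum[OF \<rho> finite_Plus[OF finK finL] poly_approx_coords_mult[OF f poly_gen_vars_prod]])
    also have "\<dots> = (\<Sum>i\<in>K <+> L. case_sum (\<lambda>_. 1) c i * C n (\<lambda>v. \<gamma> v - int (count_list (case_sum us us' i) v)))"
    proof (intro sum.cong refl)
      fix i assume "i \<in> K <+> L"
      then have "set (case_sum us us' i) \<subseteq> set vs"
        using usZ us'Z unfolding Z_def by (elim PlusE) simp_all
      then show "case_sum (\<lambda>_. 1) c i * icoeff vs (\<lambda>x. vars_prod (case_sum us us' i) x * f n x) \<gamma>
          = case_sum (\<lambda>_. 1) c i * C n (\<lambda>v. \<gamma> v - int (count_list (case_sum us us' i) v))"
        unfolding C_def by (subst icoeff_vars_prod[OF \<rho> f dist]) auto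
    qed
    finally show ?thesis by (simp add: sum.Plus finK finL)
  qed
  obtain \<tau> :: real where \<tau>: "0 < \<tau>" "\<tau> < 1"
    and trans: "\<And>(c :: nat \<Rightarrow> int) n. (\<Sum>i\<le>n. of_int (c i) * \<tau> ^ i) = 0 \<Longrightarrow> \<forall>i\<le>n. c i = 0"
    using ex_transcendental by blast
  \<comment> \<open>Each pair of variables shares weight 1 and each linear term has weight 1. The
    products indexed by \<open>L\<close> contain a variable of weight 1 and a further one of
    positive weight, so they weigh more than 1.\<close>
  define \<omega> :: "nat + nat \<Rightarrow> real" where
    "\<omega> = case_sum (\<lambda>j. if j < N then \<tau> ^ Suc j else 1) (\<lambda>j. if j < N then 1 - \<tau> ^ Suc j else 1)"
  have \<tau>p: "0 < \<tau> ^ Suc j" "\<tau> ^ Suc j < 1" for j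
    using \<tau> power_Suc_less_one[of \<tau> j] by auto
  have \<omega>: "\<omega> v > 0" for v using \<tau>p by (cases v) (auto simp: \<omega>_def simp del: power_Suc)
  have wsum: "(\<Sum>v\<in>Z. \<mu> v * of_int (int (count_list xs v))) = (\<Sum>u\<leftarrow>xs. \<mu> u)"
    if "set xs \<subseteq> Z" for \<mu> :: "nat + nat \<Rightarrow> real" and xs
    by (rule sum_count_list) (use that in \<open>auto simp: Z_def\<close>)
  have "\<exists>\<gamma>. C 0 \<gamma> \<noteq> 0"
  proof (rule ccontr)
    assume "\<not> ?thesis"
    then have C0: "C 0 \<gamma> = 0" for \<gamma> by blast
    have "taylor_coeff vs \<gamma> (f 0) = 0" for \<gamma>
      using C0[of "\<lambda>v. int (\<gamma> v)"] by (simp add: C_def icoeff_def)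
    then have "f 0 x0 = 0"
      by (rule zero_if_taylor_coeff_zero[OF \<rho> f dist _ x0(1)]) (use x0(3) Zeq in \<open>auto simp: Z_def\<close>)
    then show False using x0(2) by (simp add: f_def)
  qed
  then obtain \<gamma>1 where \<gamma>1: "C 0 \<gamma>1 \<noteq> 0" by blast
  have nonneg: "\<gamma> v \<ge> 0" if "C 0 \<gamma> \<noteq> 0" "v \<in> Z" for \<gamma> v
    using that by (auto simp: C_def icoeff_def Z_def split: if_splits)
  obtain \<gamma>0 where \<gamma>0: "C 0 \<gamma>0 \<noteq> 0"
    "\<And>\<gamma>. C 0 \<gamma> \<noteq> 0 \<Longrightarrow> (\<Sum>v\<in>Z. \<omega> v * of_int (\<gamma>0 v)) \<le> (\<Sum>v\<in>Z. \<omega> v * of_int (\<gamma> v))"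
    using ex_minimal_weight[of Z \<omega> "\<lambda>\<gamma>. C 0 \<gamma> \<noteq> 0" \<gamma>1] \<gamma>1 nonneg \<omega> by (auto simp: Z_def)
  define \<sigma> where "\<sigma> k = (if k < N then \<tau> ^ Suc k else if k = N then 1 else 0)" for k
  have s: "(\<Sum>v\<in>Z. (if isl v then \<omega> v else 0) * of_int (int (count_list (us k) v))) = \<sigma> k" if "k \<in> K" for k
    by (subst wsum[OF usZ[OF that]]) (simp add: us_def \<omega>_def \<sigma>_def)
  have "(card K + d - 1) choose d \<le> r"
  proof (rule weighted_rank_bound[where C = C and \<delta> = "\<lambda>k v. int (count_list (us k) v)" and
        \<delta>' = "\<lambda>i v. int (count_list (us' i) v)" and \<omega> = \<omega> and Z = Z and c = c and L = L,
        OF finK finL _ _ _ _ \<gamma>0(1)])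
    show "C (Suc n) \<gamma> = (\<Sum>k\<in>K. C n (\<lambda>v. \<gamma> v - int (count_list (us k) v))) +
      (\<Sum>i\<in>L. c i * C n (\<lambda>v. \<gamma> v - int (count_list (us' i) v)))" for n \<gamma> by (rule rec)
    show "(\<Sum>v\<in>Z. \<omega> v * of_int (\<gamma>0 v)) \<le> (\<Sum>v\<in>Z. \<omega> v * of_int (\<gamma> v))" if "C 0 \<gamma> \<noteq> 0" for \<gamma>
      by (rule \<gamma>0(2)[OF that])
    show "\<gamma> v \<ge> 0" if "C 0 \<gamma> \<noteq> 0" "v \<in> Z" for \<gamma> v by (rule nonneg[OF that])
    show "finite Z" by (simp add: Z_def)
    show "(\<Sum>v\<in>Z. \<omega> v * of_int (int (count_list (us k) v))) = 1" if "k \<in> K" for k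
      by (subst wsum[OF usZ[OF that]]) (simp add: us_def \<omega>_def)
    show "1 < (\<Sum>v\<in>Z. \<omega> v * of_int (int (count_list (us' i) v)))" if "i \<in> L" for i
      by (subst wsum[OF us'Z[OF that]]) (use \<tau>p in \<open>auto simp: us'_def \<omega>_def simp del: power_Suc split: sum.splits\<close>)
    show "\<exists>v\<in>Z. int (count_list (us k) v) = 1 \<and> (\<forall>k'\<in>K - {k}. int (count_list (us k') v) = 0)" if k: "k \<in> K" for k
    proof (rule bexI[of _ "if k \<le> N then Inl k else Inr N"])
      show "(if k \<le> N then Inl k else Inr N) \<in> Z" by (auto simp: Zeq)
      show "int (count_list (us k) (if k \<le> N then Inl k else Inr N)) = 1 \<and>
          (\<forall>k'\<in>K - {k}. int (count_list (us k') (if k \<le> N then Inl k else Inr N)) = 0)"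
        using k by (auto simp: us_def K_def split: if_splits)
    qed
    show "\<forall>k\<in>K. n k = 0"
      if *: "(\<Sum>k\<in>K. of_int (n k) * (\<Sum>v\<in>Z. (if isl v then \<omega> v else 0) * of_int (int (count_list (us k) v)))) = 0"
        and **: "(\<Sum>k\<in>K. n k) = 0" for n :: "nat \<Rightarrow> int"
    proof -
      have a: "(\<Sum>k\<in>K. of_int (n k) * \<sigma> k) = 0" using * s by simp
      \<comment> \<open>The \<open>Inl\<close> weights of the summands are the powers
        \<open>\<tau>\<close>, ..., \<open>\<tau> ^ N\<close>, then 1 and 0, so a relation between
        them is an integer polynomial in \<open>\<tau>\<close> with constant term
        \<open>n N\<close>.\<close>
      define b where "b i = (if i = 0 then (if e then n N else 0) else n (i - 1))" for i
      have "(\<Sum>i\<le>N. of_int (b i) * \<tau> ^ i) = of_int (b 0) + (\<Sum>i<N. of_int (b (Suc i)) * \<tau> ^ Suc i)"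
        by (simp add: sum.atMost_shift)
      also have "\<dots> = (\<Sum>k\<in>K. of_int (n k) * \<sigma> k)"
        unfolding sumK by (simp add: b_def \<sigma>_def)
      finally have "\<forall>i\<le>N. b i = 0" using a trans[of b N] by simp
      then have n1: "n k = 0" if "k < N" for k
        using that by (auto simp: b_def dest!: spec[of _ "Suc k"])
      have n2: "e \<Longrightarrow> n N = 0" using \<open>\<forall>i\<le>N. b i = 0\<close> by (auto simp: b_def dest!: spec[of _ 0])
      \<comment> \<open>The term \<open>x (Inr N)\<close> has \<open>Inl\<close> weight 0 and is
        invisible in the polynomial; the vanishing of the sum takes care of it.\<close>
      have n3: "e' \<Longrightarrow> n (Suc N) = 0"
        using ** n1 n2 unfolding sumK by (auto split: if_splits)
      show ?thesis using n1 n2 n3 by (auto simp: K_def split: if_splits)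
    qed
    show "sep_rank_le r UNIV UNIV (\<lambda>\<alpha> \<beta>. C d (case_sum \<alpha> \<beta>))"
      unfolding C_def vs_def
      by (rule sep_rank_le_icoeff[OF \<rho> f]) (use rank in \<open>simp add: f_def \<pi>_def\<close>)
  qed
  then show ?thesis by (simp add: cardK)
qed

section \<open>Sesquilinear forms\<close>

text \<open>The binomial theorem splits off one product \<open>f m x * g m y\<close>; every power of
  it is again a single product, and the remaining powers are covered by induction on
  \<open>m\<close>.\<close>

lemma sep_rank_le_power:
  assumes "sep_rank_le m X Y F"
  shows "sep_rank_le ((m + d - 1) choose d) X Y (\<lambda>x y. F x y ^ d)"
proof -
  obtain f g where fg: "\<And>x y. x \<in> X \<Longrightarrow> y \<in> Y \<Longrightarrow> F x y = (\<Sum>k<m. f k x * g k y)"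
    using assms unfolding sep_rank_le_def by metis
  have "sep_rank_le ((m + d - 1) choose d) X Y (\<lambda>x y. (\<Sum>k<m. f k x * g k y) ^ d)"
  proof (induction m arbitrary: d)
    case 0
    show ?case
    proof (cases d)
      case 0
      have "sep_rank_le (card {()}) X Y (\<lambda>x y. 1)"
        by (rule sep_rank_le_I[where f = "\<lambda>_ _. 1" and g = "\<lambda>_ _. 1"]) auto
      then show ?thesis by (simp add: 0)
    qed (simp add: sep_rank_le_0 binomial_eq_0)
  next
    case (Suc m)
    have "sep_rank_le (\<Sum>k\<le>d. (m + k - 1) choose k) X Y
        (\<lambda>x y. \<Sum>k\<le>d. (of_nat (d choose k) * f m x ^ (d - k)) * (g m y ^ (d - k)) * (\<Sum>k<m. f k x * g k y) ^ k)"
      by (intro sep_rank_le_sum sep_rank_le_mult Suc.IH) simp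
    moreover have "(\<Sum>k<Suc m. f k x * g k y) ^ d = (\<Sum>k\<le>d. (of_nat (d choose k) * f m x ^ (d - k)) *
        (g m y ^ (d - k)) * (\<Sum>k<m. f k x * g k y) ^ k)" for x y
      by (simp add: binomial_ring power_mult_distrib mult_ac)
    \<comment> \<open>The hockey-stick identity. For \<open>m = 0\<close> truncated subtraction
      leaves only the summand \<open>k = 0\<close>.\<close>
    moreover have "(\<Sum>k\<le>d. (m + k - 1) choose k) = (Suc m + d - 1) choose d"
    proof (cases m)
      case 0
      have "(\<Sum>k\<le>d. (k - 1) choose k) = (\<Sum>k\<le>d. if k = 0 then 1 else 0)"
        by (intro sum.cong) (auto simp: binomial_eq_0)
      then show ?thesis by (simp add: 0)
    next
      case (Suc r)
      then show ?thesis using sum_choose_lower[of r d] by simp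
    qed
    ultimately show ?case by simp
  qed
  then show ?thesis
    by (rule sep_rank_le_reparam[where a = "\<lambda>x. x" and b = "\<lambda>y. y"]) (auto simp: fg)
qed

definition csubspace :: "(complex ^ 'n) set \<Rightarrow> bool" where
  "csubspace H \<longleftrightarrow> 0 \<in> H \<and> (\<forall>x\<in>H. \<forall>y\<in>H. x + y \<in> H) \<and> (\<forall>c. \<forall>x\<in>H. c *s x \<in> H)"

lemma csubspace_sum: "csubspace H \<Longrightarrow> (\<And>i. i \<in> I \<Longrightarrow> f i \<in> H) \<Longrightarrow> (\<Sum>i\<in>I. f i) \<in> H"
  by (induction I rule: infinite_finite_induct) (auto simp: csubspace_def)

lemma csubspace_diff:
  assumes "csubspace H" "x \<in> H" "y \<in> H"
  shows "x - y \<in> H"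
proof -
  have "x + (- 1) *s y \<in> H" using assms unfolding csubspace_def by blast
  then show ?thesis by (simp add: vec_eq_iff)
qed

locale sesquilinear =
  fixes B :: "complex ^ 'n \<Rightarrow> complex ^ 'n \<Rightarrow> complex"
  assumes add_left: "B (x + y) z = B x z + B y z"
    and scale_left: "B (c *s x) z = c * B x z"
    and add_right: "B x (y + z) = B x y + B x z"
    and scale_right: "B x (c *s z) = cnj c * B x z"
begin

lemma diff_left: "B (x - y) z = B x z - B y z"
  using add_left[of x "(- 1) *s y" z] scale_left[of "-1" y z] by simp

lemma diff_right: "B x (y - z) = B x y - B x z"
  using add_right[of x y "(- 1) *s z"] scale_right[of x "-1" z] by simp

lemma zero_left: "B 0 z = 0" using scale_left[of 0 0 z] by simp

lemma zero_right: "B x 0 = 0" using scale_right[of x 0 0] by simp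

lemma sum_left: "B (\<Sum>i\<in>I. f i) z = (\<Sum>i\<in>I. B (f i) z)"
  by (induction I rule: infinite_finite_induct) (auto simp: zero_left add_left)

lemma sum_right: "B x (\<Sum>i\<in>I. f i) = (\<Sum>i\<in>I. B x (f i))"
  by (induction I rule: infinite_finite_induct) (auto simp: zero_right add_right)

text \<open>A biorthogonal system of maximal length represents the form: otherwise the components of a
  witnessing pair orthogonal to the system extend it.\<close>

lemma ex_biorthogonal_system:
  assumes H: "csubspace H" and H': "csubspace H'" and rank: "sep_rank_le n H H' B"
  shows "\<exists>(N :: nat) v v'. (\<forall>k<N. v k \<in> H \<and> v' k \<in> H') \<and> (\<forall>j<N. \<forall>k<N. B (v j) (v' k) = (if j = k then 1 else 0)) \<and>
    (\<forall>h\<in>H. \<forall>g\<in>H'. B h g = (\<Sum>k<N. B h (v' k) * B (v k) g))"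
proof -
  define good where "good N \<longleftrightarrow> (\<exists>v v'. (\<forall>k<N. v k \<in> H \<and> v' k \<in> H') \<and>
    (\<forall>j<N. \<forall>k<N. B (v j) (v' k) = (if j = k then 1 else 0)))" for N :: nat
  have bound: "N \<le> n" if good: "good N" for N
  proof -
    obtain v v' where v: "\<forall>k<N. v k \<in> H \<and> v' k \<in> H'"
      "\<forall>j<N. \<forall>k<N. B (v j) (v' k) = (if j = k then 1 else 0)" using good unfolding good_def by blast
    \<comment> \<open>The values of \<open>B\<close> on the system form an identity matrix, whose
      size is at most the rank.\<close>
    have "card {..<N} \<le> n"
      by (rule card_le_sep_rank[where key = "\<lambda>k. k" and F = "\<lambda>j k. B (v j) (v' k)"])
         (auto intro!: sep_rank_le_reparam[OF rank, of _ v _ v'] simp: v inj_on_def)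
    then show ?thesis by simp
  qed
  have "good 0" by (simp add: good_def)
  define N where "N = (GREATEST N. good N)"
  have N: "good N" unfolding N_def by (rule GreatestI_nat[of good, OF \<open>good 0\<close>]) (use bound in blast)
  have nS: "\<not> good (Suc N)"
  proof
    assume "good (Suc N)"
    then have "Suc N \<le> N" unfolding N_def by (rule Greatest_le_nat) (use bound in blast)
    then show False by simp
  qed
  obtain v v' where v: "\<And>k. k < N \<Longrightarrow> v k \<in> H" "\<And>k. k < N \<Longrightarrow> v' k \<in> H'"
    "\<And>j k. j < N \<Longrightarrow> k < N \<Longrightarrow> B (v j) (v' k) = (if j = k then 1 else 0)" using N unfolding good_def by blast
  have rep: "B h g = (\<Sum>k<N. B h (v' k) * B (v k) g)" if h: "h \<in> H" and g: "g \<in> H'" for h g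
  proof (rule ccontr)
    assume ne: "B h g \<noteq> (\<Sum>k<N. B h (v' k) * B (v k) g)"
    define c where "c = B h g - (\<Sum>k<N. B h (v' k) * B (v k) g)"
    have c: "c \<noteq> 0" using ne by (simp add: c_def)
    define x where "x = h - (\<Sum>k<N. B h (v' k) *s v k)"
    define y where "y = g - (\<Sum>k<N. cnj (B (v k) g) *s v' k)"
    have xv: "B x (v' j) = 0" if "j < N" for j
      using that by (simp add: x_def diff_left sum_left scale_left v(3) if_distrib[of "\<lambda>a. _ * a"] cong: if_cong)
    have vy: "B (v j) y = 0" if "j < N" for j
      using that by (simp add: y_def diff_right sum_right scale_right v(3) if_distrib[of "\<lambda>a. _ * a"] cong: if_cong)
    have "B x y = B x g" by (simp add: y_def diff_right sum_right scale_right xv)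
    also have "\<dots> = c" by (simp add: x_def c_def diff_left sum_left scale_left)
    finally have xy: "B ((1 / c) *s x) y = 1" using c by (simp add: scale_left)
    have xv': "B ((1 / c) *s x) (v' j) = 0" if "j < N" for j using xv[OF that] by (simp add: scale_left)
    have "x \<in> H" unfolding x_def
      using H by (intro csubspace_diff h csubspace_sum) (auto simp: csubspace_def v(1))
    then have xH: "(1 / c) *s x \<in> H" using H unfolding csubspace_def by blast
    have yH: "y \<in> H'" unfolding y_def
      using H' by (intro csubspace_diff g csubspace_sum) (auto simp: csubspace_def v(2))
    have "good (Suc N)"
      unfolding good_def
      by (intro exI[of _ "v(N := (1 / c) *s x)"] exI[of _ "v'(N := y)"])
         (auto simp: less_Suc_eq v xH yH xy xv' vy)
    with nS show False by blast
  qed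
  show ?thesis
    by (intro exI[of _ N] exI[of _ v] exI[of _ v'] conjI allI impI ballI) (rule v rep; assumption)+
qed

end

section \<open>Polynomials of bidegree at most (1,1)\<close>

lemma sum_degree_le_1:
  fixes f :: "('n :: finite \<Rightarrow> nat) \<Rightarrow> complex"
  shows "(\<Sum>\<alpha> | (\<Sum>i\<in>UNIV. \<alpha> i) \<le> 1. f \<alpha>) = f (\<lambda>_. 0) + (\<Sum>i\<in>UNIV. f (\<lambda>k. if k = i then 1 else 0))"
proof -
  let ?e = "\<lambda>(i :: 'n) k. if k = i then (1 :: nat) else 0"
  have eq: "{\<alpha>. (\<Sum>i\<in>(UNIV :: 'n set). \<alpha> i) \<le> (1 :: nat)} = insert (\<lambda>_. 0) (range ?e)"
  proof (intro equalityI subsetI)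
    fix \<alpha> :: "'n \<Rightarrow> nat" assume a: "\<alpha> \<in> {\<alpha>. (\<Sum>i\<in>UNIV. \<alpha> i) \<le> 1}"
    show "\<alpha> \<in> insert (\<lambda>_. 0) (range ?e)"
    proof (cases "\<exists>i. \<alpha> i \<noteq> 0")
      case True
      then obtain i where i: "\<alpha> i \<noteq> 0" by blast
      have "\<alpha> i + (\<Sum>k\<in>UNIV - {i}. \<alpha> k) \<le> 1" using a by (simp add: sum.remove[of UNIV i])
      then have "\<alpha> i = 1" and s0: "(\<Sum>k\<in>UNIV - {i}. \<alpha> k) = 0" using i by linarith+
      moreover have "\<alpha> k = 0" if "k \<noteq> i" for k
        using s0 that by (simp add: sum_eq_0_iff)
      ultimately have "\<alpha> = ?e i" by (auto simp: fun_eq_iff)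
      then show ?thesis by blast
    next
      case False
      then have "\<alpha> = (\<lambda>_. 0)" by auto
      then show ?thesis by simp
    qed
  qed auto
  have "inj ?e" by (rule injI) (metis zero_neq_one)
  moreover have "(\<lambda>_. 0) \<notin> range ?e"
  proof
    assume "(\<lambda>_. 0) \<in> range ?e"
    then obtain i where "(\<lambda>_. 0) = ?e i" by blast
    from fun_cong[OF this, of i] show False by simp
  qed
  ultimately show ?thesis unfolding eq by (simp add: sum.reindex)
qed

lemma bidegree_1_1_expansion:
  fixes P :: "complex ^ 'n \<Rightarrow> complex"
  assumes "polynomial_bidegree_le 1 1 P"
  shows "\<exists>c a b M. \<forall>z. P z = c + (\<Sum>i\<in>UNIV. a i * z $ i) + (\<Sum>j\<in>UNIV. b j * cnj (z $ j)) +
    (\<Sum>i\<in>UNIV. \<Sum>j\<in>UNIV. M i j * (z $ i) * cnj (z $ j))"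
proof -
  let ?e = "\<lambda>(i :: 'n) k. if k = i then (1 :: nat) else 0"
  obtain C where C: "\<And>z. P z = (\<Sum>\<alpha> | (\<Sum>i\<in>UNIV. \<alpha> i) \<le> 1. \<Sum>\<beta> | (\<Sum>i\<in>UNIV. \<beta> i) \<le> 1.
               C \<alpha> \<beta> * (\<Prod>i\<in>UNIV. (z $ i) ^ \<alpha> i) * (\<Prod>i\<in>UNIV. cnj (z $ i) ^ \<beta> i))"
    using assms unfolding polynomial_bidegree_le_def by blast
  have m: "(\<Prod>i\<in>UNIV. x i ^ ?e j i) = x j" for x :: "'n \<Rightarrow> complex" and j
  proof -
    have "(\<Prod>i\<in>UNIV. x i ^ ?e j i) = (\<Prod>i\<in>UNIV. if i = j then x i else 1)"
      by (intro prod.cong) auto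
    then show ?thesis by simp
  qed
  have "P z = C (\<lambda>_. 0) (\<lambda>_. 0) + (\<Sum>i\<in>UNIV. C (?e i) (\<lambda>_. 0) * z $ i) + (\<Sum>j\<in>UNIV. C (\<lambda>_. 0) (?e j) * cnj (z $ j)) +
    (\<Sum>i\<in>UNIV. \<Sum>j\<in>UNIV. C (?e i) (?e j) * (z $ i) * cnj (z $ j))" for z
    unfolding C sum_degree_le_1 by (simp add: m sum.distrib algebra_simps)
  then show ?thesis by (intro exI allI)
qed

section \<open>Adapted coordinates\<close>

lemma norm_sum_cscale_le:
  fixes f :: "'i \<Rightarrow> complex ^ 'n"
  assumes "\<And>i. i \<in> I \<Longrightarrow> norm (c i) \<le> K"
  shows "norm (\<Sum>i\<in>I. c i *s f i) \<le> K * (\<Sum>i\<in>I. norm (f i))"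
proof -
  have "norm (\<Sum>i\<in>I. c i *s f i) \<le> (\<Sum>i\<in>I. norm (c i) * norm (f i))"
    using norm_sum[of "\<lambda>i. c i *s f i" I] by (simp add: norm_cscale)
  also have "\<dots> \<le> (\<Sum>i\<in>I. K * norm (f i))"
    by (intro sum_mono mult_right_mono assms) auto
  finally show ?thesis by (simp add: sum_distrib_left)
qed

context sesquilinear
begin

text \<open>The same \<open>m\<close> bounds the rank of \<open>Pol\<close> from above and enters
  the lower bound: it counts the biorthogonal pairs on the kernels of \<open>a\<close> and
  \<open>b\<close>, and one more for each of these forms that is nonzero. It depends on neither
  \<open>Q\<close> nor \<open>d\<close>, and \<open>Q = 1\<close> will give the exact rank of
  powers.\<close>

lemma product_rank_lower_bound:
  fixes a b :: "complex ^ 'n \<Rightarrow> complex" and Pol Q :: "complex ^ 'n \<Rightarrow> complex ^ 'n \<Rightarrow> complex"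
  assumes a: "\<And>x y. a (x + y) = a x + a y" "\<And>c x. a (c *s x) = c * a x"
    and b: "\<And>x y. b (x + y) = b x + b y" "\<And>c x. b (c *s x) = cnj c * b x"
    and Pol: "\<And>h g. Pol (p + h) (p + g) = a h + b g + B h g"
    and rankB: "sep_rank_le n0 UNIV UNIV B"
  shows "\<exists>m. sep_rank_le m UNIV UNIV Pol \<and>
    (\<forall>r Q n d. r > 0 \<longrightarrow> poly_approx sesqui_coords (ball p r \<times> ball p r) (\<lambda>X. Q (fst X) (snd X)) \<longrightarrow>
      (\<exists>z\<in>ball p r. \<exists>w\<in>ball p r. Q z w \<noteq> 0) \<longrightarrow>
      sep_rank_le n (ball p r) (ball p r) (\<lambda>z w. Q z w * Pol z w ^ d) \<longrightarrow> (m + d - 1) choose d \<le> n)"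
proof -
  define e where "e \<longleftrightarrow> (\<exists>h. a h \<noteq> 0)"
  define e' where "e' \<longleftrightarrow> (\<exists>g. b g \<noteq> 0)"
  have a0: "a 0 = 0" using a(2)[of 0 0] by simp
  have b0: "b 0 = 0" using b(2)[of 0 0] by simp
  have adiff: "a (x - y) = a x - a y" for x y using a(1)[of x "(- 1) *s y"] a(2)[of "- 1" y] by simp
  have bdiff: "b (x - y) = b x - b y" for x y using b(1)[of x "(- 1) *s y"] b(2)[of "- 1" y] by simp
  have asum: "a (\<Sum>i\<in>I. f i) = (\<Sum>i\<in>I. a (f i))" for I and f :: "nat \<Rightarrow> _"
    by (induction I rule: infinite_finite_induct) (auto simp: a0 a)
  have bsum: "b (\<Sum>i\<in>I. f i) = (\<Sum>i\<in>I. b (f i))" for I and f :: "nat \<Rightarrow> _"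
    by (induction I rule: infinite_finite_induct) (auto simp: b0 b)
  have "\<exists>h1. (if e then a h1 = 1 else h1 = 0)"
  proof (cases e)
    case True
    then obtain h where "a h \<noteq> 0" by (auto simp: e_def)
    then have "a ((1 / a h) *s h) = 1" by (simp add: a)
    then show ?thesis using True by auto
  qed simp
  then obtain h1 where h1: "if e then a h1 = 1 else h1 = 0" by blast
  have "\<exists>g1. (if e' then b g1 = 1 else g1 = 0)"
  proof (cases e')
    case True
    then obtain g where "b g \<noteq> 0" by (auto simp: e'_def)
    then have "b (cnj (1 / b g) *s g) = 1" by (simp add: b)
    then show ?thesis using True by auto
  qed simp
  then obtain g1 where g1: "if e' then b g1 = 1 else g1 = 0" by blast
  have ah1: "a h1 = of_bool e" using h1 a0 by (auto split: if_splits)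
  have bg1: "b g1 = of_bool e'" using g1 b0 by (auto split: if_splits)
  have ne: "a h = 0" if "\<not> e" for h using that by (auto simp: e_def)
  have ne': "b g = 0" if "\<not> e'" for g using that by (auto simp: e'_def)
  define H where "H = {h. a h = 0}"
  define H' where "H' = {g. b g = 0}"
  have projH: "h - a h *s h1 \<in> H" for h
    using ne[of h] ne[of 0] by (cases e) (auto simp: H_def adiff a ah1)
  have projH': "g - cnj (b g) *s g1 \<in> H'" for g
    using ne'[of g] by (cases e') (auto simp: H'_def bdiff b bg1)
  have "csubspace H" "csubspace H'" by (auto simp: csubspace_def H_def H'_def a b a0 b0)
  from ex_biorthogonal_system[OF this sep_rank_le_subset[OF rankB subset_UNIV subset_UNIV]]
  obtain N :: nat and v v' where sys: "(\<forall>k<N. v k \<in> H \<and> v' k \<in> H') \<and>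
    (\<forall>j<N. \<forall>k<N. B (v j) (v' k) = (if j = k then 1 else 0)) \<and>
    (\<forall>h\<in>H. \<forall>g\<in>H'. B h g = (\<Sum>k<N. B h (v' k) * B (v k) g))" by (elim exE)
  have v: "v k \<in> H" "v' k \<in> H'" if "k < N" for k using sys that by blast+
  have vv: "B (v j) (v' k) = (if j = k then 1 else 0)" if "j < N" "k < N" for j k using sys that by blast
  have rep: "B h g = (\<Sum>k<N. B h (v' k) * B (v k) g)" if "h \<in> H" "g \<in> H'" for h g using sys that by blast
  define m where "m = N + of_bool e + of_bool e'"
  have upper: "sep_rank_le m UNIV UNIV Pol"
  proof -
    define h0 where "h0 h = h - a h *s h1" for h
    define g0 where "g0 g = g - cnj (b g) *s g1" for g
    \<comment> \<open>The parts of \<open>B\<close> involving \<open>h1\<close> or \<open>g1\<close>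
      contain a factor \<open>a h\<close> or \<open>b g\<close>. They merge with the linear terms
      and cost no further rank.\<close>
    have dec: "a h + b g + B h g = (\<Sum>k<N. B (h0 h) (v' k) * B (v k) (g0 g)) + a h * (1 + B h1 g) + (1 + B (h0 h) g1) * b g" for h g
    proof -
      have "B h g = B (h0 h) g + a h * B h1 g" by (simp add: h0_def diff_left scale_left)
      also have "B (h0 h) g = B (h0 h) (g0 g) + b g * B (h0 h) g1" by (simp add: g0_def diff_right scale_right)
      also have "B (h0 h) (g0 g) = (\<Sum>k<N. B (h0 h) (v' k) * B (v k) (g0 g))"
        by (rule rep) (auto simp: h0_def g0_def projH projH')
      finally show ?thesis by (simp add: algebra_simps)
    qed
    have 1: "sep_rank_le N UNIV UNIV (\<lambda>z w. \<Sum>k<N. B (h0 (z - p)) (v' k) * B (v k) (g0 (w - p)))"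
      using sep_rank_le_I[of "{..<N}" UNIV UNIV _ "\<lambda>k z. B (h0 (z - p)) (v' k)" "\<lambda>k w. B (v k) (g0 (w - p))"] by simp
    have 2: "sep_rank_le (of_bool e) UNIV UNIV (\<lambda>z w. a (z - p) * (1 + B h1 (w - p)))"
    proof (cases e)
      case True
      have "sep_rank_le (card {()}) UNIV UNIV (\<lambda>z w. a (z - p) * (1 + B h1 (w - p)))"
        by (rule sep_rank_le_I[where f = "\<lambda>_ z. a (z - p)" and g = "\<lambda>_ w. 1 + B h1 (w - p)"]) auto
      then show ?thesis using True by simp
    qed (simp add: sep_rank_le_0 ne)
    have 3: "sep_rank_le (of_bool e') UNIV UNIV (\<lambda>z w. (1 + B (h0 (z - p)) g1) * b (w - p))"
    proof (cases e')
      case True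
      have "sep_rank_le (card {()}) UNIV UNIV (\<lambda>z w. (1 + B (h0 (z - p)) g1) * b (w - p))"
        by (rule sep_rank_le_I[where f = "\<lambda>_ z. 1 + B (h0 (z - p)) g1" and g = "\<lambda>_ w. b (w - p)"]) auto
      then show ?thesis using True by simp
    qed (simp add: sep_rank_le_0 ne')
    have "Pol = (\<lambda>z w. (\<Sum>k<N. B (h0 (z - p)) (v' k) * B (v k) (g0 (w - p))) + a (z - p) * (1 + B h1 (w - p)) +
        (1 + B (h0 (z - p)) g1) * b (w - p))"
    proof (intro ext)
      fix z w
      have "Pol (p + (z - p)) (p + (w - p)) = (\<Sum>k<N. B (h0 (z - p)) (v' k) * B (v k) (g0 (w - p))) +
          a (z - p) * (1 + B h1 (w - p)) + (1 + B (h0 (z - p)) g1) * b (w - p)"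
        unfolding Pol dec ..
      then show "Pol z w = (\<Sum>k<N. B (h0 (z - p)) (v' k) * B (v k) (g0 (w - p))) +
          a (z - p) * (1 + B h1 (w - p)) + (1 + B (h0 (z - p)) g1) * b (w - p)" by simp
    qed
    with sep_rank_le_add[OF sep_rank_le_add[OF 1 2] 3] show ?thesis by (simp add: m_def)
  qed
  have lower: "(m + d - 1) choose d \<le> n"
    if r: "r > 0" and Q: "poly_approx sesqui_coords (ball p r \<times> ball p r) (\<lambda>X. Q (fst X) (snd X))"
      and Qzw: "z0 \<in> ball p r" "w0 \<in> ball p r" "Q z0 w0 \<noteq> 0"
      and rank: "sep_rank_le n (ball p r) (ball p r) (\<lambda>z w. Q z w * Pol z w ^ d)" for r Q n d z0 w0
  proof -
    define zh where "zh = z0 - p"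
    define wg where "wg = w0 - p"
    \<comment> \<open>What remains of \<open>z0 - p\<close> after removing its components along
      \<open>h1\<close> and the \<open>v k\<close>, and likewise \<open>ge\<close> for
      \<open>w0 - p\<close>. These two extra directions let \<open>N + 2\<close> coordinates on each
      side reach the point where \<open>Q\<close> is nonzero, without a basis of the whole space.
      They do not disturb the diagonal form, as \<open>B he ge = 0\<close> by
      \<open>rep\<close>.\<close>
    define he where "he = (zh - a zh *s h1) - (\<Sum>k<N. B (zh - a zh *s h1) (v' k) *s v k)"
    define ge where "ge = (wg - cnj (b wg) *s g1) - (\<Sum>k<N. cnj (B (v k) (wg - cnj (b wg) *s g1)) *s v' k)"
    have heH: "he \<in> H"
      unfolding he_def
      by (rule csubspace_diff[OF \<open>csubspace H\<close> projH csubspace_sum[OF \<open>csubspace H\<close>]])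
         (use \<open>csubspace H\<close> v(1) in \<open>auto simp: csubspace_def\<close>)
    have geH: "ge \<in> H'"
      unfolding ge_def
      by (rule csubspace_diff[OF \<open>csubspace H'\<close> projH' csubspace_sum[OF \<open>csubspace H'\<close>]])
         (use \<open>csubspace H'\<close> v(2) in \<open>auto simp: csubspace_def\<close>)
    have hev: "B he (v' j) = 0" if "j < N" for j
      using that unfolding he_def diff_left[of "zh - a zh *s h1"]
      by (simp add: sum_left scale_left vv if_distrib[of "\<lambda>a. _ * a"] cong: if_cong)
    have vge: "B (v j) ge = 0" if "j < N" for j
      using that unfolding ge_def diff_right[of _ "wg - cnj (b wg) *s g1"]
      by (simp add: sum_right scale_right vv if_distrib[of "\<lambda>a. _ * a"] cong: if_cong)
    have hege: "B he ge = 0" using rep[OF heH geH] hev by simp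
    define hv where "hv j = (if j < N then v j else if j = N then h1 else he)" for j
    define gv where "gv j = (if j < N then v' j else if j = N then g1 else ge)" for j
    define \<zeta> where "\<zeta> x = (\<Sum>j\<le>Suc N. x j *s hv j)" for x
    define \<eta> where "\<eta> y = (\<Sum>j\<le>Suc N. cnj (y j) *s gv j)" for y
    have hvH: "hv j \<in> H" if "j \<noteq> N" "j \<le> Suc N" for j using that v(1) heH by (auto simp: hv_def)
    have gvH: "gv j \<in> H'" if "j \<noteq> N" "j \<le> Suc N" for j using that v(2) geH by (auto simp: gv_def)
    have Suc_split: "(\<Sum>j\<le>Suc N. f j) = (\<Sum>j<N. f j) + f N + f (Suc N)" for f :: "nat \<Rightarrow> 'z :: comm_monoid_add"
      by (simp add: lessThan_Suc_atMost[symmetric])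
    have a\<zeta>: "a (\<zeta> x) = (if e then x N else 0)" for x
    proof -
      have "a (\<zeta> x) = (\<Sum>j\<le>Suc N. x j * a (hv j))" by (simp add: \<zeta>_def asum a)
      also have "\<dots> = x N * a h1"
        unfolding Suc_split using v(1) heH by (simp add: hv_def H_def)
      finally show ?thesis by (simp add: ah1)
    qed
    have b\<eta>: "b (\<eta> y) = (if e' then y N else 0)" for y
    proof -
      have "b (\<eta> y) = (\<Sum>j\<le>Suc N. y j * b (gv j))" by (simp add: \<eta>_def bsum b)
      also have "\<dots> = y N * b g1"
        unfolding Suc_split using v(2) geH by (simp add: gv_def H'_def)
      finally show ?thesis by (simp add: bg1)
    qed
    define l where "l j = B h1 (gv j)" for j
    \<comment> \<open>The entry at \<open>N\<close> is 0 because the term in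
      \<open>x N * y N\<close> is already counted in \<open>l N\<close>.\<close>
    define l' where "l' j = (if j = N then 0 else B (hv j) g1)" for j
    have B\<zeta>\<eta>: "B (\<zeta> x) (\<eta> y) = (\<Sum>k<N. x k * y k) + ((\<Sum>j\<le>Suc N. l j * (x N * y j)) + (\<Sum>j\<le>Suc N. l' j * (y N * x j)))" for x y
    proof -
      define S where "S i = (\<Sum>j\<le>Suc N. y j * B (hv i) (gv j))" for i
      have "B (hv i) (\<eta> y) = S i" for i
        by (simp only: \<eta>_def S_def sum_right scale_right complex_cnj_cnj)
      moreover have "B (\<zeta> x) (\<eta> y) = (\<Sum>i\<le>Suc N. x i * B (hv i) (\<eta> y))"
        by (simp only: \<zeta>_def sum_left scale_left)
      ultimately have "B (\<zeta> x) (\<eta> y) = (\<Sum>i\<le>Suc N. x i * S i)" by simp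
      moreover have "S k = y k + y N * l' k" if k: "k < N" for k
        unfolding S_def Suc_split using k vge[OF k]
        by (simp add: hv_def gv_def l'_def vv if_distrib[of "\<lambda>a. _ * a"] cong: if_cong)
      moreover have "S (Suc N) = y N * l' (Suc N)"
        unfolding S_def Suc_split by (simp add: hv_def gv_def l'_def hev hege)
      moreover have "S N = (\<Sum>j\<le>Suc N. y j * l j)" by (simp add: S_def hv_def l_def)
      ultimately have "B (\<zeta> x) (\<eta> y) = (\<Sum>k<N. x k * (y k + y N * l' k)) + x N * (\<Sum>j\<le>Suc N. y j * l j) + x (Suc N) * (y N * l' (Suc N))"
        unfolding Suc_split[of "\<lambda>i. x i * S i"] by simp
      also have "\<dots> = (\<Sum>k<N. x k * y k) + ((\<Sum>j\<le>Suc N. l j * (x N * y j)) + (\<Sum>j\<le>Suc N. l' j * (y N * x j)))"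
        unfolding Suc_split[of "\<lambda>j. l' j * (y N * x j)"]
        by (simp add: sum_distrib_left sum.distrib algebra_simps l'_def[of N] del: sum.atMost_Suc)
      finally show ?thesis .
    qed
    have Pol\<zeta>\<eta>: "Pol (p + \<zeta> x) (p + \<eta> y) = adapted_form e e' N l l' (case_sum x y)" for x y
      unfolding Pol a\<zeta> b\<eta> B\<zeta>\<eta> adapted_form_def by simp
    define M where "M = (\<Sum>j\<le>Suc N. norm (hv j)) + (\<Sum>j\<le>Suc N. norm (gv j)) + 1"
    have M: "M > 0" "(\<Sum>j\<le>Suc N. norm (hv j)) \<le> M" "(\<Sum>j\<le>Suc N. norm (gv j)) \<le> M"
      using sum_nonneg[of "{..Suc N}" "\<lambda>j. norm (hv j)"] sum_nonneg[of "{..Suc N}" "\<lambda>j. norm (gv j)"]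
      by (simp_all add: M_def del: sum.atMost_Suc)
    \<comment> \<open>Keeps the image of the polydisc within distance \<open>r / 2\<close> of
      \<open>p\<close>.\<close>
    define \<rho> where "\<rho> = r / (2 * M)"
    have \<rho>: "\<rho> > 0" using r M(1) by (simp add: \<rho>_def)
    have \<rho>M: "\<rho> * M < r" using r M(1) by (simp add: \<rho>_def)
    have \<zeta>ball: "p + \<zeta> x \<in> ball p r" if "x \<in> polydisc \<rho>" for x
    proof -
      have "norm (\<zeta> x) \<le> \<rho> * (\<Sum>j\<le>Suc N. norm (hv j))"
        unfolding \<zeta>_def by (rule norm_sum_cscale_le) (use that in \<open>auto simp: polydisc_def intro: less_imp_le\<close>)
      also have "\<dots> \<le> \<rho> * M" using \<rho> M by (intro mult_left_mono) auto
      finally show ?thesis using \<rho>M by (simp add: dist_norm)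
    qed
    have \<eta>ball: "p + \<eta> y \<in> ball p r" if "y \<in> polydisc \<rho>" for y
    proof -
      have "norm (\<eta> y) \<le> \<rho> * (\<Sum>j\<le>Suc N. norm (gv j))"
        unfolding \<eta>_def by (rule norm_sum_cscale_le) (use that in \<open>auto simp: polydisc_def intro: less_imp_le\<close>)
      also have "\<dots> \<le> \<rho> * M" using \<rho> M by (intro mult_left_mono) auto
      finally show ?thesis using \<rho>M by (simp add: dist_norm)
    qed
    define F0 where "F0 x = Q (p + \<zeta> (\<lambda>j. x (Inl j))) (p + \<eta> (\<lambda>j. x (Inr j)))" for x :: "nat + nat \<Rightarrow> complex"
    have F0: "poly_approx coords (polydisc \<rho>) F0"
    proof -
      define \<sigma> where "\<sigma> x = (p + \<zeta> (\<lambda>j. x (Inl j)), p + \<eta> (\<lambda>j. x (Inr j)))" for x :: "nat + nat \<Rightarrow> complex"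
      have "poly_approx coords (polydisc \<rho>) (\<lambda>x. Q (fst (\<sigma> x)) (snd (\<sigma> x)))"
      proof (rule poly_approx_compose[OF Q])
        show "\<sigma> x \<in> ball p r \<times> ball p r" if "x \<in> polydisc \<rho>" for x
          using \<zeta>ball[of "\<lambda>j. x (Inl j)"] \<eta>ball[of "\<lambda>j. x (Inr j)"] that by (auto simp: \<sigma>_def polydisc_def)
        show "(\<lambda>x. f (\<sigma> x)) \<in> poly_gen coords" if f: "f \<in> sesqui_coords" for f
        proof -
          have c: "(\<lambda>x. x u) \<in> poly_gen coords" for u :: "nat + nat"
            by (rule poly_gen_base) (auto simp: coords_def)
          consider i where "f = (\<lambda>X. fst X $ i)" | i where "f = (\<lambda>X. cnj (snd X $ i))"
            using f by (auto simp: sesqui_coords_def)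
          then show ?thesis
          proof cases
            case (1 i)
            have "(\<lambda>x :: nat + nat \<Rightarrow> complex. p $ i + (\<Sum>j\<le>Suc N. (hv j $ i) * x (Inl j))) \<in> poly_gen coords"
              by (intro poly_gen_add poly_gen_const poly_gen_sum poly_gen_scale c)
            then show ?thesis by (simp add: 1 \<sigma>_def \<zeta>_def mult.commute del: sum.atMost_Suc)
          next
            case (2 i)
            have "(\<lambda>x :: nat + nat \<Rightarrow> complex. cnj (p $ i) + (\<Sum>j\<le>Suc N. cnj (gv j $ i) * x (Inr j))) \<in> poly_gen coords"
              by (intro poly_gen_add poly_gen_const poly_gen_sum poly_gen_scale c)
            then show ?thesis by (simp add: 2 \<sigma>_def \<eta>_def mult.commute del: sum.atMost_Suc)
          qed
        qed
      qed
      then show ?thesis by (simp add: \<sigma>_def F0_def[abs_def])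
    qed
    \<comment> \<open>The adapted coordinates of \<open>z0 - p\<close>; the remainder
      \<open>he\<close> has coordinate 1. Those of \<open>w0 - p\<close> follow.\<close>
    define x0 where "x0 j = (if j < N then B (zh - a zh *s h1) (v' j) else if j = N then a zh else 1)" for j
    define y0 where "y0 j = (if j < N then B (v j) (wg - cnj (b wg) *s g1) else if j = N then b wg else 1)" for j
    have \<zeta>x0: "\<zeta> (\<lambda>j. l * x0 j) = l *s zh" for l
    proof -
      have "\<zeta> x0 = zh"
        unfolding \<zeta>_def Suc_split by (simp add: x0_def hv_def he_def)
      moreover have "\<zeta> (\<lambda>j. l * x0 j) = l *s \<zeta> x0"
        by (simp add: \<zeta>_def vec_eq_iff sum_distrib_left mult_ac del: sum.atMost_Suc)
      ultimately show ?thesis by simp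
    qed
    have \<eta>y0: "\<eta> (\<lambda>j. l * y0 j) = cnj l *s wg" for l
    proof -
      have "\<eta> y0 = wg"
        unfolding \<eta>_def Suc_split by (simp add: y0_def gv_def ge_def)
      moreover have "\<eta> (\<lambda>j. l * y0 j) = cnj l *s \<eta> y0"
        by (simp add: \<eta>_def vec_eq_iff sum_distrib_left mult_ac del: sum.atMost_Suc)
      ultimately show ?thesis by simp
    qed
    have sQ: "sesqui_on Q (ball p r \<times> ball p r)"
      by (rule sesqui_on_poly_approx[OF _ Q]) (intro open_Times open_ball)
    \<comment> \<open>The coordinates \<open>x0\<close> and \<open>y0\<close> may lie outside the
      polydisc, but small multiples lie inside. If \<open>F0\<close> vanished at all of these,
      \<open>Q\<close> would vanish along the line through \<open>(z0, w0)\<close> near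
      \<open>(p, p)\<close>, and hence at \<open>(z0, w0)\<close>.\<close>
    have "\<exists>x\<in>polydisc \<rho>. F0 x \<noteq> 0 \<and> (\<forall>v. v \<notin> Inl ` {..Suc N} \<union> Inr ` {..Suc N} \<longrightarrow> x v = 0)"
    proof (rule ccontr)
      assume no: "\<not> ?thesis"
      define K where "K = (\<Sum>j\<le>Suc N. norm (x0 j)) + (\<Sum>j\<le>Suc N. norm (y0 j)) + 1"
      have s: "0 \<le> (\<Sum>j\<le>Suc N. norm (x0 j))" "0 \<le> (\<Sum>j\<le>Suc N. norm (y0 j))" by (intro sum_nonneg norm_ge_zero)+
      have K: "K > 0" using s by (simp add: K_def del: sum.atMost_Suc)
      have K1: "norm (x0 j) \<le> K" if "j \<le> Suc N" for j
        using member_le_sum[of j "{..Suc N}" "\<lambda>j. norm (x0 j)"] that s by (simp add: K_def del: sum.atMost_Suc)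
      have K2: "norm (y0 j) \<le> K" if "j \<le> Suc N" for j
        using member_le_sum[of j "{..Suc N}" "\<lambda>j. norm (y0 j)"] that s by (simp add: K_def del: sum.atMost_Suc)
      have "Q (p + zh) (p + wg) = 0"
      proof (rule sesqui_on_zero_along_line[OF sQ])
        show "\<rho> / K > 0" using \<rho> K by simp
        show "Q (p + l *s zh) (p + cnj l *s wg) = 0" if l: "norm l < \<rho> / K" for l
        proof -
          define x where "x = case_sum (\<lambda>j. if j \<le> Suc N then l * x0 j else 0) (\<lambda>j. if j \<le> Suc N then l * y0 j else 0)"
          have small: "norm (l * t) < \<rho>" if "norm t \<le> K" for t
          proof -
            have "norm (l * t) \<le> norm l * K" unfolding norm_mult by (intro mult_left_mono that) simp
            also have "\<dots> < \<rho>" using l K by (simp add: pos_less_divide_eq)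
            finally show ?thesis .
          qed
          have "x \<in> polydisc \<rho>"
            using small[OF K1] small[OF K2] \<rho> by (auto simp: polydisc_def x_def split: sum.splits)
          moreover have "x v = 0" if "v \<notin> Inl ` {..Suc N} \<union> Inr ` {..Suc N}" for v
            using that by (auto simp: x_def split: sum.splits)
          ultimately have "F0 x = 0" using no by blast
          moreover have "\<zeta> (\<lambda>j. x (Inl j)) = \<zeta> (\<lambda>j. l * x0 j)" "\<eta> (\<lambda>j. x (Inr j)) = \<eta> (\<lambda>j. l * y0 j)"
            by (auto simp: \<zeta>_def \<eta>_def x_def intro!: sum.cong simp del: sum.atMost_Suc)
          ultimately show ?thesis by (simp add: F0_def \<zeta>x0 \<eta>y0)
        qed
      qed (use Qzw r in \<open>auto simp: zh_def wg_def\<close>)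
      then show False using Qzw(3) by (simp add: zh_def wg_def)
    qed
    then obtain x where x: "x \<in> polydisc \<rho>" "F0 x \<noteq> 0" "\<And>v. v \<notin> Inl ` {..Suc N} \<union> Inr ` {..Suc N} \<Longrightarrow> x v = 0" by blast
    have "sep_rank_le n (polydisc \<rho>) (polydisc \<rho>) (\<lambda>x y. F0 (case_sum x y) * adapted_form e e' N l l' (case_sum x y) ^ d)"
      by (rule sep_rank_le_reparam[OF rank, where a = "\<lambda>x. p + \<zeta> x" and b = "\<lambda>y. p + \<eta> y"])
         (auto simp: \<zeta>ball \<eta>ball Pol\<zeta>\<eta> F0_def simp del: mem_ball)
    from product_rank_bound[OF \<rho> F0 x this] show ?thesis by (simp add: m_def)
  qed
  show ?thesis
    by (intro exI[of _ m] conjI upper allI impI) (use lower in blast)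
qed

end

section \<open>The rank theorem\<close>

lemma real_analytic_imp_polarizable:
  assumes "real_analytic_on Q U" "\<And>W. sesqui_on F W"
  shows "polarizable_on U (\<lambda>z. Q z * F z z)"
  unfolding polarizable_on_def
proof
  fix q assume "q \<in> U"
  with assms(1) obtain r G where G: "r > 0"
    "poly_approx sesqui_coords (ball q r \<times> ball q r) (\<lambda>X. G (fst X) (snd X))"
    "\<And>z. z \<in> ball q r \<Longrightarrow> G z z = Q z"
    by (rule real_analytic_on_polarization) blast
  have "sesqui_on G (ball q r \<times> ball q r)"
    by (rule sesqui_on_poly_approx[OF _ G(2)]) (intro open_Times open_ball)
  from sesqui_on_mult[OF this assms(2)]
  show "\<exists>r G. r > 0 \<and> sesqui_on G (ball q r \<times> ball q r) \<and> (\<forall>z\<in>ball q r. Q z * F z z = G z z)"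
    using G(1,3) by (intro exI[of _ r] exI[of _ "\<lambda>z w. G z w * F z w"]) simp
qed

theorem theorem1p1:
  fixes P Q :: "complex ^ 'n \<Rightarrow> complex"
    and p :: "complex ^ 'n"
    and U :: "(complex ^ 'n) set"
    and d :: nat
  assumes "polynomial_bidegree_le 1 1 P"
    and "P p = 0"
    and "open U" and "connected U" and "p \<in> U"
    and "real_analytic_on Q U"
    and "\<exists>z\<in>U. Q z \<noteq> 0"
  shows "hermitian_rank U (\<lambda>z. Q z * P z ^ d) \<ge> hermitian_rank UNIV (\<lambda>z. P z ^ d) \<and>
    (\<exists>m. hermitian_rank UNIV P = enat m \<and>
         hermitian_rank UNIV (\<lambda>z. P z ^ d) = enat ((m + d - 1) choose d))"
proof -
  obtain c a b M where P: "\<forall>z. P z = c + (\<Sum>i\<in>UNIV. a i * z $ i) + (\<Sum>j\<in>UNIV. b j * cnj (z $ j)) +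
    (\<Sum>i\<in>UNIV. \<Sum>j\<in>UNIV. M i j * (z $ i) * cnj (z $ j))"
    using bidegree_1_1_expansion[OF assms(1)] by (elim exE)
  define Pol where "Pol z w = c + (\<Sum>i\<in>UNIV. a i * z $ i) + (\<Sum>j\<in>UNIV. b j * cnj (w $ j)) +
    (\<Sum>i\<in>UNIV. \<Sum>j\<in>UNIV. M i j * (z $ i) * cnj (w $ j))" for z w
  define B where "B h g = (\<Sum>i\<in>UNIV. \<Sum>j\<in>UNIV. M i j * (h $ i) * cnj (g $ j))" for h g
  \<comment> \<open>The expansion is recentred at \<open>p\<close>: the mixed terms of
    \<open>B\<close> with \<open>p\<close> join the linear parts, and the constant term becomes
    \<open>P p = 0\<close>.\<close>
  define a' where "a' h = (\<Sum>i\<in>UNIV. a i * h $ i) + B h p" for h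
  define b' where "b' g = (\<Sum>j\<in>UNIV. b j * cnj (g $ j)) + B p g" for g
  have PolP: "Pol z z = P z" for z using P by (simp add: Pol_def)
  interpret sesquilinear B
    by unfold_locales (simp_all add: B_def sum.distrib sum_distrib_left algebra_simps)
  have PolB: "Pol (p + h) (p + g) = a' h + b' g + B h g" for h g
  proof -
    have "Pol (p + h) (p + g) = Pol p p + a' h + b' g + B h g"
      by (simp add: Pol_def a'_def b'_def B_def sum.distrib algebra_simps)
    then show ?thesis by (simp add: PolP assms(2))
  qed
  have "sep_rank_le (card (UNIV :: ('n \<times> 'n) set)) UNIV UNIV B"
    by (rule sep_rank_le_I[where f = "\<lambda>k h. M (fst k) (snd k) * (h $ fst k)" and g = "\<lambda>k g. cnj (g $ snd k)"])
       (simp_all add: B_def sum.cartesian_product case_prod_unfold)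
  note rank_bound = product_rank_lower_bound[where a = a' and b = b' and Pol = Pol and p = p, OF _ _ _ _ PolB this]
  have "a' (x + y) = a' x + a' y" "a' (s *s x) = s * a' x" "b' (x + y) = b' x + b' y" "b' (s *s x) = cnj s * b' x"
    for x y s
    by (simp_all add: a'_def b'_def add_left add_right scale_left scale_right sum.distrib sum_distrib_left algebra_simps)
  from rank_bound[OF this] obtain m where upper: "sep_rank_le m UNIV UNIV Pol"
    and lower: "\<And>r Q n d. r > 0 \<Longrightarrow> poly_approx sesqui_coords (ball p r \<times> ball p r) (\<lambda>X. Q (fst X) (snd X)) \<Longrightarrow>
      \<exists>z\<in>ball p r. \<exists>w\<in>ball p r. Q z w \<noteq> 0 \<Longrightarrow>
      sep_rank_le n (ball p r) (ball p r) (\<lambda>z w. Q z w * Pol z w ^ d) \<Longrightarrow> (m + d - 1) choose d \<le> n"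
    by blast
  have Pol: "sesqui_on Pol W" for W
    unfolding Pol_def[abs_def]
    by (intro sesqui_on_add sesqui_on_sum sesqui_on_mult sesqui_on_const sesqui_on_left sesqui_on_right)
  have rank_power: "hermitian_rank UNIV (\<lambda>z. P z ^ k) = enat ((m + k - 1) choose k)" for k
  proof -
    have pol: "polarizable_on UNIV (\<lambda>z. P z ^ k)"
      unfolding polarizable_on_def
      by (intro ballI exI[of _ 1] exI[of _ "\<lambda>z w. Pol z w ^ k"]) (simp add: PolP sesqui_on_power[OF Pol])
    have "hermitian_rank_at p (\<lambda>z. P z ^ k) = Inf {enat n | n. sep_rank_le n (ball p 1) (ball p 1) (\<lambda>z w. Pol z w ^ k)}"
      by (rule hermitian_rank_at_eq[OF sesqui_on_power[OF Pol]]) (simp_all add: PolP)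
    also have "\<dots> = enat ((m + k - 1) choose k)"
    proof (rule antisym)
      have "sep_rank_le ((m + k - 1) choose k) (ball p 1) (ball p 1) (\<lambda>z w. Pol z w ^ k)"
        by (rule sep_rank_le_subset[OF sep_rank_le_power[OF upper]]) auto
      then show "Inf {enat n | n. sep_rank_le n (ball p 1) (ball p 1) (\<lambda>z w. Pol z w ^ k)} \<le> enat ((m + k - 1) choose k)"
        by (intro Inf_lower) blast
      show "enat ((m + k - 1) choose k) \<le> Inf {enat n | n. sep_rank_le n (ball p 1) (ball p 1) (\<lambda>z w. Pol z w ^ k)}"
      proof (rule Inf_greatest)
        fix x assume "x \<in> {enat n | n. sep_rank_le n (ball p 1) (ball p 1) (\<lambda>z w. Pol z w ^ k)}"
        then obtain n where n: "x = enat n" "sep_rank_le n (ball p 1) (ball p 1) (\<lambda>z w. Pol z w ^ k)" by blast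
        have "(m + k - 1) choose k \<le> n"
        \<comment> \<open>With the constant factor 1 the bound for products becomes the lower bound
          for the power itself; exponent 1 then identifies \<open>m\<close> as the rank of
          \<open>P\<close>.\<close>
        proof (rule lower[where Q = "\<lambda>_ _. 1" and r = 1])
          show "\<exists>z\<in>ball p 1. \<exists>w\<in>ball p 1. (1 :: complex) \<noteq> 0"
            by (intro bexI[of _ p]) auto
        qed (use n in \<open>simp_all add: poly_approx_poly poly_gen_const\<close>)
        then show "enat ((m + k - 1) choose k) \<le> x" by (simp add: n(1))
      qed
    qed
    finally show ?thesis using hermitian_rank_eq[OF connected_UNIV pol UNIV_I, of p] by simp
  qed
  have rank_P: "hermitian_rank UNIV P = enat m" using rank_power[of 1] by simp
  have polQ: "polarizable_on U Q"
    using real_analytic_imp_polarizable[OF assms(6) sesqui_on_const[of 1]] by simp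
  have polQP: "polarizable_on U (\<lambda>z. Q z * P z ^ d)"
    using real_analytic_imp_polarizable[OF assms(6) sesqui_on_power[OF Pol, of d]] by (simp add: PolP)
  obtain r G where G: "r > 0"
    "poly_approx sesqui_coords (ball p r \<times> ball p r) (\<lambda>X. G (fst X) (snd X))"
    "\<And>z. z \<in> ball p r \<Longrightarrow> G z z = Q z"
    using real_analytic_on_polarization[OF assms(6,5)] by blast
  have sG: "sesqui_on G (ball p r \<times> ball p r)"
    by (rule sesqui_on_poly_approx[OF _ G(2)]) (intro open_Times open_ball)
  obtain z where z: "z \<in> ball p r" "Q z \<noteq> 0"
    using polarizable_on_nonzero_near[OF assms(4) polQ assms(5,7) G(1)] by blast
  have p: "p \<in> ball p r" using G(1) by simp
  have "hermitian_rank U (\<lambda>z. Q z * P z ^ d) = hermitian_rank_at p (\<lambda>z. Q z * P z ^ d)"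
    by (rule hermitian_rank_eq[OF assms(4) polQP assms(5)])
  also have "\<dots> = Inf {enat n | n. sep_rank_le n (ball p r) (ball p r) (\<lambda>z w. G z w * Pol z w ^ d)}"
    by (rule hermitian_rank_at_eq[OF sesqui_on_mult[OF sG sesqui_on_power[OF Pol]] _ p]) (simp add: G(3) PolP)
  also have "\<dots> \<ge> enat ((m + d - 1) choose d)"
  proof (rule Inf_greatest)
    fix x assume "x \<in> {enat n | n. sep_rank_le n (ball p r) (ball p r) (\<lambda>z w. G z w * Pol z w ^ d)}"
    then obtain n where n: "x = enat n" "sep_rank_le n (ball p r) (ball p r) (\<lambda>z w. G z w * Pol z w ^ d)" by blast
    have "\<exists>z\<in>ball p r. \<exists>w\<in>ball p r. G z w \<noteq> 0" using z G(3) by metis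
    from lower[OF G(1,2) this n(2)] show "enat ((m + d - 1) choose d) \<le> x" by (simp add: n(1))
  qed
  finally show ?thesis using rank_power[of d] rank_P by auto
qed

end
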